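(* Let $\ell>3$ be prime. Then $$\mathcal{R}_{\ell+1}-P_{\frac{\ell+1}{2}}(\delta_q)\,\mathcal{R}_2\in P\mathcal{X}_{\ell+1}.$$
   Context: $q=e^{2\pi iz}$, $\delta_q:=q\frac{d}{dq}$. The rank of a partition is its largest part minus its number of parts; $N(m,n)$ is the number of partitions of $n$ with rank $m$; $N_j(n):=\sum_mm^jN(m,n)$ and $\mathcal{R}_j:=\sum_{n\ge1}N_j(n)q^n$. $P_k(x)\in\mathbb{Q}[x]$ is defined by $P_0:=0$, $P_1:=1$, and for $k\ge2$, $P_k(x):=-\frac{1}{(2k-1)(k-1)}\sum_{i=1}^{k-1}\left(6x\binom{2k}{2i}(2^{2i-1}-1)+\binom{2k}{2i+2}(2^{2i+1}-1)-2^{2i}\binom{2k}{2i+1}+\binom{2k}{2i}\right)P_{k-i}(x)$. $P:=\prod_{n\ge1}(1-q^n)^{-1}$, $E_2:=1-24\sum_{n\ge1}\sigma_1(n)q^n$. An $\ell$-integral quasimodular form of weight $w$ and level 1 is a sum of functions $E_2^aF_b$, $a,b\ge0$, $2a+b=w$, with $F_b\in M_b(SL_2(\mathbb{Z}))$ having rational, $\ell$-integral coefficients with bounded denominators; for even $k$, $\mathcal{X}_k$ is the set of sums of such forms of weight $\le k$, and $P\mathcal{X}_k:=\{GP:G\in\mathcal{X}_k\}$. *)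

theory Defs
  imports Complex_Main "HOL-Library.Multiset" "HOL-Computational_Algebra.Formal_Power_Series"
    "HOL-Computational_Algebra.Polynomial" "HOL-Computational_Algebra.Primes"
begin

definition partitions :: "nat \<Rightarrow> nat multiset set" where
  "partitions n = {M. (\<forall>x\<in>#M. 0 < x) \<and> sum_mset M = n}"

definition rank :: "nat multiset \<Rightarrow> int" where
  "rank M = (if M = {#} then 0 else int (Max_mset M) - int (size M))"

definition Nrank :: "int \<Rightarrow> nat \<Rightarrow> nat" where
  "Nrank m n = card {M \<in> partitions n. rank M = m}"

text \<open>N_j(n) = sum over m of m^j N(m,n) (finite sum: only |m| \<le> n contribute).\<close>
definition Nmom :: "nat \<Rightarrow> nat \<Rightarrow> int" where
  "Nmom j n = (\<Sum>m\<in>{-int n..int n}. m ^ j * int (Nrank m n))"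

definition Rgen :: "nat \<Rightarrow> rat fps" where
  "Rgen j = Abs_fps (\<lambda>n. if n = 0 then 0 else of_int (Nmom j n))"

text \<open>P = prod_{n\<ge>1} (1-q^n)^{-1}, as formal power series: the coefficient of q^n
  is that of the finite product over k \<le> n (later factors do not affect it).\<close>
definition Pgen :: "rat fps" where
  "Pgen = Abs_fps (\<lambda>n. fps_nth (\<Prod>k\<in>{1..n}. inverse (1 - fps_X ^ k)) n)"

definition E2 :: "rat fps" where
  "E2 = Abs_fps (\<lambda>n. if n = 0 then 1 else - 24 * of_nat (\<Sum>d | d dvd n. d))"

text \<open>Applying a polynomial in delta_q = q d/dq to a q-series.\<close>
definition poly_delta :: "rat poly \<Rightarrow> rat fps \<Rightarrow> rat fps" where
  "poly_delta p F = Abs_fps (\<lambda>n. poly p (of_nat n) * fps_nth F n)"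

function Ppoly :: "nat \<Rightarrow> rat poly" where
  "Ppoly k = (if k = 0 then 0 else if k = 1 then 1 else
     smult (- 1 / (of_nat (2*k - 1) * of_nat (k - 1)))
       (\<Sum>i\<in>{1..k-1}.
          (smult (6 * of_nat (2*k choose (2*i)) * (2^(2*i-1) - 1)) [:0, 1:]
           + [: of_nat (2*k choose (2*i+2)) * (2^(2*i+1) - 1)
                - 2^(2*i) * of_nat (2*k choose (2*i+1))
                + of_nat (2*k choose (2*i)) :]) * Ppoly (k - i)))"
  by auto
termination
  by (relation "measure id") auto

definition qexp :: "rat fps \<Rightarrow> complex \<Rightarrow> complex" where
  "qexp F z = (\<Sum>n. of_rat (fps_nth F n) * exp (2 * pi * \<i> * z) ^ n)"

text \<open>F is (the q-expansion of) a modular form of weight k for SL_2(Z):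
  the series converges on the unit disc (so qexp F is holomorphic on the upper half
  plane and holomorphic at the cusp), and it is weight-k invariant under SL_2(Z).\<close>
definition modular_form :: "nat \<Rightarrow> rat fps \<Rightarrow> bool" where
  "modular_form k F \<longleftrightarrow>
     (\<forall>q::complex. norm q < 1 \<longrightarrow> summable (\<lambda>n. of_rat (fps_nth F n) * q ^ n)) \<and>
     (\<forall>a b c d :: int. a * d - b * c = 1 \<longrightarrow>
        (\<forall>z. 0 < Im z \<longrightarrow>
           qexp F ((of_int a * z + of_int b) / (of_int c * z + of_int d))
             = (of_int c * z + of_int d) ^ k * qexp F z))"

definition ell_integral :: "nat \<Rightarrow> rat fps \<Rightarrow> bool" where
  "ell_integral l F \<longleftrightarrow> (\<forall>n. \<not> int l dvd snd (quotient_of (fps_nth F n)))"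

definition bounded_denominators :: "rat fps \<Rightarrow> bool" where
  "bounded_denominators F \<longleftrightarrow> (\<exists>D::int. 0 < D \<and> (\<forall>n. \<exists>m::int. of_int D * fps_nth F n = of_int m))"

definition quasimodular_ell :: "nat \<Rightarrow> nat \<Rightarrow> rat fps \<Rightarrow> bool" where
  "quasimodular_ell l w G \<longleftrightarrow>
     (\<exists>xs :: (nat \<times> rat fps) list.
        (\<forall>(a, F)\<in>set xs. 2 * a \<le> w \<and> modular_form (w - 2 * a) F
                           \<and> ell_integral l F \<and> bounded_denominators F) \<and>
        G = (\<Sum>(a, F)\<leftarrow>xs. E2 ^ a * F))"

definition Xset :: "nat \<Rightarrow> nat \<Rightarrow> rat fps set" where
  "Xset l k = {G. \<exists>ys :: (nat \<times> rat fps) list.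
      (\<forall>(w, H)\<in>set ys. w \<le> k \<and> quasimodular_ell l w H) \<and> G = (\<Sum>(w, H)\<leftarrow>ys. H)}"

definition PXset :: "nat \<Rightarrow> nat \<Rightarrow> rat fps set" where
  "PXset l k = {Pgen * G | G. G \<in> Xset l k}"

end

theory Submission
  imports Defs "HOL-Complex_Analysis.Complex_Analysis"
begin

text \<open>
  Let \<open>w = exp u\<close>. Dyson's map (remove the first column, add a new first row) gives, for the number
  \<open>H m n\<close> of partitions of \<open>n\<close> with rank at most \<open>m\<close>, a functional equation relating \<open>H m\<close> and
  \<open>H (m + 3)\<close>. Multiplied by \<open>6 n + m (m + 1)\<close>, its inhomogeneity becomes quadratic in \<open>m\<close>, hence is
  annihilated by the cube of the theta series \<open>\<theta> = \<Sum> (-1)^a q^(a(a+1)/2) w^(a+1/2)\<close>, which has a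
  triple zero at \<open>w = 1\<close>. The product of \<open>\<theta>^3\<close> with the generating function is therefore invariant under
  \<open>w \<mapsto> q w\<close>, so it is constant in \<open>w\<close>: this is the rank-crank partial differential equation.

  The recursion defining \<open>P_k\<close> is the homogeneous version of that equation, so the exponential generating
  function of \<open>R_(2k) - P_k(\<delta>) R_2\<close> satisfies the inhomogeneous one. After division by
  \<open>P * 2 sinh (u/2) / u\<close> its Taylor coefficients in \<open>u\<close> obey
  \<open>(j-1)(j-2) q_j = v_j + (E2/4 - 6 \<delta>) q_(j-2)\<close>, where \<open>v\<close> is twice the inverse cube of the normalised theta series.
  The coefficients of the latter are built from \<open>1\<close> by the operator \<open>2 \<delta> + E2/4\<close>, so that all denominators are visible:
  up to the index \<open>l + 1\<close> the prime \<open>l\<close> enters only through the coefficient of \<open>u^(l-1)\<close>,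
  and its contributions to \<open>q_(l+1)\<close> cancel modulo \<open>l\<close>.

  It remains that \<open>l\<close>-integral quasimodular forms are closed under \<open>\<delta>\<close>, which follows from the
  transformation law of \<open>E2\<close>. That law is obtained by comparing the zeta functions of \<open>\<tau>\<close> and
  \<open>(a \<tau> + b) / (c \<tau> + d)\<close>, whose difference is linear by Liouville's theorem.
\<close>

section \<open>The transformation law of \<open>E2\<close>\<close>

text \<open>Why P_k(\<delta>) R_2 is subtracted: the conjugated operator multiplies u^j by
  (j-1)(j-2) in top order, so the equation leaves the coefficient at j = 2, which carries the second
  rank moment, undetermined. The homogeneous solution normalised by P_1 = 1 removes exactly this
  parameter, and then q_0 = 1 and q_2 = -1/24 generate all even coefficients.

  The obstacle is the last step, to j = l + 1. The target carries (l+1)!, which contains l once, and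
  the division by l (l-1) uses it up. Yet the coefficients A and B of u^(l-1) and u^(l+1) in the
  normalised theta series may both have an l in the denominator. Modulo l-integral forms B is
  \<delta> A + E2 A / 8, v_(l+1) is -6 B + E2 A and q_(l-1) is -A, so the polar part of v_(l+1) +
  (E2/4 - 6 \<delta>) q_(l-1) cancels.

  The series in q that the theta cube times the ranks amounts to does not depend on u, so it is read
  off at u = 0 instead of being computed as a product.\<close>

unbundle no vec_syntax
unbundle fps_syntax


text \<open>\<open>zeta_q q w\<close> is the symmetric sum of \<open>(w q^n + 1) / (2 (w q^n - 1))\<close> over all integers \<open>n\<close>; the terms
  with indices \<open>n\<close> and \<open>-n\<close> are combined into one term of \<open>(w^2 - 1) * zeta_reg q w\<close>.\<close>

definition zeta_reg :: "complex \<Rightarrow> complex \<Rightarrow> complex" where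
  "zeta_reg q w = (\<Sum>n. q ^ Suc n / ((w * q ^ Suc n - 1) * (w - q ^ Suc n)))"

definition zeta_q :: "complex \<Rightarrow> complex \<Rightarrow> complex" where
  "zeta_q q w = (w + 1) / (2 * (w - 1)) + (w\<^sup>2 - 1) * zeta_reg q w"

definition zeta_dom :: "complex \<Rightarrow> complex set" where
  "zeta_dom q = {w. w \<noteq> 0 \<and> (\<forall>n. w * q ^ Suc n \<noteq> 1 \<and> w \<noteq> q ^ Suc n)}"

text \<open>Weierstrass test near \<open>w0\<close>: only the first \<open>N\<close> terms can have
  poles there, and a small enough neighbourhood avoids these; from \<open>N\<close> on both factors
  of the denominator stay away from 0, so a geometric series dominates.\<close>

lemma zeta_reg_local:
  assumes q: "norm q < 1" and w0: "w0 \<in> zeta_dom q"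
  shows "\<exists>S. open S \<and> w0 \<in> S \<and> (\<forall>w\<in>S. (\<lambda>n. q ^ Suc n / ((w * q ^ Suc n - 1) * (w - q ^ Suc n))) sums zeta_reg q w
            \<and> zeta_reg q field_differentiable at w)"
proof -
  have w0': "w0 \<noteq> 0" using w0 by (simp add: zeta_dom_def)
  define e where "e = min (norm w0 / 4) (1 / (4 * norm w0))"
  have e: "e > 0" using w0' by (simp add: e_def)
  obtain N where N: "norm q ^ N < e" using q e real_arch_pow_inv by blast
  have Nle: "norm q ^ Suc n \<le> e" if "n \<ge> N" for n
  proof -
    have "norm q ^ Suc n \<le> norm q ^ N" using q that by (intro power_decreasing) auto
    then show ?thesis using N by simp
  qed
  define S where "S = ball w0 (norm w0 / 2) \<inter> (\<Inter>n\<in>{..<N}. {w. w * q ^ Suc n \<noteq> 1} \<inter> {w. w \<noteq> q ^ Suc n})"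
  have opS: "open S"
    unfolding S_def by (intro open_Int open_INT open_ball finite_lessThan ballI open_Collect_neq continuous_intros)
  have w0S: "w0 \<in> S" using w0 w0' by (auto simp: S_def zeta_dom_def)
  have bnd: "norm (w * q ^ Suc n - 1) \<ge> 1/2 \<and> norm (w - q ^ Suc n) \<ge> norm w0 / 4"
    if "w \<in> S" "n \<ge> N" for w n
  proof -
    have d: "norm (w0 - w) < norm w0 / 2" using that by (simp add: S_def dist_norm)
    have 1: "norm w \<le> 3/2 * norm w0" using norm_triangle_ineq2[of w w0] d by (simp add: norm_minus_commute)
    have 2: "norm w \<ge> norm w0 / 2" using norm_triangle_ineq2[of w0 w] d by simp
    have qn: "norm (q ^ Suc n) \<le> norm w0 / 4" "norm (q ^ Suc n) \<le> 1 / (4 * norm w0)"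
      using Nle[OF that(2)] unfolding e_def norm_power min.bounded_iff by blast+
    have "norm (w * q ^ Suc n) \<le> (3/2 * norm w0) * (1 / (4 * norm w0))"
      unfolding norm_mult using 1 qn by (intro mult_mono) auto
    also have "\<dots> = 3/8" using w0' by simp
    finally have "norm (w * q ^ Suc n - 1) \<ge> 1/2"
      using norm_triangle_ineq2[of 1 "w * q ^ Suc n"] by (simp add: norm_minus_commute)
    moreover have "norm (w - q ^ Suc n) \<ge> norm w0 / 4"
      using norm_triangle_ineq2[of w "q ^ Suc n"] 2 qn by simp
    ultimately show ?thesis by blast
  qed
  have nz: "w * q ^ Suc n \<noteq> 1 \<and> w \<noteq> q ^ Suc n" if "w \<in> S" for w n
  proof (cases "n < N")
    case True then show ?thesis using that by (auto simp: S_def)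
  next
    case False
    then have "norm (w * q ^ Suc n - 1) \<ge> 1/2 \<and> norm (w - q ^ Suc n) \<ge> norm w0 / 4" using bnd that by auto
    then show ?thesis using w0' by auto
  qed
  define h where "h = (\<lambda>n. of_real (8 / norm w0 * norm q ^ Suc n) :: complex)"
  obtain g where g: "\<forall>x \<in> S. ((\<lambda>n. q ^ Suc n / ((x * q ^ Suc n - 1) * (x - q ^ Suc n))) sums g x) \<and> g field_differentiable (at x)"
  proof (rule series_differentiable_comparison_complex[OF opS])
    fix n x assume "x \<in> S"
    then show "(\<lambda>x. q ^ Suc n / ((x * q ^ Suc n - 1) * (x - q ^ Suc n))) field_differentiable at x"
      using nz[of x n] by (intro derivative_intros) auto
  next
    fix x assume x: "x \<in> S"
    have "summable (\<lambda>n. 8 / norm w0 * norm q ^ Suc n)"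
      using q by (intro summable_mult) (simp add: summable_geometric summable_mult)
    then have "summable h" unfolding h_def by (simp only: summable_of_real)
    moreover have "range h \<subseteq> \<real>\<^sub>\<ge>\<^sub>0" by (auto simp: h_def simp del: of_real_mult of_real_divide of_real_power)
    moreover have "\<forall>\<^sub>F n in sequentially. \<forall>y\<in>ball x 1 \<inter> S. cmod (q ^ Suc n / ((y * q ^ Suc n - 1) * (y - q ^ Suc n))) \<le> cmod (h n)"
    proof (rule eventually_sequentiallyI[of N], rule ballI)
      fix n y assume n: "n \<ge> N" and y: "y \<in> ball x 1 \<inter> S"
      have b: "norm (y * q ^ Suc n - 1) \<ge> 1/2" "norm (y - q ^ Suc n) \<ge> norm w0 / 4" using bnd n y by auto
      have "1/2 * (norm w0 / 4) \<le> norm ((y * q ^ Suc n - 1) * (y - q ^ Suc n))"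
        unfolding norm_mult using b w0' by (intro mult_mono) auto
      then have "norm (q ^ Suc n) / norm ((y * q ^ Suc n - 1) * (y - q ^ Suc n)) \<le> norm (q ^ Suc n) / (1/2 * (norm w0 / 4))"
        using w0' by (intro divide_left_mono mult_pos_pos) (auto intro: less_le_trans[rotated])
      then show "cmod (q ^ Suc n / ((y * q ^ Suc n - 1) * (y - q ^ Suc n))) \<le> cmod (h n)"
        unfolding h_def norm_divide norm_of_real by (simp add: norm_power norm_mult field_simps)
    qed
    ultimately show "\<exists>d h. 0 < d \<and> summable h \<and> range h \<subseteq> \<real>\<^sub>\<ge>\<^sub>0 \<and> (\<forall>\<^sub>F n in sequentially. \<forall>y\<in>ball x d \<inter> S. cmod (q ^ Suc n / ((y * q ^ Suc n - 1) * (y - q ^ Suc n))) \<le> cmod (h n))"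
      by (intro exI[of _ 1] exI[of _ h]) auto
  qed auto
  have eq: "zeta_reg q x = g x" if "x \<in> S" for x
  proof -
    have "(\<lambda>n. q ^ Suc n / ((x * q ^ Suc n - 1) * (x - q ^ Suc n))) sums g x" using g that by blast
    then show ?thesis unfolding zeta_reg_def by (rule sums_unique[symmetric])
  qed
  have "zeta_reg q field_differentiable at x" if "x \<in> S" for x
  proof -
    have "g field_differentiable at x" using g that by blast
    then obtain D where "(g has_field_derivative D) (at x)" by (auto simp: field_differentiable_def)
    moreover have "eventually (\<lambda>y. zeta_reg q y = g y) (nhds x)"
      unfolding eventually_nhds using opS that eq by (intro exI[of _ S]) auto
    ultimately have "(zeta_reg q has_field_derivative D) (at x)" using DERIV_cong_ev[OF refl _ refl] by metis
    then show ?thesis by (auto simp: field_differentiable_def)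
  qed
  then show ?thesis using opS w0S g eq by (intro exI[of _ S]) auto
qed

lemma zeta_reg_sums:
  assumes "norm q < 1" "w \<in> zeta_dom q"
  shows "(\<lambda>n. q ^ Suc n / ((w * q ^ Suc n - 1) * (w - q ^ Suc n))) sums zeta_reg q w"
  using zeta_reg_local[OF assms] by blast

lemma zeta_reg_differentiable:
  assumes "norm q < 1" "w \<in> zeta_dom q"
  shows "zeta_reg q field_differentiable at w"
  using zeta_reg_local[OF assms] by blast

text \<open>The index shifts by one under w -> q w, so the symmetric partial sums telescope. What
  remains is \<open>h (Suc N) w - k N w\<close>, whose two parts each contribute -1/2 in the
  limit.\<close>

lemma zeta_q_shift:
  assumes q: "norm q < 1" "q \<noteq> 0" and w: "w \<in> zeta_dom q" and qw: "q * w \<in> zeta_dom q"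
  shows "zeta_q q (q * w) = zeta_q q w - 1"
proof -
  define h where "h = (\<lambda>n w. (w * q ^ n + 1) / (2 * (w * q ^ n - 1)))"
  define k where "k = (\<lambda>n w. (w + q ^ n) / (2 * (w - q ^ n)))"
  have hk: "(w\<^sup>2 - 1) * (q ^ Suc n / ((w * q ^ Suc n - 1) * (w - q ^ Suc n))) = h (Suc n) w + k (Suc n) w"
    if "w \<in> zeta_dom q" for w n
  proof -
    have "w * q ^ Suc n - 1 \<noteq> 0" "w - q ^ Suc n \<noteq> 0" using that by (auto simp: zeta_dom_def)
    then show ?thesis unfolding h_def k_def
      by (simp add: divide_simps del: power_Suc) (simp add: algebra_simps power2_eq_square del: power_Suc)
  qed
  have lim: "(\<lambda>N. h 0 w + (\<Sum>n<N. h (Suc n) w + k (Suc n) w)) \<longlonglongrightarrow> zeta_q q w" if "w \<in> zeta_dom q" for w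
  proof -
    have "(\<lambda>n. (w\<^sup>2 - 1) * (q ^ Suc n / ((w * q ^ Suc n - 1) * (w - q ^ Suc n)))) sums ((w\<^sup>2 - 1) * zeta_reg q w)"
      using zeta_reg_sums[OF q(1) that] by (rule sums_mult)
    then have "(\<lambda>n. h (Suc n) w + k (Suc n) w) sums ((w\<^sup>2 - 1) * zeta_reg q w)" using hk[OF that] by simp
    then show ?thesis unfolding zeta_q_def sums_def by (intro tendsto_intros) (auto simp: h_def)
  qed
  have q0: "(\<lambda>n. q ^ n) \<longlonglongrightarrow> 0" using q by (simp add: LIMSEQ_power_zero)
  have wnz: "w \<noteq> 0" using w by (simp add: zeta_dom_def)
  have hlim: "(\<lambda>N. h (Suc N) w) \<longlonglongrightarrow> (w * 0 + 1) / (2 * (w * 0 - 1))"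
    unfolding h_def by (intro tendsto_intros LIMSEQ_Suc[OF q0]) auto
  have klim: "(\<lambda>N. k N w) \<longlonglongrightarrow> (w + 0) / (2 * (w - 0))"
    unfolding k_def using wnz by (intro tendsto_intros q0) auto
  have hs: "h n (q * w) = h (Suc n) w" for n by (simp add: h_def mult_ac)
  have ks: "k (Suc n) (q * w) = k n w" for n
  proof -
    have "k (Suc n) (q * w) = (q * (w + q ^ n)) / (q * (2 * (w - q ^ n)))" by (simp add: k_def algebra_simps)
    then show ?thesis using q by (simp add: k_def)
  qed
  have k0: "k 0 w = h 0 w" by (simp add: h_def k_def)
  have part: "h 0 (q * w) + (\<Sum>n<N. h (Suc n) (q * w) + k (Suc n) (q * w))
      = (h 0 w + (\<Sum>n<N. h (Suc n) w + k (Suc n) w)) + h (Suc N) w - k N w" for N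
  proof (induction N)
    case 0 then show ?case by (simp add: hs k0)
  next
    case (Suc N)
    have "h 0 (q * w) + (\<Sum>n<Suc N. h (Suc n) (q * w) + k (Suc n) (q * w))
        = (h 0 (q * w) + (\<Sum>n<N. h (Suc n) (q * w) + k (Suc n) (q * w))) + (h (Suc (Suc N)) w + k N w)"
      by (simp only: sum.lessThan_Suc hs ks add.assoc)
    also have "\<dots> = ((h 0 w + (\<Sum>n<N. h (Suc n) w + k (Suc n) w)) + h (Suc N) w - k N w) + (h (Suc (Suc N)) w + k N w)"
      by (simp only: Suc.IH)
    finally show ?case by simp
  qed
  have "(\<lambda>N. (h 0 w + (\<Sum>n<N. h (Suc n) w + k (Suc n) w)) + h (Suc N) w - k N w)
     \<longlonglongrightarrow> zeta_q q w + (w * 0 + 1) / (2 * (w * 0 - 1)) - (w + 0) / (2 * (w - 0))"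
    by (intro tendsto_intros lim w hlim klim)
  moreover have "(\<lambda>N. (h 0 w + (\<Sum>n<N. h (Suc n) w + k (Suc n) w)) + h (Suc N) w - k N w) \<longlonglongrightarrow> zeta_q q (q * w)"
    using lim[OF qw] part by simp
  ultimately have "zeta_q q (q * w) = zeta_q q w + (w * 0 + 1) / (2 * (w * 0 - 1)) - (w + 0) / (2 * (w - 0))"
    using LIMSEQ_unique by blast
  then show ?thesis using wnz by simp
qed

text \<open>The quotient of exponentials is coth (v/2) / 2, and the limit is the coefficient B_2 / 2
  of v in its Laurent series. It becomes the constant term of E2 in
  \<open>zeta_x_expansion\<close>.\<close>

lemma exp_cot_limit:
  "((\<lambda>v::complex. ((exp v + 1) / (2 * (exp v - 1)) - 1 / v) / v) \<longlongrightarrow> 1 / 12) (at 0)"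
proof -
  define F :: "complex fps" where "F = fps_X * (fps_exp 1 + 1) - 2 * (fps_exp 1 - 1)"
  have F: "(\<lambda>v. v * (exp v + 1) - 2 * (exp v - 1)) has_fps_expansion F"
    unfolding F_def by (intro fps_expansion_intros has_fps_expansion_exp1)
  have F3: "F $ 3 = 1/6" "F $ 0 = 0" "F $ 1 = 0" "F $ 2 = 0"
    by (auto simp: F_def fps_numeral_nth eval_nat_numeral fps_mult_nth_0 numeral_fps_const algebra_simps)
  have Fs: "subdegree F = 3"
    by (intro subdegreeI) (use F3 in \<open>auto simp: eval_nat_numeral less_Suc_eq\<close>)
  define E :: "complex fps" where "E = fps_exp 1 - 1"
  have E: "(\<lambda>v. exp v - 1) has_fps_expansion E"
    unfolding E_def by (intro fps_expansion_intros has_fps_expansion_exp1)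
  have Es: "subdegree E = 1" by (intro subdegreeI) (auto simp: E_def)
  have E1: "E $ 1 = 1" by (simp add: E_def)
  have a1: "(\<lambda>v::complex. v * (exp v + 1) - 2 * (exp v - 1)) \<sim>[at 0] (\<lambda>v. (1/6) * v ^ 3)"
    using has_fps_expansion_imp_asymp_equiv_0[OF F] Fs F3
    by (auto simp: asymp_equiv_nhds_iff)
  have a2: "(\<lambda>v::complex. exp v - 1) \<sim>[at 0] (\<lambda>v. v)"
  proof -
    have "(\<lambda>v. exp v - 1) \<sim>[nhds 0] (\<lambda>z. E $ 1 * z ^ 1)"
      using has_fps_expansion_imp_asymp_equiv_0[OF E] unfolding Es .
    moreover have "(\<lambda>z. E $ 1 * z ^ 1) = (\<lambda>z. z)" using E1 by (simp add: fun_eq_iff)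
    ultimately show ?thesis by (simp only: asymp_equiv_nhds_iff)
  qed
  have "(\<lambda>v::complex. (v * (exp v + 1) - 2 * (exp v - 1)) / (2 * v^2 * (exp v - 1))) \<sim>[at 0] (\<lambda>v. ((1/6) * v ^ 3) / (2 * v^2 * v))"
    by (intro asymp_equiv_intros a1 a2)
  then have "(\<lambda>v::complex. (v * (exp v + 1) - 2 * (exp v - 1)) / (2 * v^2 * (exp v - 1))) \<sim>[at 0] (\<lambda>v::complex. 1/12)"
    by (rule asymp_equiv_trans) (intro asymp_equiv_refl_ev, auto simp: eventually_at_filter power2_eq_square power3_eq_cube)
  then have 1: "((\<lambda>v::complex. (v * (exp v + 1) - 2 * (exp v - 1)) / (2 * v^2 * (exp v - 1))) \<longlongrightarrow> 1/12) (at 0)"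
    by (rule asymp_equivD_const)
  have ev: "eventually (\<lambda>v::complex. exp v - 1 \<noteq> 0) (at 0)"
    by (rule asymp_equiv_eventually_zeros[OF a2, THEN eventually_rev_mp])
       (auto simp: eventually_at_filter)
  have ev2: "eventually (\<lambda>v::complex. v \<noteq> 0) (at 0)" by (simp add: eventually_at_filter)
  have "eventually (\<lambda>v::complex. (v * (exp v + 1) - 2 * (exp v - 1)) / (2 * v^2 * (exp v - 1)) = ((exp v + 1) / (2 * (exp v - 1)) - 1 / v) / v) (at 0)"
    using ev ev2 by eventually_elim (auto simp: divide_simps power2_eq_square algebra_simps)
  then show ?thesis using 1 tendsto_cong by fast
qed

section \<open>Functions with periods 1 and tau\<close>

definition lattice :: "complex \<Rightarrow> complex set" where
  "lattice \<tau> = {x. \<exists>m n::int. x = of_int m * \<tau> + of_int n}"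

lemma lattice_0 [simp]: "0 \<in> lattice \<tau>"
  unfolding lattice_def by (rule CollectI, rule exI[of _ 0], rule exI[of _ 0]) simp

lemma lattice_diff: "x \<in> lattice \<tau> \<Longrightarrow> y \<in> lattice \<tau> \<Longrightarrow> x - y \<in> lattice \<tau>"
  unfolding lattice_def
  by (clarsimp, rule_tac x="m - ma" in exI, rule_tac x="n - na" in exI) (simp add: algebra_simps)

lemma lattice_shift_iff:
  assumes "p \<in> lattice \<tau>" shows "x + p \<in> lattice \<tau> \<longleftrightarrow> x \<in> lattice \<tau>"
  using lattice_diff[of "x + p" \<tau> p] lattice_diff[of x \<tau> "0 - p"] lattice_diff[of 0 \<tau> p] assms by auto

lemma lattice_1 [simp]: "1 \<in> lattice \<tau>"
  unfolding lattice_def by (rule CollectI, rule exI[of _ 0], rule exI[of _ 1]) simp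

lemma lattice_tau [simp]: "\<tau> \<in> lattice \<tau>"
  unfolding lattice_def by (rule CollectI, rule exI[of _ 1], rule exI[of _ 0]) simp

lemma lattice_discrete:
  assumes "Im \<tau> > 0" "x \<in> lattice \<tau>" "norm x < min 1 (Im \<tau>)"
  shows "x = 0"
proof -
  obtain m n :: int where x: "x = of_int m * \<tau> + of_int n" using assms by (auto simp: lattice_def)
  have "\<bar>Im x\<bar> < Im \<tau>" using assms(3) abs_Im_le_cmod[of x] by linarith
  then have "\<bar>real_of_int m\<bar> * Im \<tau> < 1 * Im \<tau>" using x assms(1) by (simp add: abs_mult)
  then have "\<bar>real_of_int m\<bar> < 1" using assms(1) mult_less_cancel_right_pos by blast
  then have m: "m = 0" by linarith
  have "norm x < 1" using assms(3) by simp
  then have "\<bar>real_of_int n\<bar> < 1" using x m by simp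
  then show ?thesis using x m by simp
qed

lemma closed_lattice:
  assumes "Im \<tau> > 0" shows "closed (lattice \<tau>)"
proof (rule discrete_imp_closed[of "min 1 (Im \<tau>)"])
  show "\<forall>x\<in>lattice \<tau>. \<forall>y\<in>lattice \<tau>. dist y x < min 1 (Im \<tau>) \<longrightarrow> y = x"
    using lattice_discrete[OF assms] lattice_diff by (metis dist_norm right_minus_eq)
qed (use assms in auto)

text \<open>The additive constants \<open>a\<close> and \<open>b\<close> let one induction serve
  both elliptic functions, where they are 0, and \<open>zeta_x\<close>, which changes by -2 pi i
  along tau.\<close>

lemma lattice_periodic:
  assumes "x \<notin> lattice \<tau>"
    and p1: "\<And>x. x \<notin> lattice \<tau> \<Longrightarrow> f (x + 1) = f x + (a::complex)"
    and pt: "\<And>x. x \<notin> lattice \<tau> \<Longrightarrow> f (x + \<tau>) = f x + b"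
  shows "f (x + (of_int m * \<tau> + of_int n)) = f x + of_int m * b + of_int n * a"
proof -
  have L: "of_int m * \<tau> + of_int n \<in> lattice \<tau>" for m n :: int by (auto simp: lattice_def)
  have 1: "f (x + of_int n) = f x + of_int n * a" if "x \<notin> lattice \<tau>" for x n
  proof (induction n rule: int_induct[where k=0])
    case base then show ?case by simp
  next
    case (step1 i)
    have "x + of_int i \<notin> lattice \<tau>" using that lattice_shift_iff L[of 0 i] by simp
    from p1[OF this] step1 show ?case by (simp add: algebra_simps)
  next
    case (step2 i)
    have "x + of_int (i - 1) \<notin> lattice \<tau>" using that lattice_shift_iff L[of 0 "i - 1"] by simp
    from p1[OF this] step2 show ?case by (simp add: algebra_simps)
  qed
  have 2: "f (x + of_int m * \<tau>) = f x + of_int m * b" if "x \<notin> lattice \<tau>" for x m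
  proof (induction m rule: int_induct[where k=0])
    case base then show ?case by simp
  next
    case (step1 i)
    have "x + of_int i * \<tau> \<notin> lattice \<tau>" using that lattice_shift_iff L[of i 0] by simp
    from pt[OF this] step1 show ?case by (simp add: algebra_simps)
  next
    case (step2 i)
    have "x + of_int (i - 1) * \<tau> \<notin> lattice \<tau>" using that lattice_shift_iff L[of "i - 1" 0] by simp
    from pt[OF this] step2 show ?case by (simp add: algebra_simps)
  qed
  have "x + of_int m * \<tau> \<notin> lattice \<tau>" using assms(1) lattice_shift_iff L[of m 0] by simp
  from 1[OF this, of n] 2[OF assms(1), of m] show ?thesis by (simp add: add.assoc)
qed

text \<open>Liouville's theorem. The limit makes 0 a removable singularity with value 0, periodicity
  carries this to every lattice point, and the resulting entire function is bounded because it takes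
  all its values on a compact set.\<close>

lemma elliptic_eq_0:
  fixes f :: "complex \<Rightarrow> complex"
  assumes \<tau>: "Im \<tau> > 0"
    and diff: "\<And>x. x \<notin> lattice \<tau> \<Longrightarrow> f field_differentiable at x"
    and p1: "\<And>x. x \<notin> lattice \<tau> \<Longrightarrow> f (x + 1) = f x"
    and pt: "\<And>x. x \<notin> lattice \<tau> \<Longrightarrow> f (x + \<tau>) = f x"
    and lim: "(f \<longlongrightarrow> 0) (at 0)" and x: "x \<notin> lattice \<tau>"
  shows "f x = 0"
proof -
  define g where "g = (\<lambda>x. if x \<in> lattice \<tau> then 0 else f x)"
  have gper: "g (x + p) = g x" if pl: "p \<in> lattice \<tau>" for x p
  proof (cases "x \<in> lattice \<tau>")
    case True then show ?thesis using that lattice_shift_iff by (simp add: g_def)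
  next
    case False
    obtain m n :: int where "p = of_int m * \<tau> + of_int n" using pl by (auto simp: lattice_def)
    then show ?thesis using lattice_periodic[OF False, of f 0 0 m n] p1 pt lattice_shift_iff[OF that] False
      by (auto simp: g_def)
  qed
  have op: "open (- lattice \<tau>)" using closed_lattice[OF \<tau>] by (rule open_Compl)
  have off: "g field_differentiable at x" if nl: "x \<notin> lattice \<tau>" for x
  proof -
    have "eventually (\<lambda>y. g y = f y) (nhds x)"
      using op nl eventually_nhds[of _ x] by (auto simp: g_def intro!: exI[of _ "- lattice \<tau>"])
    moreover obtain D where "(f has_field_derivative D) (at x)" using diff[OF nl] by (auto simp: field_differentiable_def)
    ultimately have "(g has_field_derivative D) (at x)" using DERIV_cong_ev[OF refl _ refl] by metis
    then show ?thesis by (auto simp: field_differentiable_def)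
  qed
  define r where "r = min 1 (Im \<tau>)"
  have r: "r > 0" using \<tau> by (simp add: r_def)
  have ball: "x \<notin> lattice \<tau>" if "x \<in> ball 0 r - {0}" for x
    using lattice_discrete[OF \<tau>, of x] that by (auto simp: r_def)
  have "g holomorphic_on ball 0 r"
  proof (rule no_isolated_singularity'[where K="{0}"])
    have "(g \<longlongrightarrow> 0) (at 0)"
    proof (rule Lim_transform_eventually[OF lim])
      show "\<forall>\<^sub>F x in at 0. f x = g x"
        using r ball by (auto simp: eventually_at g_def dist_norm intro!: exI[of _ r])
    qed
    then show "(g \<longlongrightarrow> g z) (at z within ball 0 r)" if "z \<in> {0}" for z
      using that by (auto simp: g_def intro: tendsto_within_subset)
    show "g holomorphic_on ball 0 r - {0}"
      using off ball by (simp add: holomorphic_on_def field_differentiable_at_within)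
  qed auto
  then have d0: "g field_differentiable at 0"
    using r by (metis centre_in_ball holomorphic_on_imp_differentiable_at open_ball)
  have lat: "g field_differentiable at p" if p: "p \<in> lattice \<tau>" for p
  proof -
    have mp: "- p \<in> lattice \<tau>" using lattice_diff[of 0 \<tau> p] p by simp
    have "(g \<circ> (\<lambda>x. x - p)) field_differentiable at p"
      by (rule field_differentiable_compose) (use d0 in \<open>auto intro!: derivative_intros\<close>)
    moreover have "g \<circ> (\<lambda>x. x - p) = g" using gper[OF mp] by (auto simp: o_def)
    ultimately show ?thesis by simp
  qed
  have hol: "g holomorphic_on UNIV"
    using off lat by (auto simp: holomorphic_on_def)
  have "bounded (range g)"
  proof -
    define K where "K = cbox 0 (Complex 1 (Im \<tau>))"
    have "compact (g ` K)"
      by (intro compact_continuous_image holomorphic_on_imp_continuous_on holomorphic_on_subset[OF hol])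
         (auto simp: K_def)
    moreover have "range g \<subseteq> g ` K"
    proof safe
      fix x
      \<comment> \<open>Subtracting a multiple of tau and then an integer moves \<open>x\<close>
        into an upright rectangle, which replaces the fundamental parallelogram.\<close>
      define m where "m = \<lfloor>Im x / Im \<tau>\<rfloor>"
      define n where "n = \<lfloor>Re (x - of_int m * \<tau>)\<rfloor>"
      define y where "y = x - (of_int m * \<tau> + of_int n)"
      have "of_int m \<le> Im x / Im \<tau>" "Im x / Im \<tau> < of_int m + 1" unfolding m_def by linarith+
      then have "of_int m * Im \<tau> \<le> Im x" "Im x < (of_int m + 1) * Im \<tau>" using \<tau> by (simp_all add: field_simps)
      moreover have "of_int n \<le> Re (x - of_int m * \<tau>)" "Re (x - of_int m * \<tau>) < of_int n + 1" unfolding n_def by linarith+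
      ultimately have "y \<in> K" by (auto simp: y_def K_def in_cbox_complex_iff algebra_simps)
      moreover have "g x = g y"
        using gper[of "of_int m * \<tau> + of_int n" y] by (auto simp: y_def lattice_def)
      ultimately show "g x \<in> g ` K" by blast
    qed
    ultimately show ?thesis using bounded_subset compact_imp_bounded by blast
  qed
  from Liouville_theorem[OF hol this] have "g x = g 0" by (auto simp: constant_on_def)
  then show ?thesis using x by (simp add: g_def)
qed

text \<open>The Weierstrass zeta function of the lattice minus the linear term that would spoil the
  period 1. The factor 2 pi i makes the residue at 0 equal to 1.\<close>

definition zeta_x :: "complex \<Rightarrow> complex \<Rightarrow> complex" where
  "zeta_x \<tau> x = 2 * pi * \<i> * zeta_q (exp (2 * pi * \<i> * \<tau>)) (exp (2 * pi * \<i> * x))"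

lemma norm_nome: "Im \<tau> > 0 \<Longrightarrow> norm (exp (2 * pi * \<i> * \<tau>)) < 1"
  by (simp add: norm_exp_eq_Re)

lemma exp_2pii_eq_1: "exp (2 * pi * \<i> * x) = 1 \<Longrightarrow> \<exists>n::int. x = of_int n"
proof -
  assume "exp (2 * pi * \<i> * x) = 1"
  then obtain n :: int where "2 * pi * \<i> * x = 0 + (of_int (2 * n) * pi) * \<i>" using exp_eq[of "2 * pi * \<i> * x" 0] by auto
  then have "(2 * pi * \<i>) * x = (2 * pi * \<i>) * of_int n" by (simp add: algebra_simps)
  then show ?thesis by auto
qed

lemma exp_zeta_dom:
  assumes "x \<notin> lattice \<tau>"
  shows "exp (2 * pi * \<i> * x) \<in> zeta_dom (exp (2 * pi * \<i> * \<tau>))" "exp (2 * pi * \<i> * x) \<noteq> 1"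
proof -
  have L: "of_int m * \<tau> + of_int n \<in> lattice \<tau>" for m n :: int by (auto simp: lattice_def)
  show "exp (2 * pi * \<i> * x) \<noteq> 1"
    using exp_2pii_eq_1[of x] assms L[of 0] by auto
  have 1: "exp (2 * pi * \<i> * x) * exp (2 * pi * \<i> * \<tau>) ^ Suc n \<noteq> 1" for n
  proof
    assume "exp (2 * pi * \<i> * x) * exp (2 * pi * \<i> * \<tau>) ^ Suc n = 1"
    then have "exp (2 * pi * \<i> * (x + of_nat (Suc n) * \<tau>)) = 1"
      by (metis distrib_left exp_add exp_of_nat_mult mult.left_commute)
    then obtain k :: int where "x + of_nat (Suc n) * \<tau> = of_int k" using exp_2pii_eq_1 by blast
    then have "x = of_int (- int (Suc n)) * \<tau> + of_int k" by (simp add: algebra_simps)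
    then show False using assms L by metis
  qed
  have 2: "exp (2 * pi * \<i> * x) \<noteq> exp (2 * pi * \<i> * \<tau>) ^ Suc n" for n
  proof
    assume "exp (2 * pi * \<i> * x) = exp (2 * pi * \<i> * \<tau>) ^ Suc n"
    then have "exp (2 * pi * \<i> * x) = exp (2 * pi * \<i> * (of_nat (Suc n) * \<tau>))"
      by (metis exp_of_nat_mult mult.left_commute)
    then have "exp (2 * pi * \<i> * (x - of_nat (Suc n) * \<tau>)) = 1"
      by (simp only: right_diff_distrib exp_diff) simp
    then obtain k :: int where "x - of_nat (Suc n) * \<tau> = of_int k" using exp_2pii_eq_1 by blast
    then have "x = of_int (int (Suc n)) * \<tau> + of_int k" by (simp add: algebra_simps)
    then show False using assms L by metis
  qed
  show "exp (2 * pi * \<i> * x) \<in> zeta_dom (exp (2 * pi * \<i> * \<tau>))"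
    unfolding zeta_dom_def using 1 2 by simp
qed

lemma zeta_x_add_1: "zeta_x \<tau> (x + 1) = zeta_x \<tau> x"
proof -
  have "exp (2 * pi * \<i> * (x + 1)) = exp (2 * pi * \<i> * x) * exp (2 * pi * \<i>)" by (simp add: distrib_left exp_add)
  also have "exp (2 * pi * \<i>) = (1::complex)" using exp_two_pi_i by (simp add: mult_ac)
  finally show ?thesis by (simp add: zeta_x_def)
qed

lemma zeta_x_add_tau:
  assumes "Im \<tau> > 0" "x \<notin> lattice \<tau>"
  shows "zeta_x \<tau> (x + \<tau>) = zeta_x \<tau> x - 2 * pi * \<i>"
proof -
  have e: "exp (2 * pi * \<i> * (x + \<tau>)) = exp (2 * pi * \<i> * \<tau>) * exp (2 * pi * \<i> * x)"
    by (simp add: distrib_left exp_add)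
  have "x + \<tau> \<notin> lattice \<tau>" using assms lattice_shift_iff by simp
  from zeta_q_shift[OF norm_nome[OF assms(1)] _ exp_zeta_dom(1)[OF assms(2)] exp_zeta_dom(1)[OF this, unfolded e]]
  show ?thesis unfolding zeta_x_def e by (simp add: right_diff_distrib)
qed

lemma zeta_x_differentiable:
  assumes "Im \<tau> > 0" "x \<notin> lattice \<tau>"
  shows "zeta_x \<tau> field_differentiable at x"
proof -
  have z: "zeta_q (exp (2 * pi * \<i> * \<tau>)) field_differentiable at (exp (2 * pi * \<i> * x))"
    unfolding zeta_q_def using exp_zeta_dom[OF assms(2)]
    by (intro derivative_intros zeta_reg_differentiable norm_nome assms) auto
  have e: "(\<lambda>y::complex. exp (2 * pi * \<i> * y)) field_differentiable at x"
    unfolding field_differentiable_def by (rule exI, (rule derivative_eq_intros refl)+)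
  have "(\<lambda>y. zeta_q (exp (2 * pi * \<i> * \<tau>)) (exp (2 * pi * \<i> * y))) field_differentiable at x"
    using field_differentiable_compose[OF e z] by (simp add: o_def)
  then show ?thesis unfolding zeta_x_def[abs_def] by (intro derivative_intros)
qed

text \<open>\<open>zeta_reg q 1\<close> is minus the Lambert series of the divisor sums.\<close>

definition e2val :: "complex \<Rightarrow> complex" where
  "e2val \<tau> = 1 + 24 * zeta_reg (exp (2 * pi * \<i> * \<tau>)) 1"

text \<open>With w = exp v, \<open>exp_cot_limit\<close> contributes 1/12, and w^2 - 1, which is 2 v
  to first order, contributes 2 * \<open>zeta_reg q 1\<close>. So E2 appears as the coefficient of x
  in the zeta function.\<close>

lemma zeta_x_expansion:
  assumes \<tau>: "Im \<tau> > 0"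
  shows "((\<lambda>x. (zeta_x \<tau> x - 1 / x) / x) \<longlongrightarrow> (2 * pi * \<i>)\<^sup>2 * e2val \<tau> / 12) (at 0)"
proof -
  define q where "q = exp (2 * pi * \<i> * \<tau>)"
  define I where "I = complex_of_real (2 * pi) * \<i>"
  have I: "I \<noteq> 0" by (simp add: I_def)
  have q: "norm q < 1" using norm_nome[OF \<tau>] by (simp add: q_def)
  have "q ^ Suc n \<noteq> 1" for n
  proof
    assume "q ^ Suc n = 1"
    then have "norm q ^ Suc n = 1" by (metis norm_one norm_power)
    moreover have "norm q ^ Suc n \<le> norm q" using q by (simp add: mult_left_le power_le_one)
    ultimately show False using q by linarith
  qed
  then have dom: "1 \<in> zeta_dom q" unfolding zeta_dom_def by (auto simp: eq_commute[of 1] simp del: power_Suc)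
  have cont: "isCont (zeta_reg q) 1"
    using zeta_reg_differentiable[OF q dom] field_differentiable_imp_continuous_at by blast
  have lin: "filterlim (\<lambda>x. I * x) (at 0) (at 0)"
    using I by (intro filterlim_atI tendsto_eq_intros) (auto simp: eventually_at_filter)
  have e1: "((\<lambda>v::complex. (exp v - 1) / v) \<longlongrightarrow> 1) (at 0)"
    using DERIV_exp[of "0::complex"] by (simp add: DERIV_def)
  have zr: "((\<lambda>v. zeta_reg q (exp v)) \<longlongrightarrow> zeta_reg q 1) (at 0)"
  proof -
    have "isCont (\<lambda>v::complex. zeta_reg q (exp v)) 0"
      using isCont_o2[of "0::complex" exp "zeta_reg q"] cont by (simp add: isCont_exp)
    then show ?thesis by (simp add: isCont_def)
  qed
  have ex: "((\<lambda>v::complex. exp v) \<longlongrightarrow> 1) (at 0)"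
    using isCont_exp[of "0::complex"] by (simp add: isCont_def)
  have "((\<lambda>v::complex. ((exp v + 1) / (2 * (exp v - 1)) - 1 / v) / v + (exp v + 1) * ((exp v - 1) / v) * zeta_reg q (exp v))
          \<longlongrightarrow> 1 / 12 + (1 + 1) * 1 * zeta_reg q 1) (at 0)"
    by (intro tendsto_intros exp_cot_limit e1 zr ex)
  then have "((\<lambda>x. ((exp (I * x) + 1) / (2 * (exp (I * x) - 1)) - 1 / (I * x)) / (I * x)
       + (exp (I * x) + 1) * ((exp (I * x) - 1) / (I * x)) * zeta_reg q (exp (I * x)))
          \<longlongrightarrow> 1 / 12 + (1 + 1) * 1 * zeta_reg q 1) (at 0)"
    by (rule filterlim_compose[OF _ lin])
  then have lim1: "((\<lambda>x. I\<^sup>2 * (((exp (I * x) + 1) / (2 * (exp (I * x) - 1)) - 1 / (I * x)) / (I * x)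
       + (exp (I * x) + 1) * ((exp (I * x) - 1) / (I * x)) * zeta_reg q (exp (I * x))))
          \<longlongrightarrow> I\<^sup>2 * (1 / 12 + (1 + 1) * 1 * zeta_reg q 1)) (at 0)"
    by (rule tendsto_mult_left)
  have val: "I\<^sup>2 * (1 / 12 + (1 + 1) * 1 * zeta_reg q 1) = (2 * pi * \<i>)\<^sup>2 * e2val \<tau> / 12"
    by (simp add: I_def q_def e2val_def algebra_simps)
  have ev: "eventually (\<lambda>x. I\<^sup>2 * (((exp (I * x) + 1) / (2 * (exp (I * x) - 1)) - 1 / (I * x)) / (I * x)
       + (exp (I * x) + 1) * ((exp (I * x) - 1) / (I * x)) * zeta_reg q (exp (I * x))) = (zeta_x \<tau> x - 1 / x) / x) (at 0)"
  proof -
    have id: "I\<^sup>2 * ((A - 1 / (I * x)) / (I * x) + (w + 1) * ((w - 1) / (I * x)) * r) = (I * (A + (w\<^sup>2 - 1) * r) - 1 / x) / x"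
      if "x \<noteq> 0" for A w r x
      using that I by (simp add: field_simps power2_eq_square)
    have "eventually (\<lambda>x::complex. x \<noteq> 0) (at 0)" by (simp add: eventually_at_filter)
    then show ?thesis
      by eventually_elim (subst id, assumption, simp add: zeta_x_def zeta_q_def q_def I_def)
  qed
  show ?thesis using Lim_transform_eventually[OF lim1 ev] unfolding val .
qed

lemma Im_moebius_pos:
  fixes a b c d :: int
  assumes "a * d - b * c = 1" "Im \<tau> > 0"
  shows "of_int c * \<tau> + of_int d \<noteq> 0" "Im ((of_int a * \<tau> + of_int b) / (of_int c * \<tau> + of_int d)) > 0"
proof -
  show nz: "of_int c * \<tau> + of_int d \<noteq> 0"
  proof
    assume 0: "of_int c * \<tau> + of_int d = 0"
    then have "of_int c * Im \<tau> = 0" by (auto simp: complex_eq_iff)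
    then have "c = 0" using assms(2) by simp
    then have "d = 0" using 0 by simp
    then show False using assms(1) \<open>c = 0\<close> by simp
  qed
  define y where "y = of_int c * \<tau> + of_int d"
  have R: "real_of_int a * of_int d - of_int b * of_int c = 1" using assms(1) by (metis of_int_1 of_int_diff of_int_mult)
  have "Im ((of_int a * \<tau> + of_int b) / y) = (real_of_int a * of_int d - of_int b * of_int c) * Im \<tau> / ((Re y)\<^sup>2 + (Im y)\<^sup>2)"
    unfolding Im_divide by (simp add: y_def algebra_simps)
  also have "\<dots> = Im \<tau> / ((Re y)\<^sup>2 + (Im y)\<^sup>2)" using R by simp
  also have "\<dots> > 0" using nz assms(2) by (intro divide_pos_pos) (auto simp: y_def complex_eq_iff sum_power2_gt_zero_iff simp del: of_int_mult)
  finally show "Im ((of_int a * \<tau> + of_int b) / (of_int c * \<tau> + of_int d)) > 0" by (simp add: y_def)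
qed

text \<open>The anomaly 12 c j / (2 pi i) is the slope of the linear function by which the two zeta
  functions differ, found by comparing their coefficients of x at 0.\<close>

lemma e2val_transform:
  fixes a b c d :: int
  assumes det: "a * d - b * c = 1" and \<tau>: "Im \<tau> > 0"
  defines "j \<equiv> of_int c * \<tau> + of_int d"
  shows "e2val ((of_int a * \<tau> + of_int b) / j) = j\<^sup>2 * e2val \<tau> + 12 * of_int c * j / (2 * pi * \<i>)"
proof -
  define I where "I = complex_of_real (2 * pi) * \<i>"
  have I: "I \<noteq> 0" by (simp add: I_def)
  define t where "t = (of_int a * \<tau> + of_int b) / j"
  have j: "j \<noteq> 0" and t: "Im t > 0" using Im_moebius_pos[OF det \<tau>] by (auto simp: j_def t_def)
  have detc: "of_int a * of_int d - of_int b * of_int c = (1::complex)" using det by (metis of_int_1 of_int_diff of_int_mult)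
  have jt: "j * t = of_int a * \<tau> + of_int b" using j by (simp add: t_def)
  have lat: "x / j \<notin> lattice t" if "x \<notin> lattice \<tau>" for x
  proof
    assume "x / j \<in> lattice t"
    then obtain m n :: int where "x / j = of_int m * t + of_int n" by (auto simp: lattice_def)
    then have "x = of_int m * (j * t) + of_int n * j" using j by (simp add: field_simps)
    then have "x = of_int (m * a + n * c) * \<tau> + of_int (m * b + n * d)"
      by (simp add: jt) (simp add: j_def algebra_simps)
    then show False using that unfolding lattice_def by blast
  qed
  have zt: "zeta_x t (x / j + (of_int m * t + of_int n)) = zeta_x t (x / j) - of_int m * I" if "x \<notin> lattice \<tau>" for x m n
    using lattice_periodic[OF lat[OF that], of "zeta_x t" 0 "- I" m n] zeta_x_add_1 zeta_x_add_tau[OF t]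
    by (simp add: I_def)
  \<comment> \<open>Division by \<open>j\<close> maps the lattice of tau onto that of
    \<open>t\<close>; the inverse matrix expresses the images of 1 and tau in the basis
    \<open>t\<close>, 1.\<close>
  have j1: "(x + 1) / j = x / j + (of_int (- c) * t + of_int a)" for x
  proof -
    have "j * (of_int (- c) * t + of_int a) = - of_int c * (j * t) + of_int a * j" by (simp add: algebra_simps)
    also have "\<dots> = of_int a * of_int d - of_int b * of_int c" by (simp only: jt) (simp add: j_def algebra_simps)
    finally show ?thesis using j detc by (simp add: field_simps)
  qed
  have j2: "(x + \<tau>) / j = x / j + (of_int d * t + of_int (- b))" for x
  proof -
    have "j * (of_int d * t + of_int (- b)) = of_int d * (j * t) - of_int b * j" by (simp add: algebra_simps)
    also have "\<dots> = (of_int a * of_int d - of_int b * of_int c) * \<tau>" by (simp only: jt) (simp add: j_def algebra_simps)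
    finally show ?thesis using j detc by (simp add: field_simps)
  qed
  \<comment> \<open>The slope is dictated by the period 1, along which
    \<open>zeta_x t (x / j)\<close> gains \<open>c\<close> times 2 pi i. That it also fits the
    period tau amounts to the definition of \<open>j\<close>.\<close>
  define f where "f = (\<lambda>x. zeta_x t (x / j) / j - zeta_x \<tau> x - of_int c * I / j * x)"
  define A where "A = (\<lambda>\<tau> x. (zeta_x \<tau> x - 1 / x) / x)"
  have Alim: "(A \<tau> \<longlongrightarrow> I\<^sup>2 * e2val \<tau> / 12) (at 0)" if "Im \<tau> > 0" for \<tau>
    using zeta_x_expansion[OF that] by (simp add: A_def I_def)
  have div: "filterlim (\<lambda>x. x / j) (at 0) (at 0)"
    using j by (intro filterlim_atI tendsto_eq_intros) (auto simp: eventually_at_filter)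
  have At: "((\<lambda>x. A t (x / j)) \<longlongrightarrow> I\<^sup>2 * e2val t / 12) (at 0)"
    by (rule filterlim_compose[OF Alim[OF t] div])
  have fA: "f x = x * (A t (x / j) / j\<^sup>2 - A \<tau> x - of_int c * I / j)" if "x \<noteq> 0" for x
    using that j by (simp add: f_def A_def field_simps power2_eq_square)
  have Blim: "((\<lambda>x. A t (x / j) / j\<^sup>2 - A \<tau> x - of_int c * I / j) \<longlongrightarrow>
     (I\<^sup>2 * e2val t / 12) / j\<^sup>2 - I\<^sup>2 * e2val \<tau> / 12 - of_int c * I / j) (at 0)"
    using j by (intro tendsto_intros At Alim \<tau>) auto
  have "((\<lambda>x. x * (A t (x / j) / j\<^sup>2 - A \<tau> x - of_int c * I / j)) \<longlongrightarrow>
     0 * ((I\<^sup>2 * e2val t / 12) / j\<^sup>2 - I\<^sup>2 * e2val \<tau> / 12 - of_int c * I / j)) (at 0)"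
    by (intro tendsto_mult Blim tendsto_ident_at)
  moreover have "eventually (\<lambda>x. x * (A t (x / j) / j\<^sup>2 - A \<tau> x - of_int c * I / j) = f x) (at 0)"
    using fA by (auto simp: eventually_at_filter)
  ultimately have flim: "(f \<longlongrightarrow> 0) (at 0)" using Lim_transform_eventually by force
  have f0: "f x = 0" if x: "x \<notin> lattice \<tau>" for x
  proof (rule elliptic_eq_0[OF \<tau> _ _ _ flim x])
    fix x assume x: "x \<notin> lattice \<tau>"
    have "(\<lambda>x. zeta_x t (x / j)) field_differentiable at x"
    proof -
      have "(\<lambda>x. x / j) field_differentiable at x"
        unfolding field_differentiable_def using DERIV_cdivide[OF DERIV_ident, of j] by blast
      from field_differentiable_compose[OF this zeta_x_differentiable[OF t lat[OF x]]]
      show ?thesis by (simp add: o_def)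
    qed
    then show "f field_differentiable at x"
      unfolding f_def using j by (intro derivative_intros zeta_x_differentiable[OF \<tau> x]) auto
    show "f (x + 1) = f x"
      unfolding f_def j1 zt[OF x] zeta_x_add_1 using j by (simp add: field_simps)
    have "f (x + \<tau>) - f x = I * (j - of_int d - of_int c * \<tau>) / j"
      unfolding f_def j2 zt[OF x] zeta_x_add_tau[OF \<tau> x] I_def[symmetric] using j by (simp add: field_simps)
    also have "\<dots> = 0" by (simp add: j_def)
    finally show "f (x + \<tau>) = f x" by simp
  qed
  have "eventually (\<lambda>x. x \<notin> lattice \<tau> \<and> x \<noteq> 0) (at 0)"
    unfolding eventually_at using lattice_discrete[OF \<tau>] \<tau> by (intro exI[of _ "min 1 (Im \<tau>)"]) (auto simp: dist_norm)
  then have "eventually (\<lambda>x. A t (x / j) / j\<^sup>2 - A \<tau> x - of_int c * I / j = 0) (at 0)"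
    by eventually_elim (use f0 fA in force)
  then have "((\<lambda>x. A t (x / j) / j\<^sup>2 - A \<tau> x - of_int c * I / j) \<longlongrightarrow> 0) (at 0)"
    by (rule tendsto_eventually)
  with Blim have "(I\<^sup>2 * e2val t / 12) / j\<^sup>2 - I\<^sup>2 * e2val \<tau> / 12 - of_int c * I / j = 0"
    using tendsto_unique[OF at_neq_bot] by blast
  then have eq: "(I\<^sup>2 * e2val t / 12) / j\<^sup>2 = I\<^sup>2 * e2val \<tau> / 12 + of_int c * I / j" by (simp add: algebra_simps)
  have "e2val t = ((I\<^sup>2 * e2val t / 12) / j\<^sup>2) * (12 * j\<^sup>2 / I\<^sup>2)" using I j by simp
  also have "\<dots> = (I\<^sup>2 * e2val \<tau> / 12 + of_int c * I / j) * (12 * j\<^sup>2 / I\<^sup>2)" by (simp only: eq)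
  also have "\<dots> = j\<^sup>2 * e2val \<tau> + 12 * of_int c * j / I"
    using I j by (simp add: distrib_right power2_eq_square add_divide_distrib)
  finally show ?thesis by (simp add: t_def I_def)
qed

text \<open>The double series of (k+1) q^((n+1)(k+1)) is evaluated twice: summing over k first gives
  the negated terms of \<open>zeta_reg q 1\<close>, and grouping by the product (n+1)(k+1) gives the
  divisor sums. Absolute convergence justifies this.\<close>

lemma lambert_sums:
  fixes q :: complex
  assumes q: "norm q < 1"
  shows "(\<lambda>m. of_nat (\<Sum>d | d dvd m. d) * q ^ m) sums (- zeta_reg q 1)"
proof -
  define f where "f = (\<lambda>(n, k). of_nat (Suc k) * q ^ (Suc n * Suc k))"
  have qn: "norm (q ^ Suc n) < 1" for n
  proof -
    have "norm q ^ Suc n \<le> norm q" using q by (simp add: mult_left_le power_le_one)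
    then show ?thesis using q by (simp add: norm_power norm_mult)
  qed
  have inner: "((\<lambda>k. f (n, k)) has_sum (q ^ Suc n / (1 - q ^ Suc n)\<^sup>2)) UNIV"
    and inner_abs: "((\<lambda>k. norm (f (n, k))) has_sum (norm q ^ Suc n / (1 - norm q ^ Suc n)\<^sup>2)) UNIV" for n
  proof -
    have fn: "f (n, k) = q ^ Suc n * (of_nat (Suc k) * (q ^ Suc n) ^ k)" for k
      unfolding f_def prod.case power_mult by (subst power_Suc[of "q ^ Suc n" k]) (simp only: mult_ac)
    have "norm (f (n, k)) = norm q ^ Suc n * (of_nat (Suc k) * (norm q ^ Suc n) ^ k)" for k
      unfolding fn by (simp add: norm_mult norm_power del: of_nat_Suc)
    moreover have "(\<lambda>k. norm q ^ Suc n * (of_nat (Suc k) * (norm q ^ Suc n) ^ k)) sums (norm q ^ Suc n * (1 / (1 - norm q ^ Suc n)\<^sup>2))"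
      using qn[of n] by (intro sums_mult geometric_deriv_sums) (simp add: norm_power norm_mult)
    ultimately have s: "(\<lambda>k. norm (f (n, k))) sums (norm q ^ Suc n / (1 - norm q ^ Suc n)\<^sup>2)" by simp
    then show "((\<lambda>k. norm (f (n, k))) has_sum (norm q ^ Suc n / (1 - norm q ^ Suc n)\<^sup>2)) UNIV"
      by (intro sums_nonneg_imp_has_sum) auto
    have "(\<lambda>k. f (n, k)) sums (q ^ Suc n * (1 / (1 - q ^ Suc n)\<^sup>2))"
      unfolding fn using qn[of n] by (intro sums_mult geometric_deriv_sums)
    then show "((\<lambda>k. f (n, k)) has_sum (q ^ Suc n / (1 - q ^ Suc n)\<^sup>2)) UNIV"
      using s by (intro norm_summable_imp_has_sum) (auto simp: sums_iff)
  qed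
  have "(\<lambda>n. norm q ^ Suc n / (1 - norm q ^ Suc n)\<^sup>2) summable_on UNIV"
  proof (rule norm_summable_imp_summable_on, rule summable_comparison_test'[where N=0])
    show "summable (\<lambda>n. norm q ^ n * (norm q / (1 - norm q)\<^sup>2))"
      using q by (intro summable_mult2 summable_geometric) auto
    fix n
    have "norm q ^ Suc n \<le> norm q" using q by (simp add: mult_left_le power_le_one)
    then have "norm q ^ Suc n / (1 - norm q ^ Suc n)\<^sup>2 \<le> norm q ^ Suc n / (1 - norm q)\<^sup>2"
      using q by (intro divide_left_mono power_mono mult_pos_pos zero_less_power) auto
    then show "norm (norm (norm q ^ Suc n / (1 - norm q ^ Suc n)\<^sup>2)) \<le> norm q ^ n * (norm q / (1 - norm q)\<^sup>2)"
      by (simp add: mult_ac)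
  qed
  then have "(\<lambda>x. norm (f x)) summable_on (UNIV \<times> UNIV)"
    by (intro summable_on_SigmaI[OF inner_abs]) auto
  then have sf: "f summable_on (UNIV \<times> UNIV)" by (rule abs_summable_summable)
  then obtain S where S: "(f has_sum S) (UNIV \<times> UNIV)" by (auto simp: summable_on_def)
  have "((\<lambda>n. q ^ Suc n / (1 - q ^ Suc n)\<^sup>2) has_sum S) UNIV"
    using has_sum_SigmaD[OF S inner] by simp
  then have "(\<lambda>n. q ^ Suc n / (1 - q ^ Suc n)\<^sup>2) sums S" by (rule has_sum_imp_sums)
  then have "(\<lambda>n. - (q ^ Suc n / (1 - q ^ Suc n)\<^sup>2)) sums (- S)" by (rule sums_minus)
  moreover have "- (q ^ Suc n / (1 - q ^ Suc n)\<^sup>2) = q ^ Suc n / ((1 * q ^ Suc n - 1) * (1 - q ^ Suc n))" for n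
  proof -
    have "(1 * q ^ Suc n - 1) * (1 - q ^ Suc n) = - ((1 - q ^ Suc n)\<^sup>2)" by (simp add: power2_eq_square algebra_simps)
    then show ?thesis by simp
  qed
  ultimately have Sz: "S = - zeta_reg q 1" unfolding zeta_reg_def by (simp add: sums_iff)
  define g where "g = (\<lambda>(m, d). of_nat d * q ^ m)"
  have "(g has_sum S) (SIGMA m:UNIV. {d. d dvd m \<and> m > 0}) \<longleftrightarrow> (f has_sum S) (UNIV \<times> UNIV)"
  proof (rule has_sum_reindex_bij_witness[where i = "\<lambda>(n, k). (Suc n * Suc k, Suc k)" and j = "\<lambda>(m, d). (m div d - 1, d - 1)"])
    fix a :: "nat \<times> nat" assume "a \<in> (SIGMA m:UNIV. {d. d dvd m \<and> m > 0})"
    then obtain m d where a: "a = (m, d)" "d dvd m" "m > 0" by auto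
    then obtain e where e: "m = d * e" by (auto elim: dvdE)
    then have de: "d > 0" "e > 0" using a by auto
    show "(case case a of (m, d) \<Rightarrow> (m div d - 1, d - 1) of (n, k) \<Rightarrow> (Suc n * Suc k, Suc k)) = a"
      using a de e by (simp add: mult.commute del: mult_Suc mult_Suc_right)
    show "f (case a of (m, d) \<Rightarrow> (m div d - 1, d - 1)) = g a"
      using a de e by (simp add: f_def g_def mult.commute del: of_nat_Suc mult_Suc mult_Suc_right)
  qed (auto simp del: mult_Suc mult_Suc_right)
  then have g: "(g has_sum S) (SIGMA m:UNIV. {d. d dvd m \<and> m > 0})" using S by simp
  have "((\<lambda>m. of_nat (\<Sum>d | d dvd m. d) * q ^ m) has_sum S) UNIV"
  proof (rule has_sum_SigmaD[OF g])
    fix m :: nat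
    show "((\<lambda>y. g (m, y)) has_sum of_nat (\<Sum>d | d dvd m. d) * q ^ m) {d. d dvd m \<and> m > 0}"
    proof (cases "m = 0")
      case True
      \<comment> \<open>Every number divides 0, so the divisor sum at m = 0 runs over an infinite
        set and is 0 by convention.\<close>
      have "infinite {d::nat. d dvd 0}" by simp
      then show ?thesis using True by simp
    next
      case False
      then have "finite {d. d dvd m}" by simp
      then have "((\<lambda>y. g (m, y)) has_sum (\<Sum>d | d dvd m. g (m, d))) {d. d dvd m}" by (rule has_sum_finite)
      then show ?thesis using False by (simp add: g_def sum_distrib_right)
    qed
  qed
  then show ?thesis unfolding Sz by (rule has_sum_imp_sums)
qed

section \<open>Quasimodular forms and their derivatives\<close>

definition cfps :: "rat fps \<Rightarrow> complex fps" where
  "cfps F = Abs_fps (\<lambda>n. of_rat (fps_nth F n))"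

definition conv_disc :: "rat fps \<Rightarrow> bool" where
  "conv_disc F \<longleftrightarrow> (\<forall>q::complex. norm q < 1 \<longrightarrow> summable (\<lambda>n. of_rat (fps_nth F n) * q ^ n))"

definition qD :: "'a::semiring_1 fps \<Rightarrow> 'a fps" where
  "qD F = Abs_fps (\<lambda>n. of_nat n * fps_nth F n)"

lemma qD_nth [simp]: "fps_nth (qD F) n = of_nat n * fps_nth F n"
  by (simp add: qD_def)

lemma qD_altdef: "qD (F :: 'a::comm_ring_1 fps) = fps_X * fps_deriv F"
  by (rule fps_ext) (auto simp: qD_def fps_X_mult_nth of_nat_diff)

lemma cfps_nth [simp]: "fps_nth (cfps F) n = of_rat (fps_nth F n)"
  by (simp add: cfps_def)

lemma cfps_mult: "cfps (F * G) = cfps F * cfps G"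
  by (rule fps_ext) (simp add: fps_mult_nth of_rat_mult of_rat_sum)

lemma cfps_add: "cfps (F + G) = cfps F + cfps G"
  by (rule fps_ext) (simp add: of_rat_add)

lemma cfps_const: "cfps (fps_const c) = fps_const (of_rat c)"
  by (rule fps_ext) simp

lemma cfps_qD: "cfps (qD F) = qD (cfps F)"
  by (rule fps_ext) (simp add: of_rat_mult)

lemma conv_disc_iff: "conv_disc F \<longleftrightarrow> fps_conv_radius (cfps F) \<ge> 1"
proof
  assume F: "conv_disc F"
  show "fps_conv_radius (cfps F) \<ge> 1"
    unfolding fps_conv_radius_def
  proof (rule conv_radius_geI_ex)
    fix r :: real assume "0 < r" "ereal r < 1"
    then show "\<exists>z. norm z = r \<and> summable (\<lambda>n. fps_nth (cfps F) n * z ^ n)"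
      using F by (intro exI[of _ "of_real r"]) (auto simp: conv_disc_def)
  qed
next
  assume "fps_conv_radius (cfps F) \<ge> 1"
  moreover have "ereal (norm q) < 1" if "norm q < 1" for q :: complex using that by (simp add: one_ereal_def)
  ultimately have "summable (\<lambda>n. fps_nth (cfps F) n * q ^ n)" if "norm q < 1" for q
    using summable_fps[of q "cfps F"] that less_le_trans by blast
  then show "conv_disc F" unfolding conv_disc_def by simp
qed

lemma qexp_eval: "qexp F z = eval_fps (cfps F) (exp (2 * pi * \<i> * z))"
  by (simp add: qexp_def eval_fps_def)

lemma nome_radius:
  assumes "conv_disc F" "Im z > 0"
  shows "ereal (norm (exp (2 * pi * \<i> * z))) < fps_conv_radius (cfps F)"
proof -
  have "ereal (norm (exp (2 * pi * \<i> * z))) < 1" using norm_nome[OF assms(2)] by (simp only: one_ereal_def less_ereal.simps)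
  also have "\<dots> \<le> fps_conv_radius (cfps F)" using assms(1) by (simp only: conv_disc_iff)
  finally show ?thesis .
qed

lemma conv_disc_mult: "conv_disc F \<Longrightarrow> conv_disc G \<Longrightarrow> conv_disc (F * G)"
  unfolding conv_disc_iff cfps_mult by (rule order_trans[OF _ fps_conv_radius_mult]) simp

lemma conv_disc_add: "conv_disc F \<Longrightarrow> conv_disc G \<Longrightarrow> conv_disc (F + G)"
  unfolding conv_disc_iff cfps_add by (rule order_trans[OF _ fps_conv_radius_add]) simp

lemma conv_disc_const [simp]: "conv_disc (fps_const c)"
  unfolding conv_disc_iff cfps_const by simp

lemma conv_disc_qD: "conv_disc F \<Longrightarrow> conv_disc (qD F)"
  unfolding conv_disc_iff cfps_qD qD_altdef[of "cfps F"]
  by (rule order_trans[OF _ fps_conv_radius_mult], rule order_trans, assumption)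
     (simp add: fps_conv_radius_deriv)

lemma qexp_mult: "conv_disc F \<Longrightarrow> conv_disc G \<Longrightarrow> Im z > 0 \<Longrightarrow> qexp (F * G) z = qexp F z * qexp G z"
  unfolding qexp_eval cfps_mult by (intro eval_fps_mult nome_radius)

lemma qexp_add: "conv_disc F \<Longrightarrow> conv_disc G \<Longrightarrow> Im z > 0 \<Longrightarrow> qexp (F + G) z = qexp F z + qexp G z"
  unfolding qexp_eval cfps_add by (intro eval_fps_add nome_radius)

lemma qexp_const: "qexp (fps_const c) z = of_rat c"
  unfolding qexp_eval cfps_const by simp

lemma qexp_has_derivative:
  assumes "conv_disc F" "Im z > 0"
  shows "(qexp F has_field_derivative (2 * pi * \<i> * qexp (qD F) z)) (at z)"
proof -
  define q where "q = exp (2 * pi * \<i> * z)"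
  have r: "ereal (norm q) < fps_conv_radius (cfps F)" using nome_radius[OF assms] by (simp add: q_def)
  have 1: "(eval_fps (cfps F) has_field_derivative eval_fps (fps_deriv (cfps F)) q) (at q)"
    using r by (rule has_field_derivative_eval_fps)
  have 2: "((\<lambda>z. exp (2 * pi * \<i> * z)) has_field_derivative (2 * pi * \<i> * q)) (at z)"
    unfolding q_def by (rule derivative_eq_intros refl)+ simp
  have "((\<lambda>z. eval_fps (cfps F) (exp (2 * pi * \<i> * z))) has_field_derivative (eval_fps (fps_deriv (cfps F)) q * (2 * pi * \<i> * q))) (at z)"
    using DERIV_chain2[OF 1[unfolded q_def] 2[unfolded q_def]] by (simp add: q_def)
  moreover have "eval_fps (qD (cfps F)) q = q * eval_fps (fps_deriv (cfps F)) q"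
    unfolding qD_altdef using r fps_conv_radius_deriv[of "cfps F"]
    by (subst eval_fps_mult) (auto intro: less_le_trans)
  ultimately show ?thesis
    unfolding qexp_eval[abs_def] cfps_qD q_def[symmetric] by (simp add: mult_ac)
qed

lemma conv_disc_E2: "conv_disc E2" and qexp_E2: "Im z > 0 \<Longrightarrow> qexp E2 z = e2val z"
proof -
  have E: "(\<lambda>n. of_rat (fps_nth E2 n) * q ^ n) sums (1 + 24 * zeta_reg q 1)" if "norm q < 1" for q :: complex
  proof -
    have "(\<lambda>n. (if n = 0 then 1 else 0) + (-24) * (of_nat (\<Sum>d | d dvd n. d) * q ^ n)) sums (1 + (-24) * (- zeta_reg q 1))"
      using sums_single[of 0 "\<lambda>_. 1::complex"] by (intro sums_add sums_mult lambert_sums[OF that]) simp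
    moreover have "(if n = 0 then 1 else 0) + (-24) * (of_nat (\<Sum>d | d dvd n. d) * q ^ n) = of_rat (fps_nth E2 n) * q ^ n" for n
      by (auto simp: E2_def of_rat_mult of_rat_minus simp del: of_nat_sum)
    ultimately show ?thesis by simp
  qed
  then show "conv_disc E2" unfolding conv_disc_def by (auto simp: sums_iff)
  show "qexp E2 z = e2val z" if "Im z > 0"
    using E[OF norm_nome[OF that]] unfolding qexp_def e2val_def by (simp add: sums_iff)
qed

lemma modular_form_iff:
  "modular_form k F \<longleftrightarrow> conv_disc F \<and>
     (\<forall>a b c d :: int. a * d - b * c = 1 \<longrightarrow> (\<forall>z. 0 < Im z \<longrightarrow>
        qexp F ((of_int a * z + of_int b) / (of_int c * z + of_int d)) = (of_int c * z + of_int d) ^ k * qexp F z))"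
  by (simp add: modular_form_def conv_disc_def)

lemma modular_form_mult:
  assumes "modular_form j F" "modular_form k G"
  shows "modular_form (j + k) (F * G)"
  using assms unfolding modular_form_iff
  by (auto simp: conv_disc_mult qexp_mult Im_moebius_pos power_add)

lemma modular_form_const: "modular_form 0 (fps_const c)"
  unfolding modular_form_iff by (simp add: qexp_const)

text \<open>Both sides of \<open>eq\<close> are differentiated, and the Moebius map has derivative 1
  / (c z + d)^2. The function \<open>g\<close> is arbitrary so that modular forms and E2, with its
  anomaly, are both covered.\<close>

lemma qexp_derivative_moebius:
  fixes a b c d :: int
  assumes det: "a * d - b * c = 1" and z: "Im z > 0" and F: "conv_disc F"
    and eq: "\<And>z. Im z > 0 \<Longrightarrow> qexp F ((of_int a * z + of_int b) / (of_int c * z + of_int d)) = g z"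
    and g: "(g has_field_derivative g') (at z)"
  shows "2 * pi * \<i> * qexp (qD F) ((of_int a * z + of_int b) / (of_int c * z + of_int d)) = (of_int c * z + of_int d)\<^sup>2 * g'"
proof -
  let ?j = "\<lambda>z. of_int c * z + of_int d :: complex"
  let ?m = "\<lambda>z. (of_int a * z + of_int b) / (of_int c * z + of_int d) :: complex"
  note pos = Im_moebius_pos[OF det z]
  have detc: "of_int a * of_int d - of_int b * of_int c = (1::complex)" using det by (metis of_int_1 of_int_diff of_int_mult)
  have m: "(?m has_field_derivative (of_int a * ?j z - (of_int a * z + of_int b) * of_int c) / (?j z * ?j z)) (at z)"
    using pos(1) by (auto intro!: derivative_eq_intros)
  have num: "of_int a * ?j z - (of_int a * z + of_int b) * of_int c = 1" using detc by (simp add: algebra_simps)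
  have der: "((\<lambda>z. qexp F (?m z)) has_field_derivative (2 * pi * \<i> * qexp (qD F) (?m z)) * (1 / (?j z * ?j z))) (at z)"
    using DERIV_chain2[OF qexp_has_derivative[OF F pos(2)] m[unfolded num]] .
  have ev: "eventually (\<lambda>z. qexp F (?m z) = g z) (nhds z)"
    unfolding eventually_nhds
    by (rule exI[of _ "{z. Im z > 0}"]) (use z eq in \<open>auto simp: open_halfspace_Im_gt\<close>)
  have "(g has_field_derivative (2 * pi * \<i> * qexp (qD F) (?m z)) * (1 / (?j z * ?j z))) (at z)"
    using DERIV_cong_ev[OF refl ev refl] der by (rule iffD1)
  with g have "g' = (2 * pi * \<i> * qexp (qD F) (?m z)) * (1 / (?j z * ?j z))" by (rule DERIV_unique)
  then show ?thesis using pos(1) by (simp add: power2_eq_square)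
qed

lemma qexp_diff:
  assumes "conv_disc F" "conv_disc G" "Im z > 0"
  shows "qexp (F - G) z = qexp F z - qexp G z" "conv_disc (F - G)"
proof -
  have e: "F - G = F + fps_const (- 1) * G" by (rule fps_ext) (simp del: fps_const_neg)
  show "conv_disc (F - G)" unfolding e using assms by (intro conv_disc_add conv_disc_mult) auto
  show "qexp (F - G) z = qexp F z - qexp G z" unfolding e
    using assms by (subst qexp_add) (auto simp: qexp_mult qexp_const conv_disc_mult simp del: fps_const_neg)
qed

text \<open>Serre derivative: the term k c j^(k+1) F / (2 pi i) that comes from differentiating the
  automorphy factor is cancelled by k/12 times the anomaly of E2.\<close>

lemma modular_form_serre:
  assumes F: "modular_form k F"
  shows "modular_form (k + 2) (qD F - fps_const (of_nat k / 12) * (E2 * F))"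
proof -
  have cF: "conv_disc F" and tF: "\<And>a b c d z. (a::int) * d - b * c = 1 \<Longrightarrow> 0 < Im z \<Longrightarrow>
        qexp F ((of_int a * z + of_int b) / (of_int c * z + of_int d)) = (of_int c * z + of_int d) ^ k * qexp F z"
    using F by (auto simp: modular_form_iff)
  have cv: "conv_disc (qD F)" "conv_disc (fps_const (of_nat k / 12) * (E2 * F))"
    using cF by (auto intro!: conv_disc_qD conv_disc_mult conv_disc_E2)
  have val: "qexp (qD F - fps_const (of_nat k / 12) * (E2 * F)) z = qexp (qD F) z - of_nat k / 12 * (e2val z * qexp F z)" if "Im z > 0" for z
    using that cF cv by (simp add: qexp_diff qexp_mult conv_disc_E2 conv_disc_mult qexp_const qexp_E2 of_rat_divide)
  show ?thesis unfolding modular_form_iff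
  proof (intro conjI allI impI)
    show "conv_disc (qD F - fps_const (of_nat k / 12) * (E2 * F))"
      using cv qexp_diff(2)[of _ _ \<i>] by simp
    fix a b c d :: int and z assume det: "a * d - b * c = 1" and z: "0 < Im z"
    define j where "j = of_int c * z + of_int d"
    define I where "I = complex_of_real (2 * pi) * \<i>"
    have I: "I \<noteq> 0" by (simp add: I_def)
    note pos = Im_moebius_pos[OF det z]
    have g: "((\<lambda>z. (of_int c * z + of_int d) ^ k * qexp F z) has_field_derivative
        (of_nat k * of_int c * j ^ (k - 1) * qexp F z + j ^ k * (I * qexp (qD F) z))) (at z)"
      unfolding j_def I_def by (auto intro!: derivative_eq_intros qexp_has_derivative cF z)
    have "I * qexp (qD F) ((of_int a * z + of_int b) / j) = j\<^sup>2 * (of_nat k * of_int c * j ^ (k - 1) * qexp F z + j ^ k * (I * qexp (qD F) z))"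
      using qexp_derivative_moebius[OF det z cF tF[OF det] g] by (simp add: j_def I_def)
    also have "\<dots> = of_nat k * of_int c * j ^ (k + 1) * qexp F z + j ^ (k + 2) * (I * qexp (qD F) z)"
      by (cases k) (simp_all add: algebra_simps power2_eq_square)
    finally have 1: "qexp (qD F) ((of_int a * z + of_int b) / j) = of_nat k * of_int c * j ^ (k + 1) * qexp F z / I + j ^ (k + 2) * qexp (qD F) z"
      using I by (simp add: field_simps)
    have 2: "e2val ((of_int a * z + of_int b) / j) = j\<^sup>2 * e2val z + 12 * of_int c * j / I"
      using e2val_transform[OF det z] by (simp add: j_def I_def)
    have 3: "qexp F ((of_int a * z + of_int b) / j) = j ^ k * qexp F z" using tF[OF det z] by (simp add: j_def)
    have "qexp (qD F - fps_const (of_nat k / 12) * (E2 * F)) ((of_int a * z + of_int b) / j)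
      = j ^ (k + 2) * (qexp (qD F) z - of_nat k / 12 * (e2val z * qexp F z))"
      unfolding val[OF pos(2), folded j_def] 1 2 3 using I by (simp add: field_simps power2_eq_square)
    then show "qexp (qD F - fps_const (of_nat k / 12) * (E2 * F)) ((of_int a * z + of_int b) / (of_int c * z + of_int d)) =
       (of_int c * z + of_int d) ^ (k + 2) * qexp (qD F - fps_const (of_nat k / 12) * (E2 * F)) z"
      unfolding val[OF z] by (simp add: j_def)
  qed
qed

text \<open>By Ramanujan's identity this is E4. Its modularity is what puts \<open>qD E2\<close>
  into weight 4 of the filtration below.\<close>

lemma modular_form_E4: "modular_form 4 (E2 * E2 - fps_const 12 * qD E2)"
proof -
  have cv: "conv_disc (E2 * E2)" "conv_disc (fps_const 12 * qD E2)" "conv_disc (qD E2)"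
    by (auto intro!: conv_disc_qD conv_disc_mult conv_disc_E2)
  have val: "qexp (E2 * E2 - fps_const 12 * qD E2) z = e2val z * e2val z - 12 * qexp (qD E2) z" if "Im z > 0" for z
    using that cv by (simp add: qexp_diff qexp_mult conv_disc_E2 qexp_const qexp_E2)
  show ?thesis unfolding modular_form_iff
  proof (intro conjI allI impI)
    show "conv_disc (E2 * E2 - fps_const 12 * qD E2)"
      using cv qexp_diff(2)[of _ _ \<i>] by simp
    fix a b c d :: int and z assume det: "a * d - b * c = 1" and z: "0 < Im z"
    define j where "j = of_int c * z + of_int d"
    define I where "I = complex_of_real (2 * pi) * \<i>"
    have I: "I \<noteq> 0" by (simp add: I_def)
    note pos = Im_moebius_pos[OF det z]
    have tr: "qexp E2 ((of_int a * z + of_int b) / (of_int c * z + of_int d)) =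
        (of_int c * z + of_int d)\<^sup>2 * qexp E2 z + 12 * of_int c * (of_int c * z + of_int d) / I" if "Im z > 0" for z
      using e2val_transform[OF det that] qexp_E2 Im_moebius_pos[OF det that] that by (simp add: I_def)
    have g: "((\<lambda>z. (of_int c * z + of_int d)\<^sup>2 * qexp E2 z + 12 * of_int c * (of_int c * z + of_int d) / I) has_field_derivative
        (2 * of_int c * j * qexp E2 z + j\<^sup>2 * (I * qexp (qD E2) z) + 12 * of_int c * of_int c / I)) (at z)"
      unfolding j_def I_def by (auto intro!: derivative_eq_intros qexp_has_derivative conv_disc_E2 z)
    have "I * qexp (qD E2) ((of_int a * z + of_int b) / j) = j\<^sup>2 * (2 * of_int c * j * qexp E2 z + j\<^sup>2 * (I * qexp (qD E2) z) + 12 * of_int c * of_int c / I)"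
      using qexp_derivative_moebius[OF det z conv_disc_E2 tr g] by (simp add: j_def I_def)
    then have 1: "qexp (qD E2) ((of_int a * z + of_int b) / j) = j\<^sup>2 * (2 * of_int c * j * e2val z / I + j\<^sup>2 * qexp (qD E2) z + 12 * of_int c * of_int c / (I * I))"
      using I qexp_E2[OF z] by (simp add: field_simps)
    have 2: "e2val ((of_int a * z + of_int b) / j) = j\<^sup>2 * e2val z + 12 * of_int c * j / I"
      using e2val_transform[OF det z] by (simp add: j_def I_def)
    have "qexp (E2 * E2 - fps_const 12 * qD E2) ((of_int a * z + of_int b) / j) = j ^ 4 * (e2val z * e2val z - 12 * qexp (qD E2) z)"
      unfolding val[OF pos(2), folded j_def] 1 2 using I by (simp add: field_simps power2_eq_square power4_eq_xxxx)
    then show "qexp (E2 * E2 - fps_const 12 * qD E2) ((of_int a * z + of_int b) / (of_int c * z + of_int d)) =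
       (of_int c * z + of_int d) ^ 4 * qexp (E2 * E2 - fps_const 12 * qD E2) z"
      unfolding val[OF z] by (simp add: j_def)
  qed
qed

section \<open>Integrality at l for rationals and power series\<close>

definition l_integral :: "nat \<Rightarrow> rat \<Rightarrow> bool" where
  "l_integral l r \<longleftrightarrow> \<not> int l dvd snd (quotient_of r)"

text \<open>The reduced denominator divides the denominator of any other representation. In this
  form closure under sums and products is immediate.\<close>

lemma l_integral_iff:
  assumes "prime l"
  shows "l_integral l r \<longleftrightarrow> (\<exists>a b::int. \<not> int l dvd b \<and> r = of_int a / of_int b)"
proof
  assume "l_integral l r"
  then show "\<exists>a b::int. \<not> int l dvd b \<and> r = of_int a / of_int b"
    unfolding l_integral_def using quotient_of_div[of r] by (metis prod.collapse)
next
  assume "\<exists>a b::int. \<not> int l dvd b \<and> r = of_int a / of_int b"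
  then obtain a b :: int where ab: "\<not> int l dvd b" "r = of_int a / of_int b" by blast
  obtain x y where q: "quotient_of r = (x, y)" by fastforce
  have y: "y > 0" "coprime x y" "r = of_int x / of_int y"
    using quotient_of_denom_pos[OF q] quotient_of_coprime[OF q] quotient_of_div[OF q] by auto
  have b: "b \<noteq> 0" using ab by auto
  have "of_int x / of_int y = (of_int a / of_int b :: rat)" using y ab by simp
  then have "of_int (x * b) = (of_int (a * y) :: rat)" using b y by (simp add: field_simps)
  then have "x * b = a * y" by (simp only: of_int_eq_iff)
  then have "y dvd x * b" by simp
  then have "y dvd b" using y(2) by (simp add: coprime_commute coprime_dvd_mult_right_iff)
  then show "l_integral l r" using ab q by (auto simp: l_integral_def intro: dvd_trans)
qed

lemma l_integral_of_int [simp]: "prime l \<Longrightarrow> l_integral l (of_int a)"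
  unfolding l_integral_iff by (rule exI[of _ a], rule exI[of _ 1]) (auto simp: prime_nat_iff)

lemma l_integral_inverse_nat:
  assumes "prime l" "\<not> l dvd n" shows "l_integral l (1 / of_nat n)"
  unfolding l_integral_iff[OF assms(1)] using assms
  by (intro exI[of _ 1] exI[of _ "int n"]) auto

lemma l_integral_add:
  assumes "prime l" "l_integral l r" "l_integral l s" shows "l_integral l (r + s)"
proof -
  obtain a b c d where "\<not> int l dvd b" "r = of_int a / of_int b" "\<not> int l dvd d" "s = of_int c / of_int d"
    using assms unfolding l_integral_iff[OF assms(1)] by blast
  moreover from this have "b \<noteq> 0" "d \<noteq> 0" "\<not> int l dvd b * d"
    using assms(1) by (auto simp: prime_dvd_mult_iff)
  ultimately show ?thesis unfolding l_integral_iff[OF assms(1)]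
    by (intro exI[of _ "a * d + c * b"] exI[of _ "b * d"]) (simp add: field_simps)
qed

lemma l_integral_mult:
  assumes "prime l" "l_integral l r" "l_integral l s" shows "l_integral l (r * s)"
proof -
  obtain a b c d where "\<not> int l dvd b" "r = of_int a / of_int b" "\<not> int l dvd d" "s = of_int c / of_int d"
    using assms unfolding l_integral_iff[OF assms(1)] by blast
  moreover from this have "\<not> int l dvd b * d"
    using assms(1) by (auto simp: prime_dvd_mult_iff)
  ultimately show ?thesis unfolding l_integral_iff[OF assms(1)]
    by (intro exI[of _ "a * c"] exI[of _ "b * d"]) simp
qed

lemma l_integral_of_nat [simp]: "prime l \<Longrightarrow> l_integral l (of_nat a)"
  using l_integral_of_int[of l "int a"] by simp

lemma l_integral_numeral [simp]: "prime l \<Longrightarrow> l_integral l (numeral a)"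
  using l_integral_of_int[of l "numeral a"] by simp

lemma l_integral_0 [simp]: "prime l \<Longrightarrow> l_integral l 0" and l_integral_1 [simp]: "prime l \<Longrightarrow> l_integral l 1"
  using l_integral_of_int[of l 0] l_integral_of_int[of l 1] by simp_all

lemma l_integral_minus: "prime l \<Longrightarrow> l_integral l r \<Longrightarrow> l_integral l (- r)"
  using l_integral_mult[of l "- 1" r] l_integral_of_int[of l "-1"] by simp

lemma l_integral_diff: "prime l \<Longrightarrow> l_integral l r \<Longrightarrow> l_integral l s \<Longrightarrow> l_integral l (r - s)"
  using l_integral_add[of l r "- s"] l_integral_minus[of l s] by simp

lemma l_integral_power: "prime l \<Longrightarrow> l_integral l r \<Longrightarrow> l_integral l (r ^ n)"
  by (induction n) (auto intro: l_integral_mult)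

lemma l_integral_sum: "prime l \<Longrightarrow> (\<And>i. i \<in> A \<Longrightarrow> l_integral l (f i)) \<Longrightarrow> l_integral l (sum f A)"
  by (induction A rule: infinite_finite_induct) (auto intro: l_integral_add)

definition good_fps :: "nat \<Rightarrow> rat fps \<Rightarrow> bool" where
  "good_fps l F \<longleftrightarrow> ell_integral l F \<and> bounded_denominators F"

lemma ell_integral_iff: "ell_integral l F \<longleftrightarrow> (\<forall>n. l_integral l (fps_nth F n))"
  by (simp add: ell_integral_def l_integral_def)

lemma bounded_denominators_iff: "bounded_denominators F \<longleftrightarrow> (\<exists>D::int. 0 < D \<and> (\<forall>n. of_int D * fps_nth F n \<in> \<int>))"
  by (auto simp: bounded_denominators_def Ints_def image_iff)

lemma good_fps_mult:
  assumes "prime l" "good_fps l F" "good_fps l G" shows "good_fps l (F * G)"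
proof -
  obtain C D :: int where CD: "0 < C" "\<And>n. of_int C * fps_nth F n \<in> \<int>" "0 < D" "\<And>n. of_int D * fps_nth G n \<in> \<int>"
    using assms by (auto simp: good_fps_def bounded_denominators_iff)
  have "of_int (C * D) * fps_nth (F * G) n \<in> \<int>" for n
  proof -
    have "of_int (C * D) * fps_nth (F * G) n = (\<Sum>i=0..n. (of_int C * fps_nth F i) * (of_int D * fps_nth G (n - i)))"
      by (simp add: fps_mult_nth sum_distrib_left algebra_simps)
    also have "\<dots> \<in> \<int>" by (intro Ints_sum Ints_mult[OF CD(2) CD(4)])
    finally show ?thesis .
  qed
  moreover have "C * D > 0" using CD by simp
  ultimately have "bounded_denominators (F * G)" unfolding bounded_denominators_iff by blast
  moreover have "ell_integral l (F * G)"
    using assms unfolding good_fps_def ell_integral_iff fps_mult_nth by (auto intro!: l_integral_sum l_integral_mult)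
  ultimately show ?thesis by (simp add: good_fps_def)
qed

lemma good_fps_diff:
  assumes "prime l" "good_fps l F" "good_fps l G" shows "good_fps l (F - G)"
proof -
  obtain C D :: int where CD: "0 < C" "\<And>n. of_int C * fps_nth F n \<in> \<int>" "0 < D" "\<And>n. of_int D * fps_nth G n \<in> \<int>"
    using assms by (auto simp: good_fps_def bounded_denominators_iff)
  have "of_int (C * D) * fps_nth (F - G) n \<in> \<int>" for n
  proof -
    have "of_int (C * D) * fps_nth (F - G) n = of_int D * (of_int C * fps_nth F n) - of_int C * (of_int D * fps_nth G n)"
      by (simp add: algebra_simps)
    also have "\<dots> \<in> \<int>" by (intro Ints_diff Ints_mult[OF Ints_of_int CD(2)] Ints_mult[OF Ints_of_int CD(4)])
    finally show ?thesis .
  qed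
  moreover have "C * D > 0" using CD by simp
  ultimately have "bounded_denominators (F - G)" unfolding bounded_denominators_iff by blast
  moreover have "ell_integral l (F - G)"
    using assms unfolding good_fps_def ell_integral_iff by (auto intro!: l_integral_diff)
  ultimately show ?thesis by (simp add: good_fps_def)
qed

lemma good_fps_const:
  assumes "prime l" "l_integral l c" shows "good_fps l (fps_const c)"
proof -
  obtain x y where q: "quotient_of c = (x, y)" by fastforce
  have y: "y > 0" "c = of_int x / of_int y" using quotient_of_denom_pos[OF q] quotient_of_div[OF q] by auto
  have "bounded_denominators (fps_const c)"
    unfolding bounded_denominators_iff using y by (intro exI[of _ y]) auto
  moreover have "ell_integral l (fps_const c)" using assms by (auto simp: ell_integral_iff)
  ultimately show ?thesis by (simp add: good_fps_def)
qed

lemma good_fps_qD: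
  assumes "prime l" "good_fps l F" shows "good_fps l (qD F)"
proof -
  obtain D :: int where D: "0 < D" "\<And>n. of_int D * fps_nth F n \<in> \<int>"
    using assms by (auto simp: good_fps_def bounded_denominators_iff)
  have "of_int D * fps_nth (qD F) n \<in> \<int>" for n
    using Ints_mult[OF Ints_of_nat[of n] D(2)[of n]] by (simp add: mult_ac)
  then have "bounded_denominators (qD F)" unfolding bounded_denominators_iff using D by blast
  moreover have "ell_integral l (qD F)"
    using assms unfolding good_fps_def ell_integral_iff by (auto intro!: l_integral_mult)
  ultimately show ?thesis by (simp add: good_fps_def)
qed

lemma good_fps_E2: assumes "prime l" shows "good_fps l E2"
proof -
  have i: "fps_nth E2 n \<in> \<int>" for n by (auto simp: E2_def simp del: of_nat_sum)
  then have "bounded_denominators E2" unfolding bounded_denominators_iff by (intro exI[of _ 1]) auto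
  moreover have "ell_integral l E2" unfolding ell_integral_iff using i assms by (metis Ints_cases l_integral_of_int)
  ultimately show ?thesis by (simp add: good_fps_def)
qed

text \<open>One inductive sum replaces the two nested lists of \<open>Xset\<close> and
  \<open>quasimodular_ell\<close>. Only an upper bound for the weight is recorded, which keeps the
  inductions simple and admits odd indices.\<close>

inductive_set Xfilt :: "nat \<Rightarrow> nat \<Rightarrow> rat fps set" for l k :: nat where
  Xfilt_zero: "0 \<in> Xfilt l k"
| Xfilt_step: "2 * a + b \<le> k \<Longrightarrow> modular_form b F \<Longrightarrow> good_fps l F \<Longrightarrow> G \<in> Xfilt l k \<Longrightarrow> E2 ^ a * F + G \<in> Xfilt l k"

lemma Xfilt_subset_Xset: "G \<in> Xfilt l k \<Longrightarrow> G \<in> Xset l k"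
proof (induction rule: Xfilt.induct)
  case Xfilt_zero
  show ?case unfolding Xset_def by (rule CollectI, rule exI[of _ "[]"]) simp
next
  case (Xfilt_step a b F G)
  then obtain ys where ys: "\<forall>(w, H)\<in>set ys. w \<le> k \<and> quasimodular_ell l w H" "G = (\<Sum>(w, H)\<leftarrow>ys. H)"
    unfolding Xset_def by blast
  have "quasimodular_ell l (2 * a + b) (E2 ^ a * F)"
    unfolding quasimodular_ell_def using Xfilt_step by (intro exI[of _ "[(a, F)]"]) (auto simp: good_fps_def)
  then show ?case unfolding Xset_def
    using ys Xfilt_step by (intro CollectI exI[of _ "(2 * a + b, E2 ^ a * F) # ys"]) auto
qed

lemma Xfilt_mono: "F \<in> Xfilt l j \<Longrightarrow> j \<le> k \<Longrightarrow> F \<in> Xfilt l k"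
  by (induction rule: Xfilt.induct) (auto intro: Xfilt_zero Xfilt_step order_trans)

lemma Xfilt_add: "F \<in> Xfilt l k \<Longrightarrow> G \<in> Xfilt l k \<Longrightarrow> F + G \<in> Xfilt l k"
  by (induction rule: Xfilt.induct) (auto simp: add.assoc intro: Xfilt_step)

lemma Xfilt_monom: "2 * a + b \<le> k \<Longrightarrow> modular_form b F \<Longrightarrow> good_fps l F \<Longrightarrow> E2 ^ a * F \<in> Xfilt l k"
  using Xfilt_step[OF _ _ _ Xfilt_zero] by fastforce

lemma Xfilt_mult:
  assumes l: "prime l"
  shows "F \<in> Xfilt l j \<Longrightarrow> G \<in> Xfilt l k \<Longrightarrow> F * G \<in> Xfilt l (j + k)"
proof (induction rule: Xfilt.induct)
  case Xfilt_zero then show ?case by (simp add: Xfilt.Xfilt_zero)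
next
  case (Xfilt_step a b F H)
  have "E2 ^ a * F * G \<in> Xfilt l (j + k)" using Xfilt_step.prems
  proof (induction rule: Xfilt.induct)
    case Xfilt_zero then show ?case by (simp add: Xfilt.Xfilt_zero)
  next
    case (Xfilt_step a' b' F' H')
    have "E2 ^ (a + a') * (F * F') \<in> Xfilt l (j + k)"
      using Xfilt_step.hyps \<open>2 * a + b \<le> j\<close> \<open>modular_form b F\<close> \<open>good_fps l F\<close> l
      by (intro Xfilt_monom[where b = "b + b'"] modular_form_mult good_fps_mult) auto
    moreover have "E2 ^ a * F * (E2 ^ a' * F' + H') = E2 ^ (a + a') * (F * F') + E2 ^ a * F * H'"
      by (simp add: algebra_simps power_add)
    ultimately show ?case using Xfilt_step.IH by (simp add: Xfilt_add)
  qed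
  then show ?case using Xfilt_step by (simp add: distrib_right Xfilt_add)
qed

lemma Xfilt_const: "prime l \<Longrightarrow> l_integral l c \<Longrightarrow> fps_const c \<in> Xfilt l k"
  using Xfilt_monom[of 0 0 k "fps_const c" l] by (simp add: modular_form_const good_fps_const)

lemma Xfilt_scale: "prime l \<Longrightarrow> l_integral l c \<Longrightarrow> F \<in> Xfilt l k \<Longrightarrow> fps_const c * F \<in> Xfilt l k"
  using Xfilt_mult[of l "fps_const c" 0 F k] Xfilt_const[of l c 0] by simp

lemma Xfilt_1: "prime l \<Longrightarrow> 1 \<in> Xfilt l k"
  using Xfilt_const[of l 1 k] by simp

lemma Xfilt_minus: "prime l \<Longrightarrow> F \<in> Xfilt l k \<Longrightarrow> - F \<in> Xfilt l k"
  using Xfilt_scale[of l "- 1" F k] l_integral_of_int[of l "-1"] by (simp flip: fps_const_neg)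

lemma Xfilt_diff: "prime l \<Longrightarrow> F \<in> Xfilt l k \<Longrightarrow> G \<in> Xfilt l k \<Longrightarrow> F - G \<in> Xfilt l k"
  using Xfilt_add[of F l k "- G"] Xfilt_minus[of l G k] by simp

lemma Xfilt_sum: "(\<And>i. i \<in> A \<Longrightarrow> f i \<in> Xfilt l k) \<Longrightarrow> sum f A \<in> Xfilt l k"
  by (induction A rule: infinite_finite_induct) (auto intro: Xfilt_add Xfilt_zero)

lemma Xfilt_E2: "prime l \<Longrightarrow> E2 \<in> Xfilt l 2"
  using Xfilt_monom[of 1 0 2 "fps_const 1" l] modular_form_const[of 1] good_fps_const[of l 1] by simp

lemma qD_mult: "qD (F * G) = qD F * G + F * qD (G :: 'a::comm_ring_1 fps)"
  by (simp add: qD_altdef algebra_simps)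

lemma qD_add: "qD (F + G) = qD F + qD (G :: 'a::comm_ring_1 fps)"
  by (simp add: qD_altdef algebra_simps)

lemma qD_const_mult: "qD (fps_const c * F) = fps_const c * qD (F :: 'a::comm_ring_1 fps)"
  by (rule fps_ext) (simp add: mult_ac)

lemma qD_0 [simp]: "qD 0 = 0" and qD_1 [simp]: "qD (1 :: 'a::comm_ring_1 fps) = 0"
  by (rule fps_ext, simp)+

text \<open>\<open>qD E2\<close> is (E2^2 - E4) / 12, and \<open>qD F\<close> is the Serre
  derivative plus b/12 times E2 F. The only denominator is 12, and l > 3 makes it
  invertible.\<close>

lemma Xfilt_qD:
  assumes l: "prime l" "l > 3"
  shows "F \<in> Xfilt l k \<Longrightarrow> qD F \<in> Xfilt l (k + 2)"
proof (induction rule: Xfilt.induct)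
  case Xfilt_zero then show ?case by (simp add: Xfilt.Xfilt_zero)
next
  case (Xfilt_step a b F G)
  have "\<not> l dvd 2" "\<not> l dvd 3" using l by (auto dest: dvd_imp_le)
  moreover have "l dvd 2 \<or> l dvd 2 * 3" if "l dvd 12"
    using prime_dvd_multD[OF l(1), of 2 "2 * 3"] that by simp
  ultimately have "\<not> l dvd 12" using prime_dvd_multD[OF l(1), of 2 3] by blast
  then have 12: "l_integral l (1 / 12)" using l_integral_inverse_nat[of l 12] l by simp
  define E4 where "E4 = E2 * E2 - fps_const 12 * qD E2"
  have E4: "E4 \<in> Xfilt l 4" unfolding E4_def
    using Xfilt_monom[of 0 4 4 "E2 * E2 - fps_const 12 * qD E2" l] modular_form_E4 l(1)
    by (simp add: good_fps_diff good_fps_mult good_fps_E2 good_fps_const good_fps_qD)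
  have DE2: "qD E2 \<in> Xfilt l 4"
  proof -
    have "qD E2 = fps_const (1 / 12) * (E2 * E2 - E4)" unfolding E4_def by (rule fps_ext) simp
    then show ?thesis using Xfilt_scale[OF l(1) 12] Xfilt_diff[OF l(1) _ E4] Xfilt_mult[OF l(1) Xfilt_E2 Xfilt_E2] l by simp
  qed
  have E2a: "E2 ^ a \<in> Xfilt l (2 * a)" for a
    using Xfilt_monom[of a 0 "2 * a" "fps_const 1" l] modular_form_const[of 1] good_fps_const[of l 1] l by simp
  have DE2a: "qD (E2 ^ a) \<in> Xfilt l (2 * a + 2)" for a
  proof (induction a)
    case 0 then show ?case by (simp add: Xfilt.Xfilt_zero)
  next
    case (Suc a)
    have "qD E2 * E2 ^ a \<in> Xfilt l (2 * Suc a + 2)" by (rule Xfilt_mono[OF Xfilt_mult[OF l(1) DE2 E2a]]) simp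
    moreover have "E2 * qD (E2 ^ a) \<in> Xfilt l (2 * Suc a + 2)"
      by (rule Xfilt_mono[OF Xfilt_mult[OF l(1) Xfilt_E2[OF l(1)] Suc]]) simp
    ultimately show ?case unfolding power_Suc qD_mult by (rule Xfilt_add)
  qed
  have F: "F \<in> Xfilt l b" using Xfilt_monom[of 0 b b F l] Xfilt_step by simp
  have "qD F \<in> Xfilt l (b + 2)"
  proof -
    have c: "l_integral l (of_nat b / 12)" using l_integral_mult[OF l(1) l_integral_of_nat[OF l(1)] 12, of b] by simp
    have "qD F - fps_const (of_nat b / 12) * (E2 * F) \<in> Xfilt l (b + 2)"
      using Xfilt_monom[of 0 "b + 2" "b + 2" "qD F - fps_const (of_nat b / 12) * (E2 * F)" l]
        modular_form_serre[OF Xfilt_step.hyps(2)] l Xfilt_step.hyps c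
      by (simp add: good_fps_diff good_fps_qD good_fps_mult good_fps_E2 good_fps_const)
    moreover have "fps_const (of_nat b / 12) * (E2 * F) \<in> Xfilt l (b + 2)"
      using Xfilt_scale[OF l(1) c Xfilt_mult[OF l(1) Xfilt_E2[OF l(1)] F]] by (simp add: add.commute)
    ultimately show ?thesis using Xfilt_add by fastforce
  qed
  then have "E2 ^ a * qD F \<in> Xfilt l (2 * a + (b + 2))" by (rule Xfilt_mult[OF l(1) E2a])
  moreover have "qD (E2 ^ a) * F \<in> Xfilt l (2 * a + 2 + b)" by (rule Xfilt_mult[OF l(1) DE2a F])
  ultimately have "qD (E2 ^ a * F) \<in> Xfilt l (2 * a + b + 2)" by (simp add: qD_mult Xfilt_add algebra_simps)
  then have "qD (E2 ^ a * F) \<in> Xfilt l (k + 2)" by (rule Xfilt_mono) (use Xfilt_step in simp)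
  then show ?case using Xfilt_step by (simp add: qD_add Xfilt_add)
qed

section \<open>Dyson's symmetry of ranks\<close>

lemma finite_partitions [simp]: "finite (partitions n)"
proof (rule finite_subset)
  show "partitions n \<subseteq> mset ` {xs. set xs \<subseteq> {..n} \<and> length xs \<le> n}"
  proof
    fix M assume M: "M \<in> partitions n"
    obtain xs where xs: "M = mset xs" using ex_mset by metis
    have "\<forall>x\<in>set xs. 0 < x" using M by (simp add: xs partitions_def)
    then have "length xs \<le> sum_list xs" by (induction xs) auto
    moreover have "\<forall>x\<in>set xs. x \<le> sum_list xs" using member_le_sum_list by blast
    moreover have "sum_list xs = n" using M by (simp add: xs partitions_def sum_mset_sum_list)
    ultimately show "M \<in> mset ` {xs. set xs \<subseteq> {..n} \<and> length xs \<le> n}" using xs by auto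
  qed
qed (auto intro: finite_imageI finite_lists_length_le)

lemma partitions_0 [simp]: "partitions 0 = {{#}}"
  by (auto simp: partitions_def) (metis multiset_nonemptyE less_irrefl)

lemma partition_bounds:
  assumes "M \<in> partitions n" "M \<noteq> {#}"
  shows "1 \<le> size M" "size M \<le> n" "1 \<le> Max_mset M" "Max_mset M \<le> n"
proof -
  have pos: "\<forall>x\<in>#M. 0 < x" and s: "sum_mset M = n" using assms by (auto simp: partitions_def)
  show "1 \<le> size M" using assms by (simp add: Suc_leI nonempty_has_size)
  have "size M = sum_mset (image_mset (\<lambda>_. 1) M)" by (rule size_eq_sum_mset)
  also have "\<dots> \<le> sum_mset (image_mset (\<lambda>x. x) M)" using pos by (intro sum_mset_mono) (simp add: Suc_leI)
  finally show "size M \<le> n" using s by simp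
  have "Max_mset M \<in># M" using assms by simp
  then show "1 \<le> Max_mset M" "Max_mset M \<le> n"
    using pos s by (auto simp: Suc_leI sum_mset.remove)
qed

lemma rank_bounds:
  assumes "M \<in> partitions n"
  shows "Defs.rank M \<le> int n" "- int n \<le> Defs.rank M" "n > 0 \<Longrightarrow> Defs.rank M < int n" "n > 0 \<Longrightarrow> - int n < Defs.rank M"
proof -
  have "M = {#} \<Longrightarrow> n = 0" using assms by (auto simp: partitions_def)
  then have "Defs.rank M \<le> int n \<and> - int n \<le> Defs.rank M \<and> (n > 0 \<longrightarrow> Defs.rank M < int n \<and> - int n < Defs.rank M)"
  proof (cases "M = {#}")
    case False
    then have "Defs.rank M = int (Max_mset M) - int (size M)" by (simp add: Defs.rank_def)
    then show ?thesis using partition_bounds[OF assms False] by linarith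
  qed (simp add: Defs.rank_def)
  then show "Defs.rank M \<le> int n" "- int n \<le> Defs.rank M" "n > 0 \<Longrightarrow> Defs.rank M < int n" "n > 0 \<Longrightarrow> - int n < Defs.rank M"
    by auto
qed

definition dyson :: "int \<Rightarrow> nat multiset \<Rightarrow> nat multiset" where
  "dyson r M = add_mset (nat (int (size M) + r)) (filter_mset (\<lambda>x. 0 < x) (image_mset (\<lambda>x. x - 1) M))"

text \<open>The largest part of an image under \<open>dyson r\<close> is the old number of parts
  plus \<open>r\<close>, so that number is the maximum minus \<open>r\<close>. Parts equal to 1
  vanished with the first column and are refilled up to this number.\<close>

definition dyson_inv :: "int \<Rightarrow> nat multiset \<Rightarrow> nat multiset" where
  "dyson_inv r M = image_mset Suc (M - {#Max_mset M#})
     + replicate_mset (nat (int (Max_mset M) - r) - (size M - 1)) 1"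

lemma sum_mset_filter_pos: "sum_mset (filter_mset (\<lambda>x. 0 < x) M) = sum_mset (M :: nat multiset)"
  by (induction M) auto

lemma sum_mset_pred: "\<forall>x\<in>#M. 0 < x \<Longrightarrow> sum_mset (image_mset (\<lambda>x. x - 1) M) + size M = sum_mset (M :: nat multiset)"
  by (induction M) auto

text \<open>Rank at most r + 1 says that the new part is not smaller than any part left after
  removing the column; rank at least r - 1 says that the number of ones refilled by
  \<open>dyson_inv\<close> is not negative.\<close>

lemma dyson_bij:
  assumes n: "n > 0" and r: "int n = int n' + r"
  shows "bij_betw (dyson r) {M \<in> partitions n'. Defs.rank M \<le> r + 1} {M \<in> partitions n. r - 1 \<le> Defs.rank M}"
proof (rule bij_betw_byWitness[where f' = "dyson_inv r"])
  let ?A = "{M \<in> partitions n'. Defs.rank M \<le> r + 1}" and ?B = "{M \<in> partitions n. r - 1 \<le> Defs.rank M}"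
  have A: "int (size M) + r > 0 \<and> (\<forall>x\<in>#M. int x - 1 \<le> int (size M) + r) \<and> Max_mset (dyson r M) = nat (int (size M) + r)
      \<and> dyson r M \<in> ?B \<and> dyson_inv r (dyson r M) = M" if M: "M \<in> ?A" for M
  proof -
    have pos: "\<forall>x\<in>#M. 0 < x" and s: "sum_mset M = n'" using M by (auto simp: partitions_def)
    have le: "\<forall>x\<in>#M. int x - 1 \<le> int (size M) + r"
    proof
      fix x assume x: "x \<in># M"
      then have "Defs.rank M = int (Max_mset M) - int (size M)" by (auto simp: Defs.rank_def)
      moreover have "x \<le> Max_mset M" using x by simp
      ultimately show "int x - 1 \<le> int (size M) + r" using M by simp
    qed
    have gt: "int (size M) + r > 0"
    proof (cases "M = {#}")
      case True then show ?thesis using s n r by simp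
    next
      case False
      then obtain x where x: "x \<in># M" by auto
      show ?thesis
      proof (rule ccontr)
        \<comment> \<open>Otherwise every part is 1, so n' is the number of parts and n = n' + r
          would not be positive.\<close>
        assume neg: "\<not> ?thesis"
        have "\<forall>x\<in>#M. x = 1" using le neg pos by force
        then have "sum_mset M = size M" by (induction M) auto
        then show False using neg s n r by simp
      qed
    qed
    let ?R = "filter_mset (\<lambda>x. 0 < x) (image_mset (\<lambda>x. x - 1) M)"
    have sR: "sum_mset ?R + size M = n'" using sum_mset_pred[OF pos] s by (simp only: sum_mset_filter_pos)
    have szR: "size ?R \<le> size M" by (metis size_filter_mset_lesseq size_image_mset)
    have leR: "\<forall>x\<in>#?R. x \<le> nat (int (size M) + r)" using le gt by force
    have max: "Max_mset (dyson r M) = nat (int (size M) + r)"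
      unfolding dyson_def set_mset_add_mset_insert using leR by (intro Max_eqI) auto
    have "sum_mset (dyson r M) = nat (int (size M) + r) + sum_mset ?R" unfolding dyson_def by (rule sum_mset.add_mset)
    then have "sum_mset (dyson r M) = n" using sR gt r by linarith
    moreover have "\<forall>x\<in>#dyson r M. 0 < x" using gt by (auto simp: dyson_def)
    ultimately have "dyson r M \<in> partitions n" by (simp add: partitions_def)
    moreover have "r - 1 \<le> Defs.rank (dyson r M)"
    proof -
      have "Defs.rank (dyson r M) = int (Max_mset (dyson r M)) - int (size (dyson r M))" by (simp add: Defs.rank_def dyson_def)
      then show ?thesis unfolding max using szR gt by (simp add: dyson_def)
    qed
    moreover have "dyson_inv r (dyson r M) = M"
    proof -
      have d: "dyson r M - {#Max_mset (dyson r M)#} = ?R" unfolding max by (simp add: dyson_def)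
      have R1: "image_mset Suc ?R = filter_mset (\<lambda>x. 1 < x) M" using pos by (induction M) auto
      have szR': "size ?R = size (filter_mset (\<lambda>x. 1 < x) M)" using R1 by (metis size_image_mset)
      have "size M = size (filter_mset (\<lambda>x. 1 < x) M) + size (filter_mset (\<lambda>x. \<not> 1 < x) M)"
        by (metis multiset_partition size_union)
      moreover have "filter_mset (\<lambda>x. \<not> 1 < x) M = filter_mset (\<lambda>x. x = 1) M" using pos by (intro filter_mset_cong) auto
      ultimately have cnt: "size M - size ?R = count M 1" unfolding szR' by (simp add: filter_eq_replicate_mset)
      have "nat (int (Max_mset (dyson r M)) - r) - (size (dyson r M) - 1) = count M 1"
        unfolding max using gt cnt by (simp add: dyson_def)
      then have "dyson_inv r (dyson r M) = filter_mset (\<lambda>x. 1 < x) M + replicate_mset (count M 1) 1"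
        unfolding dyson_inv_def d R1 by simp
      also have "replicate_mset (count M 1) 1 = filter_mset (\<lambda>x. x = 1) M" by (simp add: filter_eq_replicate_mset)
      also have "\<dots> = filter_mset (\<lambda>x. \<not> 1 < x) M" using pos by (intro filter_mset_cong) auto
      also have "filter_mset (\<lambda>x. 1 < x) M + filter_mset (\<lambda>x. \<not> 1 < x) M = M" by (rule multiset_partition[symmetric])
      finally show ?thesis .
    qed
    ultimately show ?thesis using gt le max by blast
  qed
  have B: "dyson_inv r M \<in> ?A \<and> dyson r (dyson_inv r M) = M" if M: "M \<in> ?B" for M
  proof -
    have pos: "\<forall>x\<in>#M. 0 < x" and s: "sum_mset M = n" using M by (auto simp: partitions_def)
    have ne: "M \<noteq> {#}" using s n by auto
    define m where "m = Max_mset M"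
    have mM: "m \<in># M" using ne by (simp add: m_def)
    define S where "S = M - {#m#}"
    have MS: "M = add_mset m S" using mM by (simp add: S_def)
    define k where "k = nat (int m - r)"
    have rk: "Defs.rank M = int m - int (size M)" using ne by (simp add: Defs.rank_def m_def)
    have szS: "size M = Suc (size S)" by (simp add: MS)
    have k1: "size S \<le> k" and k2: "int k = int m - r" using M rk szS by (auto simp: k_def)
    have inv: "dyson_inv r M = image_mset Suc S + replicate_mset (k - size S) 1"
      unfolding dyson_inv_def m_def[symmetric] S_def[symmetric] k_def[symmetric] by (simp add: szS)
    have szi: "size (dyson_inv r M) = k" using k1 by (simp add: inv)
    have sumSuc: "sum_mset (image_mset Suc S) = sum_mset S + size S" by (induction S) auto
    have "sum_mset (dyson_inv r M) = sum_mset S + size S + (k - size S)" unfolding inv using sumSuc by simp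
    moreover have "sum_mset M = m + sum_mset S" by (simp add: MS)
    ultimately have "sum_mset (dyson_inv r M) = n'" using k1 k2 s r by linarith
    then have p: "dyson_inv r M \<in> partitions n'" unfolding partitions_def by (auto simp: inv)
    have rank: "Defs.rank (dyson_inv r M) \<le> r + 1"
    proof (cases "dyson_inv r M = {#}")
      case True
      then have "n' = 0" using p by (auto simp: partitions_def)
      then show ?thesis using True r n by (simp add: Defs.rank_def)
    next
      case False
      have "\<forall>x\<in>#S. x \<le> m" unfolding m_def S_def by (auto dest: in_diffD)
      then have "\<forall>x\<in>#dyson_inv r M. x \<le> Suc m" unfolding inv by (auto simp: in_replicate_mset)
      then have "Max_mset (dyson_inv r M) \<le> Suc m" using False by simp
      moreover have "Defs.rank (dyson_inv r M) = int (Max_mset (dyson_inv r M)) - int (size (dyson_inv r M))"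
        using False by (simp add: Defs.rank_def)
      ultimately show ?thesis using k2 szi by linarith
    qed
    have "dyson r (dyson_inv r M) = M"
    proof -
      have "filter_mset (\<lambda>x. 0 < x) (image_mset (\<lambda>x. x - 1) (dyson_inv r M)) = filter_mset (\<lambda>x. 0 < x) S"
        unfolding inv by (simp add: image_mset.compositionality o_def image_replicate_mset filter_mset_eq_conv)
      also have "\<dots> = S" using pos MS by (simp add: filter_mset_eq_conv)
      finally show ?thesis unfolding dyson_def szi using k2 MS by simp
    qed
    then show ?thesis using p rank by blast
  qed
  show "\<forall>M\<in>?A. dyson_inv r (dyson r M) = M" using A by blast
  show "\<forall>M\<in>?B. dyson r (dyson_inv r M) = M" using B by blast
  show "dyson r ` ?A \<subseteq> ?B" using A by blast
  show "dyson_inv r ` ?B \<subseteq> ?A" using B by blast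
qed

text \<open>Both counts take integer arguments and vanish for negative \<open>n\<close>, so that the functional equation holds
  without side conditions.\<close>

definition pcount :: "int \<Rightarrow> rat" where
  "pcount n = (if n < 0 then 0 else of_nat (card (partitions (nat n))))"

definition rcount :: "int \<Rightarrow> int \<Rightarrow> rat" where
  "rcount m n = (if n < 0 then 0 else of_nat (card {M \<in> partitions (nat n). Defs.rank M \<le> m}))"

lemma rcount_compl:
  assumes "n \<ge> 0"
  shows "pcount n - rcount m n = of_nat (card {M \<in> partitions (nat n). m + 1 \<le> Defs.rank M})"
proof -
  have "partitions (nat n) = {M \<in> partitions (nat n). Defs.rank M \<le> m} \<union> {M \<in> partitions (nat n). m + 1 \<le> Defs.rank M}" by auto
  then have "card (partitions (nat n)) = card {M \<in> partitions (nat n). Defs.rank M \<le> m} + card {M \<in> partitions (nat n). m + 1 \<le> Defs.rank M}"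
    by (metis (no_types, lifting) card_Un_disjoint finite_Un finite_partitions disjoint_iff mem_Collect_eq not_less zle_add1_eq_le less_add_one)
  then show ?thesis using assms by (simp add: pcount_def rcount_def)
qed

text \<open>It serves the case n = 0 of \<open>dyson_relation\<close>, outside the range of the
  bijection: 1 - n' is the least rank that a partition of n' can have.\<close>

lemma rcount_all_ones:
  assumes "n' > 0" shows "{M \<in> partitions n'. Defs.rank M \<le> 1 - int n'} = {replicate_mset n' 1}"
proof (intro equalityI subsetI)
  fix M assume M: "M \<in> {M \<in> partitions n'. Defs.rank M \<le> 1 - int n'}"
  have ne: "M \<noteq> {#}" using M assms by (auto simp: partitions_def)
  have b: "size M \<le> n'" "1 \<le> Max_mset M" using partition_bounds[of M n'] M ne by auto
  have "int (Max_mset M) - int (size M) \<le> 1 - int n'" using M ne by (simp add: Defs.rank_def)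
  then have "Max_mset M = 1" "size M = n'" using b by linarith+
  moreover have "\<forall>x\<in>#M. x = 1"
  proof
    fix x assume x: "x \<in># M"
    then have "x \<le> Max_mset M" "x > 0" using M by (auto simp: partitions_def)
    then show "x = 1" using \<open>Max_mset M = 1\<close> by simp
  qed
  ultimately show "M \<in> {replicate_mset n' 1}"
    by (metis insert_iff set_mset_subset_singletonD subsetI singletonI)
next
  fix M assume "M \<in> {replicate_mset n' (1::nat)}"
  moreover have "replicate_mset n' (1::nat) \<noteq> {#}" using assms by simp
  ultimately show "M \<in> {M \<in> partitions n'. Defs.rank M \<le> 1 - int n'}"
    using assms by (auto simp: partitions_def Defs.rank_def in_replicate_mset)
qed

text \<open>Without the factor the identity fails, because of the empty partition, exactly at \<open>(m, n) = (-1, 0)\<close> and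
  \<open>(m, n) = (-3, -1)\<close>; there the factor is zero.\<close>

lemma dyson_relation:
  "of_int (6 * n + m * (m + 1)) * (pcount n - rcount m n) = of_int (6 * n + m * (m + 1)) * rcount (m + 3) (n - m - 2)"
proof -
  define n' where "n' = n - m - 2"
  \<comment> \<open>Only the first case uses the bijection, with r = m + 2; in the others each side
    counts at most one partition.\<close>
  consider "n \<ge> 1" "n' \<ge> 0" | "n \<ge> 1" "n' < 0" | "n = 0" "n' \<ge> 1" | "n = 0" "n' = 0" | "n = 0" "n' < 0"
    | "n < 0" "n' \<ge> 1" | "n < 0" "n' = 0" | "n < 0" "n' < 0" by linarith
  then show ?thesis
  proof cases
    case 1
    have "bij_betw (dyson (m + 2)) {M \<in> partitions (nat n'). Defs.rank M \<le> (m + 2) + 1} {M \<in> partitions (nat n). (m + 2) - 1 \<le> Defs.rank M}"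
      by (rule dyson_bij) (use 1 in \<open>auto simp: n'_def\<close>)
    then have "card {M \<in> partitions (nat n'). Defs.rank M \<le> m + 3} = card {M \<in> partitions (nat n). m + 1 \<le> Defs.rank M}"
      using bij_betw_same_card by (fastforce simp: algebra_simps)
    then show ?thesis using 1 rcount_compl[of n m] unfolding n'_def[symmetric] by (simp add: rcount_def)
  next
    case 2
    have "{M \<in> partitions (nat n). m + 1 \<le> Defs.rank M} = {}"
      using rank_bounds(3)[of _ "nat n"] 2 by (force simp: n'_def)
    then show ?thesis using 2 rcount_compl[of n m] unfolding n'_def[symmetric] by (simp add: rcount_def)
  next
    case 3
    then have "m + 3 = 1 - int (nat n')" by (simp add: n'_def)
    then have "rcount (m + 3) n' = 1" using rcount_all_ones[of "nat n'"] 3 by (simp only: rcount_def) simp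
    moreover have "pcount n - rcount m n = 1" using 3 by (auto simp: pcount_def rcount_def Defs.rank_def n'_def)
    ultimately show ?thesis unfolding n'_def[symmetric] by simp
  next
    case 4
    have "{M. M = {#} \<and> Defs.rank M \<le> m + 3} = {{#}}" using 4 by (auto simp: Defs.rank_def n'_def)
    then have "rcount (m + 3) n' = 1" using 4 by (simp add: rcount_def)
    moreover have "pcount n - rcount m n = 1" using 4 by (auto simp: pcount_def rcount_def Defs.rank_def n'_def)
    ultimately show ?thesis unfolding n'_def[symmetric] by simp
  next
    case 5
    show ?thesis
    proof (cases "m = -1")
      case True then show ?thesis using 5 by simp
    next
      case False
      then have "{M. M = {#} \<and> Defs.rank M \<le> m} = {{#}}" using 5 by (auto simp: Defs.rank_def n'_def)
      then show ?thesis unfolding n'_def[symmetric] using 5 by (simp add: pcount_def rcount_def)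
    qed
  next
    case 6
    have "{M \<in> partitions (nat n'). Defs.rank M \<le> m + 3} = {}"
      using rank_bounds(4)[of _ "nat n'"] 6 by (force simp: n'_def)
    then show ?thesis unfolding n'_def[symmetric] using 6 by (simp add: pcount_def rcount_def)
  next
    case 7
    then have m: "m = n - 2" by (simp add: n'_def)
    show ?thesis
    proof (cases "n = -1")
      case True then show ?thesis using m by simp
    next
      case False
      then have "{M. M = {#} \<and> Defs.rank M \<le> m + 3} = {}" using 7 m by (auto simp: Defs.rank_def)
      then show ?thesis unfolding n'_def[symmetric] using 7 by (simp add: pcount_def rcount_def)
    qed
  next
    case 8
    then show ?thesis unfolding n'_def[symmetric] by (simp add: pcount_def rcount_def)
  qed
qed

section \<open>The rank-crank equation\<close>

definition tri :: "int \<Rightarrow> int" where "tri a = a * (a + 1) div 2"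

lemma tri_double: "2 * tri a = a * (a + 1)"
  unfolding tri_def by (simp add: dvd_mult_div_cancel)

lemma tri_reflect: "tri (- 1 - a) = tri a"
  unfolding tri_def by (simp add: algebra_simps)

lemma tri_Suc: "tri (a + 1) = tri a + a + 1"
  using tri_double[of a] tri_double[of "a + 1"] by (simp add: algebra_simps)

lemma tri_ge: "tri a \<ge> a" "tri a \<ge> - 1 - a" "tri a \<ge> 0"
proof -
  have ge: "tri a \<ge> a \<and> tri a \<ge> 0" if "a \<ge> 0" for a
  proof (cases "a = 0")
    case True then show ?thesis by (simp add: tri_def)
  next
    case False
    then have "a * 2 \<le> a * (a + 1)" using that by (intro mult_left_mono) auto
    then show ?thesis using tri_double[of a] that by linarith
  qed
  show "tri a \<ge> a" "tri a \<ge> - 1 - a" "tri a \<ge> 0"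
    using ge[of a] ge[of "- 1 - a"] tri_reflect[of a] by (cases "a \<ge> 0"; linarith)+
qed

lemma finite_tri_le [simp]: "finite {a. tri a \<le> N}"
proof (rule finite_subset)
  show "{a. tri a \<le> N} \<subseteq> {- 1 - N..N}"
  proof
    fix a assume "a \<in> {a. tri a \<le> N}"
    then show "a \<in> {- 1 - N..N}" using tri_ge[of a] by simp
  qed
qed simp

lemma finite_tri_eq [simp]: "finite {a. tri a = N}"
  by (rule finite_subset[OF _ finite_tri_le[of N]]) auto

definition sg :: "int \<Rightarrow> 'a::comm_ring_1" where "sg a = (if even a then 1 else - 1)"

lemma sg_Suc: "sg (a + 1) = - sg a" by (simp add: sg_def)

lemma sg_add: "sg (a + b) = sg a * sg b" by (auto simp: sg_def)

definition tri_set :: "int \<Rightarrow> (int \<times> int \<times> int) set" where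
  "tri_set N = {(a, b, c). tri a + tri b + tri c \<le> N}"

lemma tri_set_bounds:
  assumes "(a, b, c) \<in> tri_set N"
  shows "\<bar>a + b + c\<bar> \<le> 3 * N + 3" "0 \<le> N"
proof -
  have "tri a + tri b + tri c \<le> N" using assms by (simp add: tri_set_def)
  then show "\<bar>a + b + c\<bar> \<le> 3 * N + 3" "0 \<le> N" using tri_ge[of a] tri_ge[of b] tri_ge[of c] by linarith+
qed

lemma finite_tri_set [simp]: "finite (tri_set N)"
proof (rule finite_subset)
  show "tri_set N \<subseteq> {a. tri a \<le> N} \<times> {a. tri a \<le> N} \<times> {a. tri a \<le> N}"
  proof safe
    fix a b c assume "(a, b, c) \<in> tri_set N"
    then have "tri a + tri b + tri c \<le> N" by (simp add: tri_set_def)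
    then show "tri a \<le> N" "tri b \<le> N" "tri c \<le> N" using tri_ge[of a] tri_ge[of b] tri_ge[of c] by linarith+
  qed
qed simp

text \<open>Coefficient of q^N in the cube of the theta series times a q-series with coefficients
  \<open>F s n\<close>, where \<open>s\<close> is the power of w contributed by the three theta
  factors, up to the shift 3/2.\<close>

definition tri_sum :: "int \<Rightarrow> (int \<Rightarrow> int \<Rightarrow> 'a::comm_ring_1) \<Rightarrow> 'a" where
  "tri_sum N F = (\<Sum>(a, b, c)\<in>tri_set N. sg (a + b + c) * F (a + b + c) (N - (tri a + tri b + tri c)))"

text \<open>The reflection a -> -1 - a preserves \<open>tri a\<close> and reverses
  \<open>sg a\<close>.\<close>

lemma tri_sum_reflect:
  fixes g :: "int \<Rightarrow> int \<Rightarrow> int \<Rightarrow> int \<Rightarrow> 'a::comm_ring_1" and N :: int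
  defines "S \<equiv> \<lambda>g. \<Sum>(a, b, c)\<in>tri_set N. sg (a + b + c) * g a b c (N - (tri a + tri b + tri c))"
  shows "S (\<lambda>a. g (- 1 - a)) = - S g" "S (\<lambda>a b. g a (- 1 - b)) = - S g" "S (\<lambda>a b c. g a b (- 1 - c)) = - S g"
proof -
  have "S (\<lambda>a. g (- 1 - a)) = (\<Sum>(a, b, c)\<in>tri_set N. - (sg (a + b + c) * g a b c (N - (tri a + tri b + tri c))))"
    unfolding S_def
    by (rule sum.reindex_bij_witness[where i = "\<lambda>(a, b, c). (- 1 - a, b, c)" and j = "\<lambda>(a, b, c). (- 1 - a, b, c)"])
       (auto simp: tri_set_def tri_reflect sg_def)
  then show "S (\<lambda>a. g (- 1 - a)) = - S g" unfolding S_def by (simp add: sum_negf case_prod_unfold)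
  have "S (\<lambda>a b. g a (- 1 - b)) = (\<Sum>(a, b, c)\<in>tri_set N. - (sg (a + b + c) * g a b c (N - (tri a + tri b + tri c))))"
    unfolding S_def
    by (rule sum.reindex_bij_witness[where i = "\<lambda>(a, b, c). (a, - 1 - b, c)" and j = "\<lambda>(a, b, c). (a, - 1 - b, c)"])
       (auto simp: tri_set_def tri_reflect sg_def)
  then show "S (\<lambda>a b. g a (- 1 - b)) = - S g" unfolding S_def by (simp add: sum_negf case_prod_unfold)
  have "S (\<lambda>a b c. g a b (- 1 - c)) = (\<Sum>(a, b, c)\<in>tri_set N. - (sg (a + b + c) * g a b c (N - (tri a + tri b + tri c))))"
    unfolding S_def
    by (rule sum.reindex_bij_witness[where i = "\<lambda>(a, b, c). (a, b, - 1 - c)" and j = "\<lambda>(a, b, c). (a, b, - 1 - c)"])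
       (auto simp: tri_set_def tri_reflect sg_def)
  then show "S (\<lambda>a b c. g a b (- 1 - c)) = - S g" unfolding S_def by (simp add: sum_negf case_prod_unfold)
qed

text \<open>The triple zero of the cube of the theta series: the third difference of a quadratic polynomial under the
  reflections \<open>a \<mapsto> -1 - a\<close> in the three summation variables is zero.\<close>

lemma tri_sum_quadratic:
  fixes A B C :: "int \<Rightarrow> 'a::idom"
  assumes two: "(2::'a) \<noteq> 0"
  shows "tri_sum N (\<lambda>s n. A n + B n * of_int s + C n * (of_int s)\<^sup>2) = 0"
proof -
  define S :: "(int \<Rightarrow> int \<Rightarrow> int \<Rightarrow> int \<Rightarrow> 'a) \<Rightarrow> 'a" where
    "S = (\<lambda>g. \<Sum>(a, b, c)\<in>tri_set N. sg (a + b + c) * g a b c (N - (tri a + tri b + tri c)))"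
  define g where "g = (\<lambda>a b c n. A n + B n * of_int (a + b + c) + C n * (of_int (a + b + c))\<^sup>2)"
  have r1: "S (\<lambda>a. h (- 1 - a)) = - S h" and r2: "S (\<lambda>a b. h a (- 1 - b)) = - S h"
    and r3: "S (\<lambda>a b c. h a b (- 1 - c)) = - S h" for h
    using tri_sum_reflect[of h N] by (auto simp: S_def)
  have lin: "S f - S h = S (\<lambda>a b c n. f a b c n - h a b c n)" for f h
    unfolding S_def by (simp add: sum_subtractf case_prod_unfold algebra_simps)
  define g1 where "g1 = (\<lambda>a b c n. g a b c n - g (- 1 - a) b c n)"
  define g2 where "g2 = (\<lambda>a b c n. g1 a b c n - g1 a (- 1 - b) c n)"
  define g3 where "g3 = (\<lambda>a b c n. g2 a b c n - g2 a b (- 1 - c) n)"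
  have s1: "S g1 = 2 * S g" using lin[of g "\<lambda>a. g (- 1 - a)"] r1[of g] by (simp add: g1_def)
  have s2: "S g2 = 2 * S g1" using lin[of g1 "\<lambda>a b. g1 a (- 1 - b)"] r2[of g1] by (simp add: g2_def)
  have s3: "S g3 = 2 * S g2" using lin[of g2 "\<lambda>a b c. g2 a b (- 1 - c)"] r3[of g2] by (simp add: g3_def)
  have "g3 a b c n = 0" for a b c n
    unfolding g3_def g2_def g1_def g_def by (simp add: algebra_simps power2_eq_square)
  then have "S g3 = 0" unfolding S_def by simp
  then have "S g2 = 0" using s3 two by simp
  then have "S g1 = 0" using s2 two by simp
  then have "S g = 0" using s1 two by simp
  then show ?thesis by (simp add: tri_sum_def S_def g_def)
qed

definition rank_weight :: "int \<Rightarrow> int \<Rightarrow> rat" where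
  "rank_weight m n = of_int (6 * n + m * (m + 1)) * rcount m n"

text \<open>The factor 6 n + m (m + 1) is invariant under (m, n) -> (m + 3, n - m - 2), which
  accounts for its shape.\<close>

lemma rank_weight_relation: "rank_weight m n + rank_weight (m + 3) (n - m - 2) = of_int (6 * n + m * (m + 1)) * pcount n"
proof -
  have "6 * (n - m - 2) + (m + 3) * (m + 3 + 1) = 6 * n + m * (m + 1)" by (simp add: algebra_simps)
  then show ?thesis using dyson_relation[of n m] unfolding rank_weight_def by (simp only:) (simp add: algebra_simps)
qed

lemma rank_weight_neg: "n < 0 \<Longrightarrow> rank_weight m n = 0" by (simp add: rank_weight_def rcount_def)

text \<open>\<open>theta_rank m N\<close> is the coefficient of \<open>w^m q^N\<close> in the product of the cube of the theta series with
  \<open>\<Sum> rank_weight m n w^m q^n\<close>.\<close>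

definition theta_rank :: "int \<Rightarrow> int \<Rightarrow> rat" where
  "theta_rank m N = tri_sum N (\<lambda>s n. rank_weight (m - s) n)"

text \<open>Invariance under w -> q w, coefficient by coefficient. In
  \<open>rank_weight_relation\<close> summed against the theta cube the right-hand side is quadratic
  in s and vanishes; raising a, b, c by one turns the second term into minus the coefficient at N -
  m - 2.\<close>

lemma theta_rank_shift: "theta_rank m N = theta_rank m (N - m - 2)"
proof -
  define sh where "sh = (\<lambda>(a, b, c). (a + 1, b + 1, c + 1) :: int \<times> int \<times> int)"
  \<comment> \<open>A common index set for both regions; outside its own region each summand
    vanishes because the counts vanish at negative n.\<close>
  define V where "V = tri_set N \<union> sh ` tri_set (N - m - 2)"
  have fin: "finite V" by (simp add: V_def)
  let ?n = "\<lambda>a b c. N - (tri a + tri b + tri c)"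
  have 1: "theta_rank m N = (\<Sum>(a, b, c)\<in>V. sg (a + b + c) * rank_weight (m - (a + b + c)) (?n a b c))"
    unfolding theta_rank_def tri_sum_def
  proof (rule sum.mono_neutral_left[OF fin])
    show "\<forall>i\<in>V - tri_set N. (case i of (a, b, c) \<Rightarrow> sg (a + b + c) * rank_weight (m - (a + b + c)) (?n a b c)) = 0"
    proof clarify
      fix a b c assume "(a, b, c) \<notin> tri_set N"
      then have "?n a b c < 0" by (simp add: tri_set_def)
      then show "sg (a + b + c) * rank_weight (m - (a + b + c)) (?n a b c) = 0" by (simp add: rank_weight_neg)
    qed
  qed (simp add: V_def)
  have 2: "(\<Sum>(a, b, c)\<in>V. sg (a + b + c) * (of_int (6 * ?n a b c + (m - (a + b + c)) * (m - (a + b + c) + 1)) * pcount (?n a b c))) = 0"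
  proof -
    have "(\<Sum>(a, b, c)\<in>V. sg (a + b + c) * (of_int (6 * ?n a b c + (m - (a + b + c)) * (m - (a + b + c) + 1)) * pcount (?n a b c)))
      = tri_sum N (\<lambda>s n. of_int (6 * n + (m - s) * (m - s + 1)) * pcount n)"
      unfolding tri_sum_def
    proof (rule sum.mono_neutral_right[OF fin])
      show "\<forall>i\<in>V - tri_set N. (case i of (a, b, c) \<Rightarrow> sg (a + b + c) * (of_int (6 * ?n a b c + (m - (a + b + c)) * (m - (a + b + c) + 1)) * pcount (?n a b c))) = 0"
      proof clarify
        fix a b c assume "(a, b, c) \<notin> tri_set N"
        then have "pcount (?n a b c) = 0" by (simp add: tri_set_def pcount_def)
        then show "sg (a + b + c) * (of_int (6 * ?n a b c + (m - (a + b + c)) * (m - (a + b + c) + 1)) * pcount (?n a b c)) = 0" by simp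
      qed
    qed (simp add: V_def)
    also have "\<dots> = tri_sum N (\<lambda>s n. of_int (6 * n + m * (m + 1)) * pcount n + (of_int (- 2 * m - 1) * pcount n) * of_int s + pcount n * (of_int s)\<^sup>2)"
      by (intro arg_cong[of _ _ "tri_sum N"] ext) (simp add: algebra_simps power2_eq_square)
    also have "\<dots> = 0" by (rule tri_sum_quadratic) simp
    finally show ?thesis .
  qed
  have 3: "(\<Sum>(a, b, c)\<in>V. sg (a + b + c) * rank_weight (m - (a + b + c) + 3) (?n a b c - (m - (a + b + c)) - 2)) = - theta_rank m (N - m - 2)"
  proof -
    have inj: "inj_on sh (tri_set (N - m - 2))" by (auto simp: inj_on_def sh_def)
    have z: "?n a b c - (m - (a + b + c)) - 2 < 0" if "(a, b, c) \<notin> sh ` tri_set (N - m - 2)" for a b c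
    proof -
      have "(a - 1, b - 1, c - 1) \<notin> tri_set (N - m - 2)" using that by (force simp: sh_def image_iff)
      then have "tri (a - 1) + tri (b - 1) + tri (c - 1) > N - m - 2" by (simp add: tri_set_def)
      then show ?thesis using tri_Suc[of "a - 1"] tri_Suc[of "b - 1"] tri_Suc[of "c - 1"] by simp
    qed
    have "(\<Sum>(a, b, c)\<in>V. sg (a + b + c) * rank_weight (m - (a + b + c) + 3) (?n a b c - (m - (a + b + c)) - 2))
      = (\<Sum>(a, b, c)\<in>sh ` tri_set (N - m - 2). sg (a + b + c) * rank_weight (m - (a + b + c) + 3) (?n a b c - (m - (a + b + c)) - 2))"
    proof (rule sum.mono_neutral_right[OF fin])
      show "\<forall>i\<in>V - sh ` tri_set (N - m - 2). (case i of (a, b, c) \<Rightarrow> sg (a + b + c) * rank_weight (m - (a + b + c) + 3) (?n a b c - (m - (a + b + c)) - 2)) = 0"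
        using rank_weight_neg[OF z] by (clarify, simp)
    qed (simp add: V_def)
    also have "\<dots> = (\<Sum>(a, b, c)\<in>tri_set (N - m - 2). - (sg (a + b + c) * rank_weight (m - (a + b + c)) (N - m - 2 - (tri a + tri b + tri c))))"
      unfolding sum.reindex[OF inj] o_def
    proof (intro sum.cong refl, clarify)
      fix a b c :: int
      have s: "a + 1 + (b + 1) + (c + 1) = (a + b + c) + 1 + 1 + 1" by simp
      have sgn: "sg (a + 1 + (b + 1) + (c + 1)) = - (sg (a + b + c) :: rat)" unfolding s sg_Suc by simp
      have n: "?n (a + 1) (b + 1) (c + 1) - (m - (a + 1 + (b + 1) + (c + 1))) - 2 = N - m - 2 - (tri a + tri b + tri c)"
        by (simp add: tri_Suc)
      have m: "m - (a + 1 + (b + 1) + (c + 1)) + 3 = m - (a + b + c)" by simp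
      show "(case sh (a, b, c) of (a, b, c) \<Rightarrow> sg (a + b + c) * rank_weight (m - (a + b + c) + 3) (?n a b c - (m - (a + b + c)) - 2)) =
          - (sg (a + b + c) * rank_weight (m - (a + b + c)) (N - m - 2 - (tri a + tri b + tri c)))"
        unfolding sh_def prod.case sgn n m by simp
    qed
    also have "\<dots> = - theta_rank m (N - m - 2)"
      unfolding theta_rank_def tri_sum_def by (simp add: sum_negf case_prod_unfold)
    finally show ?thesis .
  qed
  have "theta_rank m N + - theta_rank m (N - m - 2) = 0"
  proof -
    have "theta_rank m N + - theta_rank m (N - m - 2) = (\<Sum>(a, b, c)\<in>V. sg (a + b + c) * rank_weight (m - (a + b + c)) (?n a b c)
        + sg (a + b + c) * rank_weight (m - (a + b + c) + 3) (?n a b c - (m - (a + b + c)) - 2))"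
      unfolding 1 3[symmetric] by (simp only: sum.distrib[symmetric] case_prod_unfold)
    also have "\<dots> = 0"
      unfolding distrib_left[symmetric] rank_weight_relation by (rule 2)
    finally show ?thesis .
  qed
  then show ?thesis by simp
qed

lemma theta_rank_neg: "N < 0 \<Longrightarrow> theta_rank m N = 0"
proof -
  assume "N < 0"
  then have "tri_set N = {}" using tri_set_bounds(2) by fastforce
  then show ?thesis by (simp add: theta_rank_def tri_sum_def)
qed

text \<open>For m other than -2 the shift moves N by a nonzero amount, so it can be iterated until N
  is negative, where every coefficient is 0.\<close>

lemma theta_rank_eq_0:
  assumes "m \<noteq> - 2" shows "theta_rank m N = 0"
proof -
  define d where "d = \<bar>m + 2\<bar>"
  have d: "d \<ge> 1" using assms by (simp add: d_def)
  have step: "theta_rank m N = theta_rank m (N - d)" for N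
    using theta_rank_shift[of m N] theta_rank_shift[of m "N + m + 2"] by (cases "m + 2 \<ge> 0") (auto simp: d_def algebra_simps)
  have "theta_rank m N = 0" if "N < int k * d" for k N
    using that
  proof (induction k arbitrary: N)
    case 0 then show ?case by (simp add: theta_rank_neg)
  next
    case (Suc k)
    then have "N - d < int k * d" by (simp add: algebra_simps)
    then show ?case using Suc.IH step[of N] by simp
  qed
  moreover have "N < int (nat N + 1) * d"
  proof -
    have "N < int (nat N + 1) * 1" by simp
    also have "\<dots> \<le> int (nat N + 1) * d" using d by (intro mult_left_mono) auto
    finally show ?thesis .
  qed
  ultimately show ?thesis by blast
qed

text \<open>\<open>expu k\<close> stands for \<open>w^k\<close> with \<open>w = exp u\<close>, as a power series in \<open>u\<close>.\<close>

abbreviation expu :: "int \<Rightarrow> rat fps" where "expu k \<equiv> fps_exp (of_int k)"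

lemma expu_add: "expu (a + b) = expu a * expu b"
  by (simp add: fps_exp_add_mult)

text \<open>\<open>w^r * rank_symbol r n / (1 - w)^3\<close> is the sum of \<open>(6 n + m (m + 1)) w^m\<close> over \<open>m \<ge> r\<close>.\<close>

definition rank_symbol :: "int \<Rightarrow> int \<Rightarrow> rat fps" where
  "rank_symbol r n = (1 - expu 1)\<^sup>2 * of_int (6 * n + r * (r + 1)) + 2 * of_int (r + 1) * expu 1 * (1 - expu 1) + 2 * (expu 1)\<^sup>2"

lemma rank_symbol_step: "expu m * rank_symbol m n - expu (m + 1) * rank_symbol (m + 1) n = (1 - expu 1) ^ 3 * (of_int (6 * n + m * (m + 1)) * expu m)"
proof -
  have alg: "e * ((1 - w)\<^sup>2 * (6 * k + x * (x + 1)) + 2 * (x + 1) * w * (1 - w) + 2 * w\<^sup>2)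
      - e * w * ((1 - w)\<^sup>2 * (6 * k + (x + 1) * (x + 1 + 1)) + 2 * (x + 1 + 1) * w * (1 - w) + 2 * w\<^sup>2)
     = (1 - w) ^ 3 * ((6 * k + x * (x + 1)) * e)" for e w k x :: "rat fps"
    by (simp add: algebra_simps power2_eq_square power3_eq_cube)
  show ?thesis unfolding rank_symbol_def expu_add[of m 1]
    using alg[of "expu m" "expu 1" "of_int n" "of_int m"] by simp
qed

lemma rank_symbol_sum: "r \<le> K \<Longrightarrow> (1 - expu 1) ^ 3 * (\<Sum>m\<in>{r..<K}. of_int (6 * n + m * (m + 1)) * expu m) = expu r * rank_symbol r n - expu K * rank_symbol K n"
proof (induction K rule: int_ge_induct)
  case base then show ?case by simp
next
  case (step K)
  have "{r..<K + 1} = insert K {r..<K}" using step(1) by auto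
  then have "(1 - expu 1) ^ 3 * (\<Sum>m\<in>{r..<K + 1}. of_int (6 * n + m * (m + 1)) * expu m)
     = (1 - expu 1) ^ 3 * (of_int (6 * n + K * (K + 1)) * expu K) + (1 - expu 1) ^ 3 * (\<Sum>m\<in>{r..<K}. of_int (6 * n + m * (m + 1)) * expu m)"
    by (simp add: distrib_left)
  also have "\<dots> = expu r * rank_symbol r n - expu (K + 1) * rank_symbol (K + 1) n"
    unfolding step.IH rank_symbol_step[symmetric] by simp
  finally show ?case .
qed

text \<open>This stands for (1 - w)^3 times the sum of \<open>rank_weight m n\<close> w^m over all
  m. That sum is infinite, since the count equals p(n) for every large m, and it gets a meaning in
  powers of u only after the factor has cleared the pole at w = 1.\<close>

definition rank_op_gen :: "nat \<Rightarrow> rat fps" where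
  "rank_op_gen n = (\<Sum>M\<in>partitions n. expu (Defs.rank M) * rank_symbol (Defs.rank M) (int n))"

text \<open>Double counting of pairs of a partition and an m not below its rank. From
  \<open>K\<close> on every partition is counted, so the tail is p(n) times the closed form.\<close>

lemma rank_op_gen_expand:
  assumes "K \<ge> int n" "L \<ge> int n"
  shows "rank_op_gen n = (1 - expu 1) ^ 3 * (\<Sum>m\<in>{- L..<K}. fps_const (rank_weight m (int n)) * expu m) + fps_const (pcount (int n)) * (expu K * rank_symbol K (int n))"
proof -
  let ?f = "\<lambda>m. of_int (6 * int n + m * (m + 1)) * expu m"
  have rk: "- L \<le> Defs.rank M" "Defs.rank M \<le> K" if "M \<in> partitions n" for M
    using rank_bounds[OF that] assms by linarith+
  have "rank_op_gen n = (\<Sum>M\<in>partitions n. (1 - expu 1) ^ 3 * (\<Sum>m\<in>{Defs.rank M..<K}. ?f m) + expu K * rank_symbol K (int n))"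
    unfolding rank_op_gen_def by (intro sum.cong refl) (simp only: rank_symbol_sum[OF rk(2)] diff_add_cancel)
  also have "\<dots> = (1 - expu 1) ^ 3 * (\<Sum>M\<in>partitions n. \<Sum>m\<in>{Defs.rank M..<K}. ?f m) + fps_const (pcount (int n)) * (expu K * rank_symbol K (int n))"
    by (simp add: sum.distrib sum_distrib_left pcount_def fps_of_nat)
  also have "(\<Sum>M\<in>partitions n. \<Sum>m\<in>{Defs.rank M..<K}. ?f m) = (\<Sum>M\<in>partitions n. \<Sum>m | m \<in> {- L..<K} \<and> Defs.rank M \<le> m. ?f m)"
    using rk by (intro sum.cong refl) force
  also have "\<dots> = (\<Sum>m\<in>{- L..<K}. \<Sum>M | M \<in> partitions n \<and> Defs.rank M \<le> m. ?f m)"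
    by (rule sum.swap_restrict) auto
  also have "\<dots> = (\<Sum>m\<in>{- L..<K}. fps_const (rank_weight m (int n)) * expu m)"
  proof (intro sum.cong refl)
    fix m
    have "fps_const (rank_weight m (int n)) = of_int (6 * int n + m * (m + 1)) * of_nat (card {M \<in> partitions n. Defs.rank M \<le> m})"
      unfolding rank_weight_def rcount_def by (simp only: of_nat_less_0_iff if_False nat_int fps_const_mult[symmetric] fps_of_int fps_of_nat)
    then show "(\<Sum>M | M \<in> partitions n \<and> Defs.rank M \<le> m. ?f m) = fps_const (rank_weight m (int n)) * expu m"
      by (simp add: mult_ac)
  qed
  finally show ?thesis .
qed

lemma fps_const_sum: "fps_const (sum f A) = (\<Sum>x\<in>A. fps_const (f x))"
  by (rule fps_ext) (auto simp: fps_sum_nth)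

text \<open>All series are cut at the same \<open>K\<close>. Their tails are quadratic in s and
  cancel by the triple zero; the finite parts assemble to \<open>theta_rank\<close>, of which only m
  = -2 survives.\<close>

lemma tri_sum_rank_op_gen: "tri_sum N (\<lambda>s n. expu s * rank_op_gen (nat n)) = (1 - expu 1) ^ 3 * (fps_const (theta_rank (- 2) N) * expu (- 2))"
proof -
  \<comment> \<open>Large enough for all terms at once: |s| is at most 3 N + 3 and n at most N, so
    \<open>K - s\<close> and \<open>K + s\<close> both exceed n.\<close>
  define K where "K = 4 * N + 4"
  let ?n = "\<lambda>a b c. N - (tri a + tri b + tri c)"
  have termeq: "expu s * rank_op_gen (nat n) = (1 - expu 1) ^ 3 * (\<Sum>m\<in>{- K..<K}. fps_const (rank_weight (m - s) n) * expu m) + fps_const (pcount n) * (expu K * rank_symbol (K - s) n)"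
    if "\<bar>s\<bar> \<le> 3 * N + 3" "0 \<le> n" "n \<le> N" for s n
  proof -
    have n: "int (nat n) = n" using that by simp
    have "expu s * rank_op_gen (nat n) = (1 - expu 1) ^ 3 * (\<Sum>m\<in>{- (K + s)..<K - s}. fps_const (rank_weight m n) * (expu s * expu m)) + fps_const (pcount n) * ((expu s * expu (K - s)) * rank_symbol (K - s) n)"
      using rank_op_gen_expand[of "nat n" "K - s" "K + s"] that unfolding n K_def
      by (simp add: distrib_left sum_distrib_left mult_ac)
    also have "(\<Sum>m\<in>{- (K + s)..<K - s}. fps_const (rank_weight m n) * (expu s * expu m)) = (\<Sum>m\<in>{- K..<K}. fps_const (rank_weight (m - s) n) * expu m)"
      by (rule sum.reindex_bij_witness[where i = "\<lambda>m. m - s" and j = "\<lambda>m. m + s"]) (auto simp: mult.commute simp flip: fps_exp_add_mult)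
    also have "expu s * expu (K - s) = expu K" by (simp flip: fps_exp_add_mult)
    finally show ?thesis .
  qed
  have "tri_sum N (\<lambda>s n. expu s * rank_op_gen (nat n)) =
     (\<Sum>(a, b, c)\<in>tri_set N. (1 - expu 1) ^ 3 * (\<Sum>m\<in>{- K..<K}. fps_const (sg (a + b + c) * rank_weight (m - (a + b + c)) (?n a b c)) * expu m)
       + sg (a + b + c) * (fps_const (pcount (?n a b c)) * (expu K * rank_symbol (K - (a + b + c)) (?n a b c))))"
    unfolding tri_sum_def
  proof (intro sum.cong refl, clarify)
    fix a b c assume abc: "(a, b, c) \<in> tri_set N"
    have n: "0 \<le> ?n a b c" "?n a b c \<le> N" using abc tri_ge(3)[of a] tri_ge(3)[of b] tri_ge(3)[of c] by (auto simp: tri_set_def)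
    have sgc: "fps_const (sg (a + b + c) * x) = sg (a + b + c) * fps_const x" for x :: rat by (simp add: sg_def flip: fps_const_neg)
    show "sg (a + b + c) * (expu (a + b + c) * rank_op_gen (nat (?n a b c))) =
       (1 - expu 1) ^ 3 * (\<Sum>m\<in>{- K..<K}. fps_const (sg (a + b + c) * rank_weight (m - (a + b + c)) (?n a b c)) * expu m)
       + sg (a + b + c) * (fps_const (pcount (?n a b c)) * (expu K * rank_symbol (K - (a + b + c)) (?n a b c)))"
      unfolding termeq[OF tri_set_bounds(1)[OF abc] n] sgc
      by (simp add: distrib_left sum_distrib_left mult_ac)
  qed
  also have "\<dots> = (1 - expu 1) ^ 3 * (\<Sum>(a, b, c)\<in>tri_set N. \<Sum>m\<in>{- K..<K}. fps_const (sg (a + b + c) * rank_weight (m - (a + b + c)) (?n a b c)) * expu m)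
       + tri_sum N (\<lambda>s n. fps_const (pcount n) * (expu K * rank_symbol (K - s) n))"
    unfolding tri_sum_def by (simp add: sum.distrib sum_distrib_left case_prod_unfold)
  also have "tri_sum N (\<lambda>s n. fps_const (pcount n) * (expu K * rank_symbol (K - s) n)) = 0"
  proof -
    let ?W = "\<lambda>n. fps_const (pcount n) * expu K"
    have "(\<lambda>s n. fps_const (pcount n) * (expu K * rank_symbol (K - s) n)) = (\<lambda>s n. ?W n * rank_symbol K n
        + (?W n * ((1 - expu 1)\<^sup>2 * of_int (- 2 * K - 1) - 2 * expu 1 * (1 - expu 1))) * of_int s + (?W n * (1 - expu 1)\<^sup>2) * (of_int s)\<^sup>2)"
      unfolding rank_symbol_def by (intro ext) (simp add: algebra_simps power2_eq_square)
    moreover have two: "(2 :: rat fps) \<noteq> 0" by (simp add: numeral_fps_const)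
    ultimately show ?thesis
      using tri_sum_quadratic[OF two, of N "\<lambda>n. ?W n * rank_symbol K n" "\<lambda>n. ?W n * ((1 - expu 1)\<^sup>2 * of_int (- 2 * K - 1) - 2 * expu 1 * (1 - expu 1))"
        "\<lambda>n. ?W n * (1 - expu 1)\<^sup>2"] by (simp only: not_False_eq_True simp_thms)
  qed
  also have "(\<Sum>(a, b, c)\<in>tri_set N. \<Sum>m\<in>{- K..<K}. fps_const (sg (a + b + c) * rank_weight (m - (a + b + c)) (?n a b c)) * expu m)
     = (\<Sum>m\<in>{- K..<K}. fps_const (theta_rank m N) * expu m)"
  proof -
    have "(\<Sum>(a, b, c)\<in>tri_set N. \<Sum>m\<in>{- K..<K}. fps_const (sg (a + b + c) * rank_weight (m - (a + b + c)) (?n a b c)) * expu m)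
      = (\<Sum>m\<in>{- K..<K}. \<Sum>(a, b, c)\<in>tri_set N. fps_const (sg (a + b + c) * rank_weight (m - (a + b + c)) (?n a b c)) * expu m)"
      unfolding case_prod_unfold by (rule sum.swap)
    also have "\<dots> = (\<Sum>m\<in>{- K..<K}. fps_const (theta_rank m N) * expu m)"
      unfolding theta_rank_def tri_sum_def case_prod_unfold by (simp only: sum_distrib_right[symmetric] fps_const_sum)
    finally show ?thesis .
  qed
  also have "(\<Sum>m\<in>{- K..<K}. fps_const (theta_rank m N) * expu m) = fps_const (theta_rank (- 2) N) * expu (- 2)"
  proof (cases "N < 0")
    case True then show ?thesis by (simp add: theta_rank_neg)
  next
    case False
    have "(\<Sum>m\<in>{- K..<K}. fps_const (theta_rank m N) * expu m) = (\<Sum>m\<in>{- 2}. fps_const (theta_rank m N) * expu m)"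
      by (rule sum.mono_neutral_right) (use False in \<open>auto simp: K_def theta_rank_eq_0\<close>)
    then show ?thesis by simp
  qed
  finally show ?thesis by simp
qed

text \<open>Outer variable \<open>q\<close>, inner variable \<open>u\<close>.\<close>

definition Theta :: "rat fps fps" where
  "Theta = Abs_fps (\<lambda>n. \<Sum>a | tri a = int n. sg a * expu a)"

lemma Theta_mult_nth:
  "fps_nth (Theta * F) N = (\<Sum>a | tri a \<le> int N. sg a * expu a * fps_nth F (N - nat (tri a)))"
proof -
  have "fps_nth (Theta * F) N = (\<Sum>i\<in>{0..N}. \<Sum>a | a \<in> {a. tri a \<le> int N} \<and> nat (tri a) = i. sg a * expu a * fps_nth F (N - nat (tri a)))"
    unfolding fps_mult_nth
  proof (intro sum.cong refl)
    fix i assume i: "i \<in> {0..N}"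
    have eq: "{a. a \<in> {a. tri a \<le> int N} \<and> nat (tri a) = i} = {a. tri a = int i}"
      using i tri_ge(3) by (auto simp: nat_eq_iff)
    show "fps_nth Theta i * fps_nth F (N - i) = (\<Sum>a | a \<in> {a. tri a \<le> int N} \<and> nat (tri a) = i. sg a * expu a * fps_nth F (N - nat (tri a)))"
      unfolding eq by (simp add: Theta_def sum_distrib_right)
  qed
  also have "\<dots> = (\<Sum>a | tri a \<le> int N. sg a * expu a * fps_nth F (N - nat (tri a)))"
    by (rule sum.group) (auto simp: nat_le_iff)
  finally show ?thesis .
qed

lemma Theta3_mult_nth:
  "fps_nth (Theta * (Theta * (Theta * F))) N = tri_sum (int N) (\<lambda>s n. expu s * fps_nth F (nat n))"
proof -
  have le: "tri b \<le> int (N - nat (tri a)) \<longleftrightarrow> tri a + tri b \<le> int N" if "tri a \<le> int N" for a b and N :: nat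
    using that tri_ge(3)[of a] by (auto simp: of_nat_diff nat_le_iff)
  have "fps_nth (Theta * (Theta * (Theta * F))) N =
     (\<Sum>a | tri a \<le> int N. \<Sum>b | tri a + tri b \<le> int N. \<Sum>c | tri a + tri b + tri c \<le> int N.
        sg a * expu a * (sg b * expu b * (sg c * expu c * fps_nth F (nat (int N - (tri a + tri b + tri c))))))"
    unfolding Theta_mult_nth[of "Theta * (Theta * F)"]
  proof (intro sum.cong refl)
    fix a assume "a \<in> {a. tri a \<le> int N}"
    then have a: "tri a \<le> int N" by simp
    have eqb: "{b. tri b \<le> int (N - nat (tri a))} = {b. tri a + tri b \<le> int N}" using le[OF a] by auto
    show "sg a * expu a * fps_nth (Theta * (Theta * F)) (N - nat (tri a)) =
      (\<Sum>b | tri a + tri b \<le> int N. \<Sum>c | tri a + tri b + tri c \<le> int N.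
        sg a * expu a * (sg b * expu b * (sg c * expu c * fps_nth F (nat (int N - (tri a + tri b + tri c))))))"
      unfolding Theta_mult_nth[of "Theta * F"] eqb sum_distrib_left
    proof (intro sum.cong refl)
      fix b assume "b \<in> {b. tri a + tri b \<le> int N}"
      then have b: "tri a + tri b \<le> int N" by simp
      have n: "int (N - nat (tri a) - nat (tri b)) = int N - (tri a + tri b)" using a b tri_ge(3)[of a] tri_ge(3)[of b] by linarith
      have eqc: "{c. tri c \<le> int (N - nat (tri a) - nat (tri b))} = {c. tri a + tri b + tri c \<le> int N}" unfolding n by auto
      have nn: "N - nat (tri a) - nat (tri b) - nat (tri c) = nat (int N - (tri a + tri b + tri c))" for c
        using n tri_ge(3)[of c] by linarith
      show "sg a * expu a * (sg b * expu b * fps_nth (Theta * F) (N - nat (tri a) - nat (tri b))) =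
        (\<Sum>c | tri a + tri b + tri c \<le> int N. sg a * expu a * (sg b * expu b * (sg c * expu c * fps_nth F (nat (int N - (tri a + tri b + tri c))))))"
        unfolding Theta_mult_nth[of F] eqc sum_distrib_left nn ..
    qed
  qed
  also have "\<dots> = (\<Sum>(a, b, c)\<in>(SIGMA a:{a. tri a \<le> int N}. SIGMA b:{b. tri a + tri b \<le> int N}. {c. tri a + tri b + tri c \<le> int N}).
        sg a * expu a * (sg b * expu b * (sg c * expu c * fps_nth F (nat (int N - (tri a + tri b + tri c))))))"
  proof -
    have fb: "finite {b. tri a + tri b \<le> int N}" for a by (rule finite_subset[OF _ finite_tri_le[of "int N - tri a"]]) auto
    have fc: "finite {c. tri a + tri b + tri c \<le> int N}" for a b by (rule finite_subset[OF _ finite_tri_le[of "int N - tri a - tri b"]]) auto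
    show ?thesis by (simp add: sum.Sigma fb fc)
  qed
  also have "(SIGMA a:{a. tri a \<le> int N}. SIGMA b:{b. tri a + tri b \<le> int N}. {c. tri a + tri b + tri c \<le> int N}) = tri_set (int N)"
  proof -
    have "tri a \<le> int N \<and> tri a + tri b \<le> int N" if "tri a + tri b + tri c \<le> int N" for a b c
      using that tri_ge(3)[of a] tri_ge(3)[of b] tri_ge(3)[of c] by linarith
    then show ?thesis by (auto simp: tri_set_def)
  qed
  finally show ?thesis unfolding tri_sum_def
    by (simp add: sg_add fps_exp_add_mult mult_ac)
qed

text \<open>The rank-crank equation, with its operator hidden in \<open>rank_op_gen\<close>. The
  series \<open>theta_rank (- 2)\<close> stays open here; the comparison at u = 0 in
  \<open>mu_vc\<close> replaces it.\<close>

lemma rank_crank_Theta: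
  "Theta ^ 3 * Abs_fps rank_op_gen = fps_const ((1 - expu 1) ^ 3 * expu (- 2)) * Abs_fps (\<lambda>N. fps_const (theta_rank (- 2) (int N)))"
proof (rule fps_ext)
  fix N
  have "fps_nth (Theta ^ 3 * Abs_fps rank_op_gen) N = fps_nth (Theta * (Theta * (Theta * Abs_fps rank_op_gen))) N"
    by (simp add: power3_eq_cube mult.assoc)
  also have "\<dots> = (1 - expu 1) ^ 3 * (fps_const (theta_rank (- 2) (int N)) * expu (- 2))"
    unfolding Theta3_mult_nth using tri_sum_rank_op_gen[of "int N"] by simp
  finally show "fps_nth (Theta ^ 3 * Abs_fps rank_op_gen) N = fps_nth (fps_const ((1 - expu 1) ^ 3 * expu (- 2)) * Abs_fps (\<lambda>N. fps_const (theta_rank (- 2) (int N)))) N"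
    by (simp add: mult_ac)
qed

section \<open>The recursion for \<open>P_k\<close>\<close>

definition two_sinh :: "rat fps" where "two_sinh = fps_exp (1/2) - fps_exp (- (1/2))"

text \<open>The rank-crank operator \<open>6 \<delta> + \<partial>^2 - 1/4\<close>, conjugated by \<open>2 sinh (u/2)\<close> and multiplied by its cube, on the
  coefficient of \<open>q^n\<close>.\<close>

definition rank_op :: "nat \<Rightarrow> rat fps \<Rightarrow> rat fps" where
  "rank_op n f = two_sinh\<^sup>2 * (of_nat (6 * n) * f + fps_deriv (fps_deriv f)) - (expu 1 - expu (- 1)) * fps_deriv f + 2 * f"

lemma two_sinh_squared: "two_sinh\<^sup>2 = expu 1 - 2 + expu (- 1)"
proof -
  have "two_sinh\<^sup>2 = fps_exp (1/2 + 1/2) - 2 * fps_exp (1/2 + - (1/2)) + fps_exp (- (1/2) + - (1/2))"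
    unfolding two_sinh_def fps_exp_add_mult by (simp add: power2_eq_square algebra_simps)
  then show ?thesis by simp
qed

lemma expu_neg1: "expu 1 * expu (- 1) = 1"
  by (simp flip: fps_exp_add_mult)

text \<open>On a power of w the operator acts through its symbol. Up to the factor w,
  \<open>rank_op_gen\<close> is therefore the operator applied to the generating function of the
  ranks.\<close>

lemma rank_op_expu: "expu 1 * rank_op n (expu r) = expu r * rank_symbol r (int n)"
proof -
  have d: "fps_deriv (expu r) = of_int r * expu r" "fps_deriv (of_int r * expu r) = of_int r * (of_int r * expu r)" for r
    by (simp_all add: fps_of_int[symmetric])
  have alg: "w * ((w - 2 + v) * (k * e + x * (x * e)) - (w - v) * (x * e) + 2 * e)
     = e * ((1 - w)\<^sup>2 * (k + x * (x + 1)) + 2 * (x + 1) * w * (1 - w) + 2 * w\<^sup>2)" if "w * v = 1" for w v k x e :: "rat fps"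
  proof -
    have "w * ((w - 2 + v) * (k * e + x * (x * e)) - (w - v) * (x * e) + 2 * e)
      = (w * w - 2 * w + w * v) * (k * e + x * (x * e)) - (w * w - w * v) * (x * e) + 2 * e * w" by (simp add: algebra_simps)
    then show ?thesis unfolding that by (simp add: algebra_simps power2_eq_square)
  qed
  show ?thesis unfolding rank_op_def rank_symbol_def two_sinh_squared d
    using alg[OF expu_neg1, of "of_nat (6 * n)" "expu r" "of_int r"] by simp
qed

lemma rank_op_diff: "rank_op n (f - g) = rank_op n f - rank_op n g"
  by (simp add: rank_op_def algebra_simps)

lemma rank_op_const: "rank_op n (fps_const c * f) = fps_const c * rank_op n f"
  by (simp add: rank_op_def algebra_simps)

lemma rank_op_sum: "rank_op n (sum f A) = (\<Sum>x\<in>A. rank_op n (f x))"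
proof (induction A rule: infinite_finite_induct)
  case (insert x A)
  have "rank_op n (f x + sum f A) = rank_op n (f x) + rank_op n (sum f A)" by (simp add: rank_op_def algebra_simps)
  then show ?case using insert by simp
qed (simp_all add: rank_op_def)

definition rank_gen :: "nat \<Rightarrow> rat fps" where
  "rank_gen n = (\<Sum>M\<in>partitions n. expu (Defs.rank M))"

lemma rank_op_gen_eq: "rank_op_gen n = expu 1 * rank_op n (rank_gen n)"
  unfolding rank_op_gen_def rank_gen_def rank_op_sum sum_distrib_left rank_op_expu ..

definition Ppoly_egf :: "nat \<Rightarrow> rat fps" where
  "Ppoly_egf n = Abs_fps (\<lambda>j. if even j then poly (Ppoly (j div 2)) (of_nat n) / fact j else 0)"

definition egf :: "rat fps \<Rightarrow> nat \<Rightarrow> rat" where "egf f j = fact j * fps_nth f j"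

lemma egf_mult: "egf (f * g) j = (\<Sum>i=0..j. of_nat (j choose i) * egf f i * egf g (j - i))"
  unfolding egf_def fps_mult_nth sum_distrib_left
proof (intro sum.cong refl)
  fix i assume "i \<in> {0..j}"
  then have "of_nat (j choose i) = (fact j :: rat) / (fact i * fact (j - i))" by (intro binomial_fact) simp
  then show "fact j * (f $ i * g $ (j - i)) = of_nat (j choose i) * (fact i * f $ i) * (fact (j - i) * g $ (j - i))"
    by simp
qed

lemma sum_even_index: fixes k :: nat shows "(\<Sum>i=0..2 * k. if even i then f i else 0) = (\<Sum>i=0..k. f (2 * i) :: rat)"
  by (induction k) auto

lemma sum_odd_index: fixes k :: nat shows "(\<Sum>i=0..2 * k. if odd i then f i else 0) = (\<Sum>i<k. f (2 * i + 1) :: rat)"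
  by (induction k) auto

text \<open>The left side of the defining recursion becomes the term i = 0 of the sum, whose
  coefficient is (2k-1)(k-1) - 3x. Writing 2^(2i) / 2 avoids the truncated exponent 2i - 1 at i =
  0.\<close>

lemma Ppoly_recursion:
  assumes "k \<ge> 1"
  shows "(\<Sum>i<k. (6 * x * of_nat (2*k choose (2*i)) * (2^(2*i) / 2 - 1)
       + of_nat (2*k choose (2*i+2)) * (2^(2*i+1) - 1) - 2^(2*i) * of_nat (2*k choose (2*i+1))
       + of_nat (2*k choose (2*i))) * poly (Ppoly (k - i)) x) = - (3 * x) * poly (Ppoly k) x"
proof (cases "k = 1")
  case True
  then show ?thesis by (simp add: eval_nat_numeral)
next
  case False
  define c where "c = (\<lambda>i. 6 * x * of_nat (2*k choose (2*i)) * (2^(2*i) / 2 - 1)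
       + of_nat (2*k choose (2*i+2)) * (2^(2*i+1) - 1) - 2^(2*i) * of_nat (2*k choose (2*i+1))
       + of_nat (2*k choose (2*i)))"
  define d where "d = (of_nat (2*k - 1) * of_nat (k - 1) :: rat)"
  have d: "d \<noteq> 0" using False assms by (auto simp: d_def)
  have "poly (Ppoly k) x = - 1 / d * (\<Sum>i\<in>{1..k-1}. c i * poly (Ppoly (k - i)) x)"
  proof -
    have "poly (Ppoly k) x = - 1 / d * (\<Sum>i\<in>{1..k-1}. (6 * of_nat (2*k choose (2*i)) * (2^(2*i-1) - 1) * x
           + (of_nat (2*k choose (2*i+2)) * (2^(2*i+1) - 1) - 2^(2*i) * of_nat (2*k choose (2*i+1)) + of_nat (2*k choose (2*i))))
           * poly (Ppoly (k - i)) x)"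
      using False assms by (subst Ppoly.simps) (simp add: poly_sum d_def del: Ppoly.simps, intro sum.cong refl, simp add: algebra_simps del: Ppoly.simps)
    also have "(\<Sum>i\<in>{1..k-1}. (6 * of_nat (2*k choose (2*i)) * (2^(2*i-1) - 1) * x
           + (of_nat (2*k choose (2*i+2)) * (2^(2*i+1) - 1) - 2^(2*i) * of_nat (2*k choose (2*i+1)) + of_nat (2*k choose (2*i))))
           * poly (Ppoly (k - i)) x) = (\<Sum>i\<in>{1..k-1}. c i * poly (Ppoly (k - i)) x)"
    proof (intro sum.cong refl)
      fix i assume "i \<in> {1..k-1}"
      then have "(2::rat)^(2*i) / 2 = 2^(2*i-1)" by (cases i) auto
      then show "(6 * of_nat (2*k choose (2*i)) * (2^(2*i-1) - 1) * x
           + (of_nat (2*k choose (2*i+2)) * (2^(2*i+1) - 1) - 2^(2*i) * of_nat (2*k choose (2*i+1)) + of_nat (2*k choose (2*i))))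
           * poly (Ppoly (k - i)) x = c i * poly (Ppoly (k - i)) x"
        unfolding c_def by (simp only:) (simp add: algebra_simps del: Ppoly.simps)
    qed
    finally show ?thesis .
  qed
  then have "d * poly (Ppoly k) x + (\<Sum>i\<in>{1..k-1}. c i * poly (Ppoly (k - i)) x) = 0" using d by (simp add: field_simps)
  moreover have "(\<Sum>i<k. c i * poly (Ppoly (k - i)) x) = c 0 * poly (Ppoly k) x + (\<Sum>i\<in>{1..k-1}. c i * poly (Ppoly (k - i)) x)"
  proof -
    have "{..<k} = insert 0 {1..k-1}" using assms by auto
    then show ?thesis by (simp del: Ppoly.simps)
  qed
  moreover have "c 0 = d - 3 * x"
  proof -
    have "of_nat (2*k choose 2) = (of_nat k * of_nat (2 * k - 1) :: rat)" by (simp add: choose_two flip: of_nat_mult)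
    moreover have "(2*k choose Suc (Suc 0)) = (2*k choose 2)" by (simp only: numeral_2_eq_2)
    ultimately show ?thesis using assms unfolding c_def d_def by (simp add: of_nat_diff algebra_simps)
  qed
  ultimately have "(\<Sum>i<k. c i * poly (Ppoly (k - i)) x) = - (3 * x) * poly (Ppoly k) x"
    by (simp add: algebra_simps del: Ppoly.simps)
  then show ?thesis by (simp only: c_def)
qed

text \<open>The recursion for \<open>P_k\<close> is this equation multiplied by \<open>cosh u / 2\<close>.\<close>

lemma rank_op_Ppoly_egf: "rank_op n (Ppoly_egf n) = 0"
proof -
  \<comment> \<open>These are cosh (2u) / 2 - cosh u + 1/2, sinh (2u) / 2 and cosh u. Up to
    factorials, their Taylor coefficients are the numbers 2^(2i-1) - 1, 2^(2i) and 1 of the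
    recursion.\<close>
  define CC where "CC = fps_const (1/4) * (expu 2 + expu (- 2)) - fps_const (1/2) * (expu 1 + expu (- 1)) + fps_const (1/2)"
  define SS where "SS = fps_const (1/4) * (expu 2 - expu (- 2))"
  define CH where "CH = fps_const (1/2) * (expu 1 + expu (- 1))"
  define x where "x = (of_nat n :: rat)"
  let ?p = "Ppoly_egf n"
  let ?F = "CC * (of_nat (6 * n) * ?p + fps_deriv (fps_deriv ?p)) - SS * fps_deriv ?p + CH * ?p"
  have w2: "expu 2 = expu 1 * expu 1" "expu (- 2) = expu (- 1) * expu (- 1)" by (simp_all flip: fps_exp_add_mult)
  have c1: "CH * two_sinh\<^sup>2 = 2 * CC"
  proof -
    have alg: "(w + v) * (w - 2 + v) = (w * w + v * v) - 2 * (w + v) + 2" if "w * v = 1" for w v :: "rat fps"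
    proof -
      have "(w + v) * (w - 2 + v) = (w * w + v * v) - 2 * (w + v) + 2 * (w * v)" by (simp add: algebra_simps)
      then show ?thesis using that by simp
    qed
    show ?thesis unfolding CH_def CC_def two_sinh_squared w2 mult.assoc alg[OF expu_neg1]
      by (rule fps_ext) (simp add: numeral_fps_const field_simps)
  qed
  have c2: "CH * (expu 1 - expu (- 1)) = 2 * SS"
    unfolding CH_def SS_def w2 by (rule fps_ext) (simp add: numeral_fps_const algebra_simps)
  have CHG: "CH * rank_op n ?p = 2 * ?F"
  proof -
    have "CH * rank_op n ?p = (CH * two_sinh\<^sup>2) * (of_nat (6 * n) * ?p + fps_deriv (fps_deriv ?p)) - (CH * (expu 1 - expu (- 1))) * fps_deriv ?p + 2 * (CH * ?p)"
    proof -
      have "c * (s * a - t * d + 2 * p) = (c * s) * a - (c * t) * d + 2 * (c * p)" for c s a t d p :: "rat fps"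
        by (simp add: algebra_simps)
      then show ?thesis unfolding rank_op_def .
    qed
    then show ?thesis unfolding c1 c2 by (simp add: algebra_simps)
  qed
  have eC: "egf CC i = (if i = 0 then 0 else if even i then 2 ^ i / 2 - 1 else 0)" for i
    by (auto simp: egf_def CC_def fps_exp_def power_minus' field_simps)
  have eS: "egf SS i = (if odd i then 2 ^ i / 2 else 0)" for i
    by (auto simp: egf_def SS_def fps_exp_def power_minus' field_simps)
  have eH: "egf CH i = (if even i then 1 else 0)" for i
    by (auto simp: egf_def CH_def fps_exp_def power_minus' field_simps)
  have eP: "egf ?p i = (if even i then poly (Ppoly (i div 2)) x else 0)" for i
    by (simp add: egf_def Ppoly_egf_def x_def del: Ppoly.simps)
  have ed: "egf (fps_deriv f) i = egf f (Suc i)" for f i by (simp add: egf_def)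
  have eadd: "egf (f + g) i = egf f i + egf g i" "egf (f - g) i = egf f i - egf g i" for f g i
    by (simp_all add: egf_def algebra_simps)
  have ecm: "egf (of_nat m * f) i = of_nat m * egf f i" for m f i
    by (simp add: egf_def fps_of_nat[symmetric])
  have P0: "Ppoly 0 = 0" by simp
  have "egf ?F j = 0" for j
  proof (cases "even j")
    case False
    have 1: "egf (CC * (of_nat (6 * n) * ?p + fps_deriv (fps_deriv ?p))) j = 0"
      unfolding egf_mult[of CC] eC eadd ecm ed eP using False by (intro sum.neutral) (auto simp del: Ppoly.simps)
    have 2: "egf (SS * fps_deriv ?p) j = 0"
      unfolding egf_mult[of SS] eS ed eP using False by (intro sum.neutral) (auto simp del: Ppoly.simps)
    have 3: "egf (CH * ?p) j = 0"
      unfolding egf_mult[of CH] eH eP using False by (intro sum.neutral) (auto simp del: Ppoly.simps)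
    show ?thesis unfolding eadd(1) eadd(2) 1 2 3 by simp
  next
    case True
    then obtain k where j: "j = 2 * k" by (auto elim: evenE)
    define p where "p = (\<lambda>i. poly (Ppoly i) x)"
    have p0: "p 0 = 0" by (simp add: p_def)
    \<comment> \<open>The coefficient of \<open>CC\<close> at i = 0 is 0 and not 2^0 / 2 - 1. The
      term 3 x p k makes up for this and cancels the right-hand side of
      \<open>Ppoly_recursion\<close>.\<close>
    have 1: "egf (CC * (of_nat (6 * n) * ?p + fps_deriv (fps_deriv ?p))) j
       = (\<Sum>i<k. of_nat (2*k choose (2*i)) * (2^(2*i) / 2 - 1) * (6 * x) * p (k - i)) + 3 * x * p k
        + (\<Sum>i<k. of_nat (2*k choose (2*i+2)) * (2^(2*i+1) - 1) * p (k - i))"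
    proof -
      have "egf (CC * (of_nat (6 * n) * ?p + fps_deriv (fps_deriv ?p))) j
        = (\<Sum>i=0..2*k. if even i then of_nat (2*k choose i) * (if i = 0 then 0 else 2 ^ i / 2 - 1) * (6 * x * p ((2 * k - i) div 2) + p ((2 * k - i) div 2 + 1)) else 0)"
        unfolding egf_mult[of CC] eC eadd ecm ed eP j by (intro sum.cong refl) (auto simp: p_def x_def simp del: Ppoly.simps)
      also have "\<dots> = (\<Sum>i=0..k. of_nat (2*k choose (2*i)) * (if i = 0 then 0 else 2 ^ (2*i) / 2 - 1) * (6 * x * p (k - i) + p (k - i + 1)))"
        unfolding sum_even_index by (intro sum.cong refl) (simp add: diff_mult_distrib2[symmetric])
      also have "\<dots> = (\<Sum>i=0..k. of_nat (2*k choose (2*i)) * (if i = 0 then 0 else 2 ^ (2*i) / 2 - 1) * (6 * x) * p (k - i))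
          + (\<Sum>i=0..k. of_nat (2*k choose (2*i)) * (if i = 0 then 0 else 2 ^ (2*i) / 2 - 1) * p (k - i + 1))"
        by (simp add: sum.distrib[symmetric] algebra_simps)
      also have "(\<Sum>i=0..k. of_nat (2*k choose (2*i)) * (if i = 0 then 0 else 2 ^ (2*i) / 2 - 1) * (6 * x) * p (k - i))
          = (\<Sum>i<k. of_nat (2*k choose (2*i)) * (2^(2*i) / 2 - 1) * (6 * x) * p (k - i)) + 3 * x * p k"
      proof -
        have "(\<Sum>i=0..k. of_nat (2*k choose (2*i)) * (if i = 0 then 0 else 2 ^ (2*i) / 2 - 1) * (6 * x) * p (k - i))
          = (\<Sum>i<k. of_nat (2*k choose (2*i)) * (if i = 0 then 0 else 2 ^ (2*i) / 2 - 1) * (6 * x) * p (k - i))"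
          by (simp add: atLeast0AtMost lessThan_Suc_atMost[symmetric] p0)
        also have "\<dots> = (\<Sum>i<k. of_nat (2*k choose (2*i)) * (2^(2*i) / 2 - 1) * (6 * x) * p (k - i) + (if i = 0 then 3 * x * p k else 0))"
          by (intro sum.cong refl) (auto simp: algebra_simps)
        also have "\<dots> = (\<Sum>i<k. of_nat (2*k choose (2*i)) * (2^(2*i) / 2 - 1) * (6 * x) * p (k - i)) + 3 * x * p k"
          by (cases k) (simp_all add: sum.distrib p0 sum.delta)
        finally show ?thesis .
      qed
      also have "(\<Sum>i=0..k. of_nat (2*k choose (2*i)) * (if i = 0 then 0 else 2 ^ (2*i) / 2 - 1) * p (k - i + 1))
          = (\<Sum>i<k. of_nat (2*k choose (2*i+2)) * (2^(2*i+1) - 1) * p (k - i))"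
      proof -
        have "(\<Sum>i=0..k. of_nat (2*k choose (2*i)) * (if i = 0 then 0 else 2 ^ (2*i) / 2 - 1) * p (k - i + 1))
          = (\<Sum>i<Suc k. of_nat (2*k choose (2*i)) * (if i = 0 then 0 else 2 ^ (2*i) / 2 - 1) * p (k - i + 1))"
          by (simp only: atLeast0AtMost lessThan_Suc_atMost)
        also have "\<dots> = (\<Sum>i<k. of_nat (2*k choose (2*i+2)) * (2^(2*i+1) - 1) * p (k - i))"
          unfolding sum.lessThan_Suc_shift
          by (simp, intro sum.cong refl) (auto simp: Suc_diff_Suc)
        finally show ?thesis .
      qed
      finally show ?thesis by (simp add: add.assoc)
    qed
    have 2: "egf (SS * fps_deriv ?p) j = (\<Sum>i<k. 2^(2*i) * of_nat (2*k choose (2*i+1)) * p (k - i))"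
    proof -
      have "egf (SS * fps_deriv ?p) j = (\<Sum>i=0..2*k. if odd i then of_nat (2*k choose i) * (2 ^ i / 2) * p ((2 * k - i + 1) div 2) else 0)"
        unfolding egf_mult[of SS] eS ed eP j by (intro sum.cong refl) (auto simp: p_def simp del: Ppoly.simps)
      also have "\<dots> = (\<Sum>i<k. 2^(2*i) * of_nat (2*k choose (2*i+1)) * p (k - i))"
        unfolding sum_odd_index
      proof (intro sum.cong refl)
        fix i assume "i \<in> {..<k}"
        then have "(2 * k - (2 * i + 1) + 1) div 2 = k - i" by auto
        then show "of_nat (2*k choose (2 * i + 1)) * (2 ^ (2 * i + 1) / 2) * p ((2 * k - (2 * i + 1) + 1) div 2)
          = 2^(2*i) * of_nat (2*k choose (2*i+1)) * p (k - i)" by simp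
      qed
      finally show ?thesis .
    qed
    have 3: "egf (CH * ?p) j = (\<Sum>i<k. of_nat (2*k choose (2*i)) * p (k - i))"
    proof -
      have "egf (CH * ?p) j = (\<Sum>i=0..2*k. if even i then of_nat (2*k choose i) * p ((2 * k - i) div 2) else 0)"
        unfolding egf_mult[of CH] eH eP j by (intro sum.cong refl) (auto simp: p_def simp del: Ppoly.simps)
      also have "\<dots> = (\<Sum>i=0..k. of_nat (2*k choose (2*i)) * p (k - i))"
        unfolding sum_even_index by (intro sum.cong refl) (simp add: diff_mult_distrib2[symmetric])
      also have "\<dots> = (\<Sum>i<k. of_nat (2*k choose (2*i)) * p (k - i))"
        by (simp add: atLeast0AtMost lessThan_Suc_atMost[symmetric] p0)
      finally show ?thesis .
    qed
    have "egf ?F j = (\<Sum>i<k. (6 * x * of_nat (2*k choose (2*i)) * (2^(2*i) / 2 - 1)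
       + of_nat (2*k choose (2*i+2)) * (2^(2*i+1) - 1) - 2^(2*i) * of_nat (2*k choose (2*i+1))
       + of_nat (2*k choose (2*i))) * p (k - i)) + 3 * x * p k"
      unfolding eadd(1) eadd(2) 1 2 3 by (simp add: sum.distrib sum_subtractf algebra_simps)
    also have "\<dots> = 0"
    proof (cases "k = 0")
      case True then show ?thesis by (simp add: p0)
    next
      case False
      then have "k \<ge> 1" by simp
      from Ppoly_recursion[OF this, of x] show ?thesis unfolding p_def by (simp del: Ppoly.simps)
    qed
    finally show ?thesis .
  qed
  then have "?F = 0" by (intro fps_ext) (simp add: egf_def)
  then have "CH * rank_op n ?p = 0" unfolding CHG by simp
  moreover have "fps_nth CH 0 = 1" by (simp add: CH_def)
  then have "CH \<noteq> 0" by auto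
  ultimately show ?thesis by simp
qed

section \<open>The partition generating function\<close>

definition Pfin :: "nat \<Rightarrow> rat fps" where "Pfin k = (\<Prod>i\<in>{1..k}. inverse (1 - fps_X ^ i))"

lemma inverse_one_minus_X_power:
  assumes "i > 0"
  shows "inverse (1 - fps_X ^ i :: rat fps) * (1 - fps_X ^ i) = 1"
  using assms by (intro inverse_mult_eq_1) simp

lemma Pfin_Suc: "Pfin (Suc k) * (1 - fps_X ^ Suc k) = Pfin k"
  unfolding Pfin_def using inverse_one_minus_X_power[of "Suc k"] by (simp add: mult.assoc del: power_Suc)

lemma Pfin_Suc_nth: "fps_nth (Pfin (Suc k)) n = fps_nth (Pfin k) n + (if n < Suc k then 0 else fps_nth (Pfin (Suc k)) (n - Suc k))"
proof -
  have "Pfin (Suc k) = Pfin k + fps_X ^ Suc k * Pfin (Suc k)"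
    using Pfin_Suc[of k] by (simp add: algebra_simps del: power_Suc)
  then have "fps_nth (Pfin (Suc k)) n = fps_nth (Pfin k + fps_X ^ Suc k * Pfin (Suc k)) n" by simp
  then show ?thesis by (simp add: fps_X_power_mult_nth del: power_Suc)
qed

lemma Pfin_stable: "n \<le> k \<Longrightarrow> fps_nth (Pfin k) n = fps_nth Pgen n"
proof (induction k rule: dec_induct)
  case base then show ?case by (simp add: Pgen_def Pfin_def)
next
  case (step k) then show ?case using Pfin_Suc_nth[of k n] by simp
qed

lemma member_le_sum_mset: "x \<in># M \<Longrightarrow> x \<le> sum_mset (M :: nat multiset)"
  by (auto dest!: multi_member_split)

text \<open>Splitting off one part equal to \<open>Suc k\<close>, if there is one, reproduces the
  recurrence \<open>Pfin_Suc_nth\<close>.\<close>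

lemma Pfin_count: "fps_nth (Pfin k) n = of_nat (card {M \<in> partitions n. \<forall>x\<in>#M. x \<le> k})"
proof (induction k arbitrary: n)
  case 0
  have *: "M = {#} \<and> n = 0" if M: "M \<in> partitions n" "\<forall>x\<in>#M. x \<le> 0" for M
  proof -
    have "M = {#}" using M by (cases M) (auto simp: partitions_def)
    then show ?thesis using M by (auto simp: partitions_def)
  qed
  have "{M \<in> partitions n. \<forall>x\<in>#M. x \<le> 0} = (if n = 0 then {{#}} else {})"
  proof (cases "n = 0")
    case True then show ?thesis by auto
  next
    case False
    then have "{M \<in> partitions n. \<forall>x\<in>#M. x \<le> 0} = {}"
    proof (intro equals0I, elim CollectE conjE)
      fix M assume "M \<in> partitions n" "\<forall>x\<in>#M. x \<le> 0"
      from *[OF this] show False using False by simp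
    qed
    then show ?thesis using False by simp
  qed
  then show ?case by (simp add: Pfin_def)
next
  case (Suc k)
  show ?case
  proof (induction n rule: less_induct)
    case (less n)
    let ?A = "\<lambda>n k. {M \<in> partitions n. \<forall>x\<in>#M. x \<le> k}"
    define B where "B = {M \<in> ?A n (Suc k). Suc k \<in># M}"
    have un: "?A n (Suc k) = ?A n k \<union> B" unfolding B_def by (auto simp: le_Suc_eq)
    have dj: "?A n k \<inter> B = {}" unfolding B_def by force
    have "finite (?A n k)" "finite B" unfolding B_def by auto
    from card_Un_disjoint[OF this dj] have "card (?A n (Suc k)) = card (?A n k) + card B" unfolding un[symmetric] .
    then have card: "card (?A n (Suc k)) = card (?A n k) + card {M \<in> ?A n (Suc k). Suc k \<in># M}" unfolding B_def .
    have c2: "card {M \<in> ?A n (Suc k). Suc k \<in># M} = (if n < Suc k then 0 else card (?A (n - Suc k) (Suc k)))"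
    proof (cases "n < Suc k")
      case True
      have "Suc k \<le> n" if "M \<in> partitions n" "Suc k \<in># M" for M
        using member_le_sum_mset[OF that(2)] that(1) by (simp add: partitions_def)
      then have "{M \<in> ?A n (Suc k). Suc k \<in># M} = {}" using True by force
      then show ?thesis using True by simp
    next
      case False
      have "bij_betw (add_mset (Suc k)) (?A (n - Suc k) (Suc k)) {M \<in> ?A n (Suc k). Suc k \<in># M}"
      proof (rule bij_betw_byWitness[where f' = "\<lambda>M. M - {#Suc k#}"], goal_cases)
        case 3 show ?case using False by (auto simp: partitions_def)
      next
        case 4 show ?case by (auto simp: partitions_def dest!: multi_member_split[of "Suc k"])
      qed auto
      then show ?thesis using False bij_betw_same_card by fastforce
    qed
    show ?case unfolding Pfin_Suc_nth[of k n] Suc.IH[of n] card c2 using less[of "n - Suc k"] by simp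
  qed
qed

lemma Pgen_count: "fps_nth Pgen n = of_nat (card (partitions n))"
proof -
  have "{M \<in> partitions n. \<forall>x\<in>#M. x \<le> n} = partitions n"
    by (auto simp: partitions_def member_le_sum_mset)
  then show ?thesis using Pfin_stable[of n n] Pfin_count[of n n] by simp
qed

lemma qD_Pfin: "qD (Pfin k) = Pfin k * (\<Sum>i\<in>{1..k}. of_nat i * (fps_X ^ i * inverse (1 - fps_X ^ i)))"
proof (induction k)
  case 0 then show ?case by (simp add: Pfin_def)
next
  case (Suc k)
  define I where "I = inverse (1 - fps_X ^ Suc k :: rat fps)"
  define Y where "Y = (fps_X ^ Suc k :: rat fps)"
  have I: "I * (1 - Y) = 1" unfolding I_def Y_def by (rule inverse_one_minus_X_power) simp
  have dY: "qD (1 - Y) = - (of_nat (Suc k) * Y)"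
    unfolding Y_def by (rule fps_ext) (auto simp: fps_X_power_iff simp flip: fps_of_nat simp del: power_Suc)
  have "qD I * (1 - Y) + I * qD (1 - Y) = 0" using arg_cong[OF I, of qD] by (simp add: qD_mult)
  then have "qD I * (1 - Y) = of_nat (Suc k) * (I * Y)" unfolding dY by (simp add: algebra_simps)
  then have "(qD I * (1 - Y)) * I = of_nat (Suc k) * (I * Y) * I" by (simp only:)
  moreover have "qD I = (qD I * (1 - Y)) * I" using I by (simp only: mult.assoc mult.commute[of "1 - Y"] mult_1_right)
  ultimately have dI: "qD I = I * (of_nat (Suc k) * (Y * I))" by (simp only: mult_ac)
  have P: "Pfin (Suc k) = Pfin k * I" by (simp add: Pfin_def I_def mult.commute)
  show ?case unfolding P qD_mult Suc.IH dI by (simp add: algebra_simps I_def Y_def del: power_Suc of_nat_Suc)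
qed

text \<open>Logarithmic derivative of the Euler product: the factor with index i contributes i q^i /
  (1 - q^i), and these add up to the divisor sums. For the coefficient of q^n the product up to n is
  enough.\<close>

lemma qD_Pgen: "fps_const 24 * qD Pgen = (1 - E2) * Pgen"
proof (rule fps_ext)
  fix n
  define S where "S = (\<Sum>i\<in>{1..n}. of_nat i * (fps_X ^ i * inverse (1 - fps_X ^ i)) :: rat fps)"
  have geo: "fps_nth (fps_X ^ i * inverse (1 - fps_X ^ i) :: rat fps) m = (if i dvd m \<and> m > 0 then 1 else 0)" if i: "i > 0" for i m
  proof -
    define g where "g = (Abs_fps (\<lambda>m. if i dvd m \<and> m > 0 then 1 else 0) :: rat fps)"
    have "g * (1 - fps_X ^ i) = fps_X ^ i"
    proof (rule fps_ext)
      fix m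
      have "fps_nth (g * (1 - fps_X ^ i)) m = fps_nth g m - (if m < i then 0 else fps_nth g (m - i))"
        by (simp add: algebra_simps fps_X_power_mult_right_nth)
      also have "\<dots> = fps_nth (fps_X ^ i) m"
        using i unfolding g_def
        by (cases m i rule: linorder_cases) (auto simp: fps_X_power_iff dvd_minus_self dest: dvd_imp_le)
      finally show "fps_nth (g * (1 - fps_X ^ i)) m = fps_nth (fps_X ^ i) m" .
    qed
    then have "g * (1 - fps_X ^ i) * inverse (1 - fps_X ^ i) = fps_X ^ i * inverse (1 - fps_X ^ i)" by simp
    then have "g = fps_X ^ i * inverse (1 - fps_X ^ i)" using inverse_one_minus_X_power[OF i] by (simp add: mult.assoc mult.commute[of "1 - fps_X ^ i"])
    from this[symmetric] show ?thesis by (simp only:) (simp add: g_def)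
  qed
  have S: "24 * fps_nth S m = fps_nth (1 - E2) m" if "m \<le> n" for m
  proof (cases "m = 0")
    case True then show ?thesis by (simp add: S_def fps_sum_nth E2_def fps_of_nat[symmetric] geo)
  next
    case False
    have "fps_nth S m = (\<Sum>i\<in>{1..n}. if i dvd m then of_nat i else 0)"
      unfolding S_def fps_sum_nth
    proof (intro sum.cong refl)
      fix i assume "i \<in> {1..n}"
      then show "fps_nth (of_nat i * (fps_X ^ i * inverse (1 - fps_X ^ i)) :: rat fps) m = (if i dvd m then of_nat i else 0)"
        using geo[of i m] False by (simp add: fps_of_nat[symmetric])
    qed
    also have "\<dots> = (\<Sum>i | i dvd m. of_nat i)"
    proof -
      have "{i \<in> {1..n}. i dvd m} = {i. i dvd m}" using False that by (auto simp: Suc_leI dest: dvd_imp_le intro!: Nat.gr0I)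
      then show ?thesis by (simp add: sum.If_cases Int_def)
    qed
    finally show ?thesis using False by (simp add: E2_def)
  qed
  have "fps_nth (fps_const 24 * qD Pgen) n = 24 * fps_nth (qD (Pfin n)) n" by (simp add: Pfin_stable)
  also have "\<dots> = (\<Sum>i=0..n. fps_nth (Pfin n) i * (24 * fps_nth S (n - i)))"
    unfolding qD_Pfin S_def[symmetric] fps_mult_nth by (simp add: sum_distrib_left mult_ac)
  also have "\<dots> = (\<Sum>i=0..n. fps_nth Pgen i * fps_nth (1 - E2) (n - i))"
    by (intro sum.cong refl) (simp add: Pfin_stable S)
  also have "\<dots> = fps_nth ((1 - E2) * Pgen) n" by (subst mult.commute) (simp only: fps_mult_nth)
  finally show "fps_nth (fps_const 24 * qD Pgen) n = fps_nth ((1 - E2) * Pgen) n" .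
qed

section \<open>Taylor coefficients in \<open>u\<close>\<close>

text \<open>The power series 2 sinh (u/2) / u; unlike \<open>two_sinh\<close> it is invertible, with
  constant term 1.\<close>

definition sig :: "rat fps" where "sig = fps_shift 1 two_sinh"

lemma two_sinh_eq: "two_sinh = fps_X * sig"
  by (rule fps_ext) (auto simp: sig_def two_sinh_def)

lemma sig_nth: "fps_nth sig j = (if even j then (1/2) ^ j / fact (j + 1) else 0)"
proof -
  have "fps_nth sig j = ((1/2) ^ (j + 1) - (- (1/2)) ^ (j + 1)) / fact (j + 1)"
    by (simp add: sig_def two_sinh_def diff_divide_distrib del: fact_Suc power_Suc)
  then show ?thesis by (cases "even j") (simp_all del: fact_Suc)
qed

lemma sig_0: "fps_nth sig 0 = 1"
  by (simp add: sig_nth)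

lemma two_sinh_deriv2: "fps_deriv (fps_deriv two_sinh) = fps_const (1/4) * two_sinh"
proof -
  have "fps_deriv (fps_deriv two_sinh) = fps_const (1/2) * (fps_const (1/2) * fps_exp (1/2)) - fps_const (- (1/2)) * (fps_const (- (1/2)) * fps_exp (- (1/2)))"
    by (simp add: two_sinh_def)
  also have "\<dots> = fps_const (1/4) * two_sinh"
    unfolding mult.assoc[symmetric] fps_const_mult by (simp add: two_sinh_def right_diff_distrib)
  finally show ?thesis .
qed

lemma two_sinh_deriv_identities:
  "(fps_deriv two_sinh)\<^sup>2 = 1 + fps_const (1/4) * two_sinh\<^sup>2" "expu 1 - expu (- 1) = 2 * two_sinh * fps_deriv two_sinh"
proof -
  define p where "p = (fps_exp (1/2) :: rat fps)"
  define m where "m = (fps_exp (- (1/2)) :: rat fps)"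
  define h where "h = (fps_const (1/2) :: rat fps)"
  have h: "2 * h = 1" unfolding h_def by (simp add: numeral_fps_const)
  have pm: "p * m = 1" unfolding p_def m_def by (simp flip: fps_exp_add_mult)
  have two_sinh: "two_sinh = p - m" by (simp add: two_sinh_def p_def m_def)
  have d: "fps_deriv two_sinh = h * p + h * m"
    by (rule fps_ext) (simp add: two_sinh p_def m_def h_def)
  have q: "fps_const (1/4) = h * h" by (simp add: h_def)
  have "(h * p + h * m)\<^sup>2 = h * h * (p - m)\<^sup>2 + (2 * h) * (2 * h) * (p * m)" by (simp add: power2_eq_square algebra_simps)
  then have "(h * p + h * m)\<^sup>2 = 1 + h * h * (p - m)\<^sup>2" unfolding h pm by simp
  then show "(fps_deriv two_sinh)\<^sup>2 = 1 + fps_const (1/4) * two_sinh\<^sup>2" unfolding d q unfolding two_sinh .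
  have "expu 1 = p * p" "expu (- 1) = m * m" unfolding p_def m_def by (simp_all flip: fps_exp_add_mult)
  moreover have "2 * (p - m) * (h * p + h * m) = (2 * h) * (p * p - m * m)" by (simp add: algebra_simps)
  ultimately show "expu 1 - expu (- 1) = 2 * two_sinh * fps_deriv two_sinh" unfolding d unfolding two_sinh h by simp
qed

text \<open>The relations S'' = S/4 and S'^2 = 1 + S^2/4 for S = 2 sinh (u/2) eliminate all
  derivatives of \<open>sig\<close>. What remains multiplies u^j by j (j-1) - 2 j + 2 = (j-1)(j-2),
  apart from the terms that raise the degree by 2.\<close>

lemma rank_op_sig:
  "rank_op n (sig * f) = sig ^ 3 * (fps_X\<^sup>2 * ((of_nat (6 * n) - fps_const (1/4)) * f + fps_deriv (fps_deriv f)) - 2 * fps_X * fps_deriv f + 2 * f)"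
proof -
  define X where "X = (fps_X :: rat fps)"
  define g1 where "g1 = fps_deriv sig"
  define g2 where "g2 = fps_deriv g1"
  define f1 where "f1 = fps_deriv f"
  define f2 where "f2 = fps_deriv f1"
  define h where "h = (fps_const (1/4) :: rat fps)"
  define k where "k = (of_nat (6 * n) :: rat fps)"
  have d1: "fps_deriv two_sinh = sig + X * g1" unfolding two_sinh_eq by (simp add: X_def g1_def algebra_simps)
  have d2: "fps_deriv (fps_deriv two_sinh) = 2 * g1 + X * g2" unfolding d1 by (simp add: X_def g1_def g2_def algebra_simps)
  have z1: "X * g2 + 2 * g1 - h * (X * sig) = 0" using two_sinh_deriv2 unfolding d2 by (simp add: two_sinh_eq X_def h_def algebra_simps)
  have z2: "(sig + X * g1)\<^sup>2 - 1 - h * (X * sig)\<^sup>2 = 0" using two_sinh_deriv_identities(1) unfolding d1 by (simp add: two_sinh_eq X_def h_def)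
  have e1: "fps_deriv (sig * f) = g1 * f + sig * f1" by (simp add: g1_def f1_def algebra_simps)
  have e2: "fps_deriv (fps_deriv (sig * f)) = g2 * f + 2 * g1 * f1 + sig * f2" unfolding e1 by (simp add: g2_def g1_def f1_def f2_def algebra_simps)
  have "rank_op n (sig * f) = (X * sig)\<^sup>2 * (k * (sig * f) + (g2 * f + 2 * g1 * f1 + sig * f2)) - (2 * (X * sig) * (sig + X * g1)) * (g1 * f + sig * f1) + 2 * (sig * f)"
    unfolding rank_op_def two_sinh_deriv_identities(2) e2 unfolding e1 d1 unfolding two_sinh_eq X_def k_def ..
  also have "\<dots> = sig ^ 3 * (X\<^sup>2 * ((k - h) * f + f2) - 2 * X * f1 + 2 * f)
      + X * sig\<^sup>2 * f * (X * g2 + 2 * g1 - h * (X * sig)) - 2 * sig * f * ((sig + X * g1)\<^sup>2 - 1 - h * (X * sig)\<^sup>2)"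
    by (simp add: power2_eq_square power3_eq_cube algebra_simps)
  also have "\<dots> = sig ^ 3 * (X\<^sup>2 * ((k - h) * f + f2) - 2 * X * f1 + 2 * f)" unfolding z1 z2 by simp
  finally show ?thesis by (simp only: X_def k_def h_def f2_def f1_def)
qed

text \<open>The even coefficients are those of the target divided by (2k)!. The subtracted series is
  annihilated by \<open>rank_op\<close>, so the equation for the ranks persists, while P_1 = 1 makes
  the coefficient of u^2 vanish.\<close>

definition Bn :: "nat \<Rightarrow> rat fps" where "Bn n = rank_gen n - fps_const (of_int (Nmom 2 n)) * Ppoly_egf n"

definition Qn :: "nat \<Rightarrow> rat fps" where "Qn n = inverse sig * Bn n"

definition Vn :: "nat \<Rightarrow> rat fps" where
  "Vn n = fps_X\<^sup>2 * ((of_nat (6 * n) - fps_const (1/4)) * Qn n + fps_deriv (fps_deriv (Qn n))) - 2 * fps_X * fps_deriv (Qn n) + 2 * Qn n"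

lemma sig_Qn: "sig * Qn n = Bn n"
proof -
  have "inverse sig * sig = 1" by (rule inverse_mult_eq_1) (simp add: sig_0)
  then show ?thesis unfolding Qn_def by (simp add: mult.assoc[symmetric] mult.commute[of sig])
qed

lemma rank_op_gen_Vn: "rank_op_gen n = expu 1 * sig ^ 3 * Vn n"
proof -
  have "rank_op n (Bn n) = rank_op n (rank_gen n)" unfolding Bn_def rank_op_diff rank_op_const rank_op_Ppoly_egf by simp
  then show ?thesis unfolding rank_op_gen_eq Vn_def using rank_op_sig[of n "Qn n"] by (simp add: sig_Qn mult.assoc)
qed

text \<open>The factor exp (u/2), which \<open>Theta\<close> lacks, makes the exponents a + 1/2
  change sign under a -> -1 - a, so that this series is odd in u.\<close>

definition That :: "rat fps fps" where
  "That = Abs_fps (\<lambda>n. \<Sum>a | tri a = int n. sg a * fps_exp (of_int a + 1/2))"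

lemma That_Theta: "That = fps_const (fps_exp (1/2)) * Theta"
  by (rule fps_ext) (simp add: That_def Theta_def sum_distrib_left fps_exp_add_mult mult_ac)

lemma sg_sum_0: "(\<Sum>a | tri a = N. sg a :: rat) = 0"
proof -
  have "(\<Sum>a | tri a = N. sg a :: rat) = (\<Sum>a | tri a = N. - sg a)"
    by (rule sum.reindex_bij_witness[where i = "\<lambda>a. - 1 - a" and j = "\<lambda>a. - 1 - a"]) (auto simp: tri_reflect sg_def)
  then show ?thesis by (simp add: sum_negf)
qed

definition theta_moment :: "nat \<Rightarrow> rat fps" where
  "theta_moment j = Abs_fps (\<lambda>n. \<Sum>a | tri a = int n. sg a * (of_int a + 1/2) ^ j)"

lemma sg_fps: "(sg a :: rat fps) = fps_const (sg a)"
  by (simp add: sg_def fps_const_neg[symmetric] del: fps_const_neg)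

lemma That_nth: "fps_nth (fps_nth That n) j = fps_nth (theta_moment j) n / fact j"
  by (simp add: That_def theta_moment_def fps_sum_nth sg_fps sum_divide_distrib)

lemma theta_moment_0: "theta_moment 0 = 0"
  by (rule fps_ext) (simp add: theta_moment_def sg_sum_0)

definition lam :: "rat fps fps" where "lam = Abs_fps (\<lambda>n. fps_shift 1 (fps_nth That n))"

lemma That_lam: "That = fps_const fps_X * lam"
proof (rule fps_ext)
  fix n
  have "fps_nth (fps_nth That n) 0 = 0" unfolding That_nth theta_moment_0 by simp
  then have "fps_nth That n = fps_X * fps_shift 1 (fps_nth That n)" by (intro fps_ext) auto
  then show "fps_nth That n = fps_nth (fps_const fps_X * lam) n" by (simp add: lam_def)
qed

text \<open>The zero of the theta cube at u = 0 matches that of (1 - w)^3, so exp u, u^3 and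
  \<open>sig\<close>^3 cancel from \<open>rank_crank_Theta\<close>. The sign comes from 1 -
  w.\<close>

lemma lam_Vn: "lam ^ 3 * Abs_fps Vn = - Abs_fps (\<lambda>N. fps_const (theta_rank (- 2) (int N)))"
proof -
  define Cc where "Cc = Abs_fps (\<lambda>N. fps_const (theta_rank (- 2) (int N)))"
  have e: "fps_exp (1/2) * two_sinh = expu 1 - 1"
    unfolding two_sinh_def right_diff_distrib fps_exp_add_mult[symmetric] by simp
  \<comment> \<open>Three of the six factors come from \<open>That\<close>, three from 1 - w = - exp
    (u/2) \<open>two_sinh\<close>.\<close>
  have e3: "fps_exp (1/2) ^ 6 * expu (- 2) = expu 1"
  proof -
    have "(fps_exp (1/2) :: rat fps) ^ 6 = fps_exp (of_nat 6 * (1/2))" by (rule fps_exp_power_mult)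
    then show ?thesis by (simp flip: fps_exp_add_mult)
  qed
  have GV: "Abs_fps rank_op_gen = fps_const (expu 1 * sig ^ 3) * Abs_fps Vn" by (rule fps_ext) (simp add: rank_op_gen_Vn)
  have "fps_const (expu 1 * fps_X ^ 3 * sig ^ 3) * (lam ^ 3 * Abs_fps Vn) = That ^ 3 * Abs_fps rank_op_gen"
    unfolding That_lam GV by (simp add: power_mult_distrib mult_ac fps_const_power flip: fps_const_mult)
  also have "\<dots> = fps_const (fps_exp (1/2) ^ 3) * (Theta ^ 3 * Abs_fps rank_op_gen)"
    unfolding That_Theta by (simp add: power_mult_distrib mult_ac fps_const_power del: fps_exp_power_mult)
  also have "\<dots> = fps_const (fps_exp (1/2) ^ 3 * ((1 - expu 1) ^ 3 * expu (- 2))) * Cc"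
    unfolding rank_crank_Theta Cc_def by (simp only: fps_const_mult[symmetric] mult.assoc)
  also have "fps_exp (1/2) ^ 3 * ((1 - expu 1) ^ 3 * expu (- 2)) = - (expu 1 * fps_X ^ 3 * sig ^ 3)"
  proof -
    have "1 - expu 1 = - (fps_exp (1/2) * (fps_X * sig))" using e by (simp add: two_sinh_eq)
    then have "fps_exp (1/2) ^ 3 * ((1 - expu 1) ^ 3 * expu (- 2)) = - ((fps_exp (1/2) ^ 6 * expu (- 2)) * (fps_X ^ 3 * sig ^ 3))"
      by (simp only:) (simp add: power_mult_distrib power_minus' mult_ac del: fps_exp_power_mult flip: power_add power_mult)
    then show ?thesis unfolding e3 by (simp add: mult.assoc)
  qed
  finally have "fps_const (expu 1 * fps_X ^ 3 * sig ^ 3) * (lam ^ 3 * Abs_fps Vn) = fps_const (expu 1 * fps_X ^ 3 * sig ^ 3) * (- Cc)"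
    by (simp add: fps_const_neg[symmetric] del: fps_const_neg)
  moreover have "expu 1 * fps_X ^ 3 * sig ^ 3 \<noteq> 0"
    using sig_0 by auto
  then have "fps_const (expu 1 * fps_X ^ 3 * sig ^ 3) \<noteq> 0" by (simp only: fps_const_eq_0_iff not_False_eq_True)
  ultimately show ?thesis unfolding Cc_def using mult_left_cancel by blast
qed

text \<open>Now u becomes the outer variable, so that the coefficients are q-series, whose weight
  and integrality can be measured.\<close>

definition swap_fps :: "rat fps fps \<Rightarrow> rat fps fps" where
  "swap_fps F = Abs_fps (\<lambda>j. Abs_fps (\<lambda>n. fps_nth (fps_nth F n) j))"

lemma swap_fps_nth [simp]: "fps_nth (fps_nth (swap_fps F) j) n = fps_nth (fps_nth F n) j"
  by (simp add: swap_fps_def)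

lemma swap_fps_mult: "swap_fps (F * G) = swap_fps F * swap_fps G"
proof (intro fps_ext)
  fix j n
  have "fps_nth (fps_nth (swap_fps (F * G)) j) n = (\<Sum>i=0..n. \<Sum>k=0..j. fps_nth (fps_nth F i) k * fps_nth (fps_nth G (n - i)) (j - k))"
    by (simp add: fps_mult_nth fps_sum_nth)
  also have "\<dots> = (\<Sum>k=0..j. \<Sum>i=0..n. fps_nth (fps_nth F i) k * fps_nth (fps_nth G (n - i)) (j - k))"
    by (rule sum.swap)
  also have "\<dots> = fps_nth (fps_nth (swap_fps F * swap_fps G) j) n"
    by (simp add: fps_mult_nth fps_sum_nth)
  finally show "fps_nth (fps_nth (swap_fps (F * G)) j) n = fps_nth (fps_nth (swap_fps F * swap_fps G) j) n" .
qed

text \<open>Heat equation of the theta series: (a + 1/2)^2 = 2 \<open>tri a\<close> + 1/4.\<close>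

lemma theta_moment_rec: "theta_moment (j + 2) = fps_const 2 * qD (theta_moment j) + fps_const (1/4) * theta_moment j"
proof (rule fps_ext)
  fix n
  have "fps_nth (theta_moment (j + 2)) n = (\<Sum>a | tri a = int n. (2 * of_nat n + 1/4) * (sg a * (of_int a + 1/2) ^ j))"
    unfolding theta_moment_def fps_nth_Abs_fps
  proof (intro sum.cong refl)
    fix a assume "a \<in> {a. tri a = int n}"
    then have "2 * int n = a * (a + 1)" using tri_double[of a] by simp
    then have "2 * of_nat n = (of_int a * (of_int a + 1) :: rat)" by (metis of_int_1 of_int_add of_int_mult of_int_numeral of_int_of_nat_eq)
    then have "(of_int a + 1/2)\<^sup>2 = (2 * of_nat n + 1/4 :: rat)" by (simp add: power2_eq_square algebra_simps)
    then show "sg a * (of_int a + 1/2) ^ (j + 2) = (2 * of_nat n + 1/4) * (sg a * (of_int a + 1/2 :: rat) ^ j)"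
      by (simp only: power_add mult_ac)
  qed
  also have "\<dots> = (2 * of_nat n + 1/4) * fps_nth (theta_moment j) n" by (simp add: theta_moment_def sum_distrib_left)
  finally show "fps_nth (theta_moment (j + 2)) n = fps_nth (fps_const 2 * qD (theta_moment j) + fps_const (1/4) * theta_moment j) n"
    by (simp add: algebra_simps)
qed

lemma theta_moment_even: "even j \<Longrightarrow> theta_moment j = 0"
proof (rule fps_ext)
  fix n assume j: "even j"
  have "(\<Sum>a | tri a = int n. sg a * (of_int a + 1/2) ^ j :: rat) = (\<Sum>a | tri a = int n. - (sg a * (of_int a + 1/2) ^ j))"
  proof (rule sum.reindex_bij_witness[where i = "\<lambda>a. - 1 - a" and j = "\<lambda>a. - 1 - a"])
    fix a assume "a \<in> {a. tri a = int n}"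
    have e: "of_int (- 1 - a) + 1/2 = - (of_int a + 1/2 :: rat)" by simp
    have "sg (- 1 - a) = - (sg a :: rat)" by (auto simp: sg_def)
    then show "- (sg (- 1 - a) * (of_int (- 1 - a) + 1/2) ^ j) = sg a * (of_int a + 1/2 :: rat) ^ j"
      unfolding e power_minus_even[OF j] by simp
  qed (auto simp: tri_reflect)
  then show "fps_nth (theta_moment j) n = fps_nth 0 n" by (simp add: theta_moment_def sum_negf)
qed

lemma theta_moment_1_0: "fps_nth (theta_moment 1) 0 = 1"
proof -
  have "a = 0 \<or> a = - 1" if "tri a = 0" for a using tri_double[of a] that by auto
  then have "{a. tri a = int 0} = {0, - 1}" by (auto simp: tri_def)
  then show ?thesis by (simp add: theta_moment_def sg_def)
qed

definition Qc :: "nat \<Rightarrow> rat fps" where "Qc j = Abs_fps (\<lambda>n. fps_nth (Qn n) j)"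

lemma rank_gen_nth: "fps_nth (rank_gen n) j = of_int (Nmom j n) / fact j"
proof -
  have "Nmom j n = (\<Sum>m\<in>{- int n..int n}. \<Sum>M | M \<in> partitions n \<and> Defs.rank M = m. (Defs.rank M) ^ j)"
    unfolding Nmom_def Nrank_def by (intro sum.cong refl) simp
  also have "\<dots> = (\<Sum>M\<in>partitions n. (Defs.rank M) ^ j)"
    by (rule sum.group) (auto intro: rank_bounds)
  finally show ?thesis by (simp add: rank_gen_def fps_sum_nth sum_divide_distrib)
qed

lemma Ppoly_1: "Ppoly 1 = 1" by simp

lemma Bn_nth: "fps_nth (Bn n) (2 * k) = (of_int (Nmom (2 * k) n) - poly (Ppoly k) (of_nat n) * of_int (Nmom 2 n)) / fact (2 * k)"
  by (simp add: Bn_def rank_gen_nth Ppoly_egf_def diff_divide_distrib del: Ppoly.simps)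

lemma Qc_0: "Qc 0 = Pgen"
proof (rule fps_ext)
  fix n
  have "fps_nth (sig * Qn n) 0 = fps_nth (Bn n) 0" by (simp only: sig_Qn)
  then have "fps_nth (Qn n) 0 = fps_nth (Bn n) 0" by (simp add: sig_0)
  also have "\<dots> = of_nat (card (partitions n))" by (simp add: Bn_def rank_gen_def Ppoly_egf_def fps_sum_nth)
  finally show "fps_nth (Qc 0) n = fps_nth Pgen n" by (simp add: Qc_def Pgen_count)
qed

text \<open>P_1 = 1 makes the coefficient of u^2 in \<open>Bn\<close> vanish, so this coefficient
  only has to balance the 1/24 of \<open>sig\<close>.\<close>

lemma Qc_2: "Qc 2 = fps_const (- 1/24) * Pgen"
proof (rule fps_ext)
  fix n
  have "fps_nth (sig * Qn n) 2 = fps_nth (Bn n) (2 * 1)" by (simp only: sig_Qn mult_1_right)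
  also have "\<dots> = 0" unfolding Bn_nth Ppoly_1 by simp
  finally have "fps_nth (Qn n) 2 + 1/24 * fps_nth (Qn n) 0 = 0"
    by (simp add: fps_mult_nth sig_nth numeral_2_eq_2 sum.atLeast0_atMost_Suc)
  then have "fps_nth (Qn n) 2 = - (1/24) * fps_nth (Qc 0) n" by (simp add: Qc_def)
  then show "fps_nth (Qc 2) n = fps_nth (fps_const (- 1/24) * Pgen) n" unfolding Qc_0 by (simp add: Qc_def)
qed

lemma target_Qc:
  assumes "k \<ge> 1"
  shows "Rgen (2 * k) - poly_delta (Ppoly k) (Rgen 2) = (\<Sum>j=0..2 * k. fps_const (fact (2 * k) * fps_nth sig (2 * k - j)) * Qc j)"
proof (rule fps_ext)
  fix n
  \<comment> \<open>\<open>Rgen\<close> is 0 at n = 0 by definition; the moments agree there because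
    the empty partition has rank 0 and the orders are positive.\<close>
  have 0: "Nmom (2 * k) 0 = 0" "Nmom 2 0 = 0" using assms by (auto simp: Nmom_def)
  have "fps_nth (Rgen (2 * k) - poly_delta (Ppoly k) (Rgen 2)) n = fact (2 * k) * fps_nth (Bn n) (2 * k)"
    unfolding Bn_nth by (cases "n = 0") (simp_all add: Rgen_def poly_delta_def 0 del: Ppoly.simps)
  also have "fps_nth (Bn n) (2 * k) = (\<Sum>j=0..2 * k. fps_nth (Qn n) j * fps_nth sig (2 * k - j))"
    unfolding sig_Qn[symmetric] by (subst mult.commute) (rule fps_mult_nth)
  finally show "fps_nth (Rgen (2 * k) - poly_delta (Ppoly k) (Rgen 2)) n = fps_nth (\<Sum>j=0..2 * k. fps_const (fact (2 * k) * fps_nth sig (2 * k - j)) * Qc j) n"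
    by (simp add: fps_sum_nth Qc_def sum_distrib_left mult_ac)
qed

definition Lc :: "rat fps fps" where "Lc = Abs_fps (\<lambda>j. fps_const (1 / fact (j + 1)) * theta_moment (j + 1))"

definition Wc :: "nat \<Rightarrow> rat fps" where "Wc j = Abs_fps (\<lambda>n. fps_nth (Vn n) j)"

lemma Lc_Wc: "\<exists>c. Lc ^ 3 * Abs_fps Wc = fps_const c"
proof -
  have L: "swap_fps lam = Lc"
    by (intro fps_ext) (simp add: Lc_def lam_def That_nth del: fact_Suc)
  have W: "swap_fps (Abs_fps Vn) = Abs_fps Wc" by (intro fps_ext) (simp add: Wc_def)
  have C: "swap_fps (- Abs_fps (\<lambda>N. fps_const (theta_rank (- 2) (int N)))) = fps_const (- Abs_fps (\<lambda>N. theta_rank (- 2) (int N)))"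
    by (intro fps_ext) simp
  have "swap_fps (lam ^ 3 * Abs_fps Vn) = Lc ^ 3 * Abs_fps Wc"
    by (simp add: power3_eq_cube swap_fps_mult L W)
  then show ?thesis unfolding lam_Vn C by metis
qed

lemma Wc_0: "Wc 0 = fps_const 2 * Qc 0"
  by (rule fps_ext) (simp add: Wc_def Vn_def Qc_def mult.assoc power2_eq_square numeral_fps_const)

text \<open>The last factor is (j+2)(j+1) - 2 (j+2) + 2. It vanishes at j = 0, so the coefficient at
  2 has to come from \<open>Qc_2\<close>.\<close>

lemma Wc_rec: "Wc (j + 2) = fps_const 6 * qD (Qc j) - fps_const (1/4) * Qc j + fps_const (of_nat ((j + 1) * j)) * Qc (j + 2)"
proof (rule fps_ext)
  fix n
  have a: "fps_nth (fps_X\<^sup>2 * g) (j + 2) = fps_nth g j" for g :: "rat fps" by (simp add: fps_X_power_mult_nth)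
  have b: "fps_nth (2 * fps_X * g) (j + 2) = 2 * fps_nth g (j + 1)" for g :: "rat fps"
    by (simp add: mult.assoc numeral_fps_const)
  have c: "fps_nth ((of_nat (6 * n) - fps_const (1/4)) * g) j = (6 * of_nat n - 1/4) * fps_nth g j" for g :: "rat fps"
    by (simp add: left_diff_distrib fps_of_nat[symmetric] numeral_fps_const)
  have d: "fps_nth (2 * g) i = 2 * fps_nth g i" for g :: "rat fps" and i by (simp add: numeral_fps_const)
  show "fps_nth (Wc (j + 2)) n = fps_nth (fps_const 6 * qD (Qc j) - fps_const (1/4) * Qc j + fps_const (of_nat ((j + 1) * j)) * Qc (j + 2)) n"
    unfolding Wc_def Vn_def fps_nth_Abs_fps fps_add_nth fps_sub_nth a b c d
    by (simp add: Qc_def algebra_simps)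
qed

text \<open>Division by the leading coefficient \<open>theta_moment 1\<close> in u leaves
  quasimodular forms, of weight at most j - 1 for the index j. Division of the \<open>Qc j\<close>
  by \<open>Pgen\<close> plays the same part for the ranks.\<close>

definition ec :: "nat \<Rightarrow> rat fps" where "ec j = inverse (theta_moment 1) * theta_moment j"

definition qc :: "nat \<Rightarrow> rat fps" where "qc j = inverse Pgen * Qc j"

definition mu :: "rat fps fps" where "mu = Abs_fps (\<lambda>j. fps_const (1 / fact (j + 1)) * ec (j + 1))"

definition vc :: "nat \<Rightarrow> rat fps" where "vc j = inverse Pgen * Wc j"

lemma Pgen_0: "fps_nth Pgen 0 = 1" by (simp add: Pgen_count)

lemma Pgen_inverse: "Pgen * inverse Pgen = 1"
  using inverse_mult_eq_1[of Pgen] by (simp add: Pgen_0 mult.commute)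

lemma theta_moment_inverse: "theta_moment 1 * inverse (theta_moment 1) = 1"
  using inverse_mult_eq_1[of "theta_moment 1"] by (simp add: theta_moment_1_0 mult.commute del: One_nat_def)

lemma theta_moment_ec: "theta_moment j = theta_moment 1 * ec j"
  unfolding ec_def mult.assoc[symmetric] theta_moment_inverse by simp

lemma Qc_qc: "Qc j = Pgen * qc j"
  unfolding qc_def mult.assoc[symmetric] Pgen_inverse by simp

lemma Wc_vc: "Wc j = Pgen * vc j"
  unfolding vc_def mult.assoc[symmetric] Pgen_inverse by simp

lemma ec_1: "ec 1 = 1"
  unfolding ec_def by (subst mult.commute) (rule theta_moment_inverse)

lemma ec_even: "even j \<Longrightarrow> ec j = 0"
  by (simp add: ec_def theta_moment_even)

lemma qc_0: "qc 0 = 1"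
  unfolding qc_def Qc_0 by (subst mult.commute) (rule Pgen_inverse)

lemma qc_2: "qc 2 = fps_const (- 1/24)"
proof -
  have "qc 2 = fps_const (- 1/24) * (Pgen * inverse Pgen)" unfolding qc_def Qc_2 by (simp only: mult_ac)
  then show ?thesis unfolding Pgen_inverse by simp
qed

lemma vc_0: "vc 0 = fps_const 2"
proof -
  have "vc 0 = fps_const 2 * qc 0" unfolding vc_def Wc_0 qc_def by (simp only: mult_ac)
  then show ?thesis by (simp add: qc_0)
qed

text \<open>Conjugation with P turns 6 \<delta> - 1/4 into 6 \<delta> - E2/4, by the logarithmic
  derivative \<open>qD_Pgen\<close>.\<close>

lemma vc_rec: "vc (j + 2) = fps_const 6 * qD (qc j) - fps_const (1/4) * (E2 * qc j) + fps_const (of_nat ((j + 1) * j)) * qc (j + 2)"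
proof -
  have P6: "fps_const 6 * qD Pgen = fps_const (1/4) * ((1 - E2) * Pgen)"
    unfolding qD_Pgen[symmetric] mult.assoc[symmetric] fps_const_mult by simp
  have "fps_const 6 * qD (Pgen * qc j) - fps_const (1/4) * (Pgen * qc j)
     = fps_const 6 * qD Pgen * qc j + fps_const 6 * (Pgen * qD (qc j)) - fps_const (1/4) * (Pgen * qc j)"
    by (simp add: qD_mult algebra_simps)
  also have "\<dots> = Pgen * (fps_const 6 * qD (qc j) - fps_const (1/4) * (E2 * qc j))"
    unfolding P6 by (simp add: algebra_simps)
  finally have "Wc (j + 2) = Pgen * (fps_const 6 * qD (qc j) - fps_const (1/4) * (E2 * qc j)) + fps_const (of_nat ((j + 1) * j)) * (Pgen * qc (j + 2))"
    unfolding Wc_rec Qc_qc by simp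
  then have "Wc (j + 2) = Pgen * (fps_const 6 * qD (qc j) - fps_const (1/4) * (E2 * qc j) + fps_const (of_nat ((j + 1) * j)) * qc (j + 2))"
    by (simp add: algebra_simps)
  moreover have "Pgen \<noteq> 0" using Pgen_0 by auto
  ultimately show ?thesis unfolding Wc_vc by simp
qed

lemma mu_0: "fps_nth mu 0 = 1"
  using ec_1 by (simp add: mu_def)

lemma mu_1: "fps_nth mu 1 = 0"
  by (simp add: mu_def ec_even)

text \<open>The unknown series is constant in u, so it is determined at u = 0, where
  \<open>mu\<close> is 1 and \<open>vc\<close> is 2.\<close>

lemma mu_vc: "mu ^ 3 * Abs_fps vc = fps_const (fps_const 2)"
proof -
  obtain c where c: "Lc ^ 3 * Abs_fps Wc = fps_const c" using Lc_Wc by blast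
  have L: "Lc = fps_const (theta_moment 1) * mu"
  proof (rule fps_ext)
    fix j
    have "fps_nth Lc j = fps_const (1 / fact (j + 1)) * (theta_moment 1 * ec (j + 1))"
      unfolding Lc_def fps_nth_Abs_fps using theta_moment_ec[of "j + 1"] by (simp only:)
    then show "fps_nth Lc j = fps_nth (fps_const (theta_moment 1) * mu) j"
      unfolding mu_def fps_mult_left_const_nth fps_nth_Abs_fps by (simp only: mult_ac)
  qed
  have W: "Abs_fps Wc = fps_const Pgen * Abs_fps vc" by (rule fps_ext) (simp add: Wc_vc)
  have k: "fps_const (theta_moment 1 ^ 3 * Pgen) * (mu ^ 3 * Abs_fps vc) = fps_const c"
    using c unfolding L W by (simp add: power_mult_distrib fps_const_power mult_ac flip: fps_const_mult del: One_nat_def)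
  have "fps_nth (mu ^ 3 * Abs_fps vc) 0 = fps_const 2" by (simp add: mu_0 vc_0 fps_power_zeroth)
  then have "c = theta_moment 1 ^ 3 * Pgen * fps_const 2" using arg_cong[OF k, of "\<lambda>f. fps_nth f 0"] by (simp del: One_nat_def)
  then have "fps_const (theta_moment 1 ^ 3 * Pgen) * (mu ^ 3 * Abs_fps vc) = fps_const (theta_moment 1 ^ 3 * Pgen) * fps_const (fps_const 2)"
    using k by simp
  moreover have "theta_moment 1 ^ 3 * Pgen \<noteq> 0" using Pgen_0 theta_moment_1_0 by auto
  then have "fps_const (theta_moment 1 ^ 3 * Pgen) \<noteq> 0" by (simp only: fps_const_eq_0_iff not_False_eq_True)
  ultimately show ?thesis using mult_left_cancel by blast
qed

section \<open>The inverse of the normalised theta series\<close>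

definition nu :: "rat fps fps" where "nu = fps_right_inverse mu 1"

lemma mu_nu: "mu * nu = 1"
  unfolding nu_def by (rule fps_right_inverse) (simp add: mu_0)

lemma vc_nu: "vc j = fps_const 2 * fps_nth (nu * (nu * nu)) j"
proof -
  have "Abs_fps vc = (mu * nu) ^ 3 * Abs_fps vc" by (simp add: mu_nu)
  also have "\<dots> = (nu * (nu * nu)) * (mu ^ 3 * Abs_fps vc)" by (simp add: power_mult_distrib power3_eq_cube mult_ac)
  finally have "fps_nth (Abs_fps vc) j = fps_nth ((nu * (nu * nu)) * fps_const (fps_const 2)) j" unfolding mu_vc by simp
  then show ?thesis by (simp add: mult.commute)
qed

lemma nu_rec: "fps_nth nu 0 = 1" "j > 0 \<Longrightarrow> fps_nth nu j = - (\<Sum>i\<in>{1..j}. fps_nth mu i * fps_nth nu (j - i))"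
proof -
  show n0: "fps_nth nu 0 = 1" using arg_cong[OF mu_nu, of "\<lambda>f. fps_nth f 0"] by (simp add: mu_0)
  assume "j > 0"
  then have "(\<Sum>i=0..j. fps_nth mu i * fps_nth nu (j - i)) = 0"
    using arg_cong[OF mu_nu, of "\<lambda>f. fps_nth f j"] by (simp add: fps_mult_nth)
  moreover have "(\<Sum>i=0..j. fps_nth mu i * fps_nth nu (j - i)) = fps_nth nu j + (\<Sum>i\<in>{1..j}. fps_nth mu i * fps_nth nu (j - i))"
    by (simp add: sum.atLeast_Suc_atMost mu_0)
  ultimately show "fps_nth nu j = - (\<Sum>i\<in>{1..j}. fps_nth mu i * fps_nth nu (j - i))" by (simp add: eq_neg_iff_add_eq_0)
qed

lemma nu_1: "fps_nth nu 1 = 0"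
  using nu_rec(2)[of 1] mu_1 by simp

lemma nu_2: "fps_nth nu 2 = - fps_nth mu 2"
  using nu_rec(2)[of 2] mu_1 nu_rec(1) by (simp add: numeral_2_eq_2)

lemma square_nth_2:
  fixes f g :: "'a::comm_ring_1 fps"
  assumes "fps_nth f 0 = 1" "fps_nth f 1 = 0" "fps_nth g 0 = 1" "fps_nth g 1 = 0"
  shows "fps_nth (f * g) 2 = fps_nth f 2 + fps_nth g 2"
  using assms by (simp add: fps_mult_nth numeral_2_eq_2 sum.atLeast0_atMost_Suc)

text \<open>The equation itself yields the logarithmic derivative of \<open>theta_moment 1\<close>, in place of Jacobi's identity
  for the cube of the eta function.\<close>

lemma mu_2: "fps_nth mu 2 = fps_const (1/24) * E2"
proof -
  have 1: "fps_nth (nu * nu) 0 = 1" "fps_nth (nu * nu) 1 = 0"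
    using nu_rec(1) nu_1 by (simp_all add: fps_mult_nth)
  have "vc 2 = fps_const 2 * (fps_nth nu 2 + (fps_nth nu 2 + fps_nth nu 2))"
    using vc_nu[of 2] square_nth_2[OF nu_rec(1) nu_1 1] square_nth_2[OF nu_rec(1) nu_1 nu_rec(1) nu_1] by simp
  also have "\<dots> = - (fps_const 6 * fps_nth mu 2)" unfolding nu_2 by (rule fps_ext) simp
  \<comment> \<open>At j = 0 the factor (j + 1) j is 0, so \<open>qc 2\<close> drops out and only E2
    is left.\<close>
  also have "vc 2 = - (fps_const (1/4) * E2)" using vc_rec[of 0] unfolding add_0 qc_0 by simp
  finally have "fps_const (1/4) * E2 = fps_const 6 * fps_nth mu 2" by simp
  then have "fps_const (1/6) * (fps_const (1/4) * E2) = fps_const (1/6) * (fps_const 6 * fps_nth mu 2)" by simp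
  then show ?thesis unfolding mult.assoc[symmetric] fps_const_mult by simp
qed

text \<open>Conjugation with \<open>theta_moment 1\<close> turns 2 \<delta> + 1/4 into 2 \<delta> +
  E2/4. The logarithmic derivative \<open>J\<close> that this takes is the case j = 1, where
  \<open>mu_2\<close> gives \<open>ec 3\<close>.\<close>

lemma ec_rec: "ec (j + 2) = fps_const 2 * qD (ec j) + fps_const (1/4) * (E2 * ec j)"
proof -
  have "ec 3 = fps_const 6 * fps_nth mu 2" by (simp add: mu_def fact_numeral numeral_3_eq_3 mult.assoc[symmetric])
  then have "ec 3 = fps_const (1/4) * E2" unfolding mu_2 mult.assoc[symmetric] fps_const_mult by simp
  then have "theta_moment 3 = theta_moment 1 * (fps_const (1/4) * E2)" using theta_moment_ec[of 3] by simp
  moreover have "theta_moment 3 = fps_const 2 * qD (theta_moment 1) + fps_const (1/4) * theta_moment 1" using theta_moment_rec[of 1] by (simp del: One_nat_def)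
  ultimately have J: "fps_const 2 * qD (theta_moment 1) = fps_const (1/4) * (E2 * theta_moment 1) - fps_const (1/4) * theta_moment 1"
    by (simp add: algebra_simps del: One_nat_def)
  have "theta_moment (j + 2) = fps_const 2 * qD (theta_moment 1) * ec j + fps_const 2 * (theta_moment 1 * qD (ec j)) + fps_const (1/4) * (theta_moment 1 * ec j)"
    unfolding theta_moment_rec by (subst (1 2) theta_moment_ec[of j]) (simp add: qD_mult algebra_simps del: One_nat_def)
  also have "\<dots> = theta_moment 1 * (fps_const 2 * qD (ec j) + fps_const (1/4) * (E2 * ec j))"
    unfolding J by (simp add: algebra_simps del: One_nat_def)
  finally have "theta_moment 1 * ec (j + 2) = theta_moment 1 * (fps_const 2 * qD (ec j) + fps_const (1/4) * (E2 * ec j))"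
    by (rule trans[OF theta_moment_ec[symmetric]])
  moreover have "theta_moment 1 \<noteq> 0" using theta_moment_1_0 by auto
  ultimately show ?thesis by simp
qed

lemma mu_rec: "fps_nth mu (j + 2) = fps_const (1 / (of_nat (j + 2) * of_nat (j + 3))) * (fps_const 2 * qD (fps_nth mu j) + fps_const (1/4) * (E2 * fps_nth mu j))"
proof -
  have f: "fact (j + 3) = (of_nat (j + 2) * of_nat (j + 3) * fact (j + 1) :: rat)"
    by (simp add: numeral_3_eq_3 algebra_simps)
  have "fps_nth mu (j + 2) = fps_const (1 / fact (j + 3)) * ec (j + 1 + 2)" by (simp add: mu_def numeral_3_eq_3 del: fact_Suc)
  also have "\<dots> = fps_const (1 / (of_nat (j + 2) * of_nat (j + 3))) * (fps_const (1 / fact (j + 1)) * (fps_const 2 * qD (ec (j + 1)) + fps_const (1/4) * (E2 * ec (j + 1))))"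
    unfolding ec_rec f mult.assoc[symmetric] fps_const_mult by simp
  also have "fps_const (1 / fact (j + 1)) * (fps_const 2 * qD (ec (j + 1)) + fps_const (1/4) * (E2 * ec (j + 1)))
     = fps_const 2 * qD (fps_nth mu j) + fps_const (1/4) * (E2 * fps_nth mu j)"
  proof -
    have m: "fps_nth mu j = fps_const (1 / fact (j + 1)) * ec (j + 1)" by (simp add: mu_def)
    show ?thesis unfolding m qD_const_mult distrib_left by (simp only: mult_ac)
  qed
  finally show ?thesis .
qed

lemma target_qc:
  assumes "k \<ge> 1"
  shows "Rgen (2 * k) - poly_delta (Ppoly k) (Rgen 2) = Pgen * (\<Sum>j=0..2 * k. fps_const (fact (2 * k) * fps_nth sig (2 * k - j)) * qc j)"
  unfolding target_Qc[OF assms] Qc_qc sum_distrib_left by (simp only: mult_ac)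

section \<open>Integrality at \<open>l\<close>\<close>

lemma l_integral_inverse_small:
  assumes "prime l" "0 < m" "m < l" shows "l_integral l (1 / of_nat m)"
  using assms by (intro l_integral_inverse_nat) (auto dest: dvd_imp_le)

lemma l_integral_inverse_fact:
  assumes "prime l" "m < l" shows "l_integral l (1 / fact m)"
  using l_integral_inverse_nat[of l "fact m"] assms by (simp add: prime_dvd_fact_iff)

lemma l_integral_half: assumes "prime l" "l > 3" shows "l_integral l (1/2)"
  using l_integral_inverse_small[OF assms(1), of 2] assms by simp

lemma l_integral_quarter: assumes "prime l" "l > 3" shows "l_integral l (1/4)"
  using l_integral_mult[OF assms(1) l_integral_half[OF assms] l_integral_half[OF assms]] by simp

lemma l_integral_24th: assumes "prime l" "l > 3" shows "l_integral l (1/24)"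
  using l_integral_mult[OF assms(1) l_integral_quarter[OF assms] l_integral_mult[OF assms(1) l_integral_half[OF assms] l_integral_inverse_small[OF assms(1), of 3]]] assms
  by simp

text \<open>Only the factors 2 and 1/4 occur in \<open>ec_rec\<close>, so before division by
  factorials no index brings l into a denominator.\<close>

lemma ec_Xfilt:
  assumes l: "prime l" "l > 3"
  shows "ec (j + 1) \<in> Xfilt l j"
proof (induction j rule: nat_less_induct)
  case (1 j)
  consider "j = 0" | "j = 1" | i where "j = i + 2" by (metis One_nat_def Suc_1 add_2_eq_Suc' not0_implies_Suc)
  then show ?case
  proof cases
    case 1 then show ?thesis using ec_1 Xfilt_1[OF l(1)] by simp
  next
    case 2 then show ?thesis by (simp add: ec_even Xfilt_zero)
  next
    case 3
    then have IH: "ec (i + 1) \<in> Xfilt l i" using "1.IH" by simp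
    have e: "ec (j + 1) = fps_const 2 * qD (ec (i + 1)) + fps_const (1/4) * (E2 * ec (i + 1))"
      using ec_rec[of "i + 1"] 3 by (simp add: add.commute add.left_commute)
    have 1: "fps_const 2 * qD (ec (i + 1)) \<in> Xfilt l j"
      unfolding 3 by (intro Xfilt_scale Xfilt_qD l IH) (simp add: l)
    have "E2 * ec (i + 1) \<in> Xfilt l j"
      unfolding 3 using Xfilt_mult[OF l(1) Xfilt_E2[OF l(1)] IH] by (simp add: add.commute)
    then have "fps_const (1/4) * (E2 * ec (i + 1)) \<in> Xfilt l j"
      by (intro Xfilt_scale l l_integral_quarter)
    with 1 show ?thesis unfolding e by (rule Xfilt_add)
  qed
qed

lemma mu_Xfilt:
  assumes l: "prime l" "l > 3" and j: "j + 1 < l"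
  shows "fps_nth mu j \<in> Xfilt l j"
  unfolding mu_def fps_nth_Abs_fps
  by (intro Xfilt_scale ec_Xfilt l l_integral_inverse_fact j)

text \<open>The denominator l! contains l exactly once.\<close>

lemma mu_pred_l_Xfilt:
  assumes l: "prime l" "l > 3"
  shows "fps_const (of_nat l) * fps_nth mu (l - 1) \<in> Xfilt l (l - 1)"
proof -
  have "fps_const (of_nat l) * fps_nth mu (l - 1) = fps_const (of_nat l * (1 / fact l)) * ec (l - 1 + 1)"
    using l by (simp add: mu_def mult.assoc[symmetric] del: fact_Suc)
  also have "of_nat l * (1 / fact l) = (1 / fact (l - 1) :: rat)"
    using l by (simp add: fact_reduce[of l])
  finally show ?thesis using l by (simp only:) (intro Xfilt_scale ec_Xfilt l_integral_inverse_fact, auto)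
qed

text \<open>Only the coefficients with index \<open>l - 1\<close> and \<open>l + 1\<close> may have \<open>l\<close> in the denominator; \<open>a\<close> and \<open>b\<close>
  record them modulo integral forms.\<close>

definition l_admissible :: "nat \<Rightarrow> rat fps fps \<Rightarrow> rat fps \<Rightarrow> rat fps \<Rightarrow> bool" where
  "l_admissible l f a b \<longleftrightarrow> fps_nth f 0 = 1 \<and> fps_nth f 1 = 0 \<and> (\<forall>j < l - 1. fps_nth f j \<in> Xfilt l j) \<and>
     fps_nth f (l - 1) - a \<in> Xfilt l (l - 1) \<and> fps_nth f l \<in> Xfilt l l \<and> fps_nth f (l + 1) - b \<in> Xfilt l (l + 1)"

lemma Xfilt_mult_eq:
  assumes "prime l" "f \<in> Xfilt l i" "g \<in> Xfilt l j" "k = i + j" shows "f * g \<in> Xfilt l k"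
  using Xfilt_mult[OF assms(1-3)] assms(4) by simp

text \<open>Two critical factors never meet at an index up to l + 1; a factor that may have l in its
  denominator is only multiplied by a coefficient of index 0, 1 or 2. Index 2 yields the mixed terms
  with \<open>c\<close> and \<open>a\<close>.\<close>

lemma l_admissible_mult:
  assumes l: "prime l" "l > 3" and f: "l_admissible l f a b" and g: "l_admissible l g c d"
  shows "l_admissible l (f * g) (a + c) (b + d + fps_nth f 2 * c + fps_nth g 2 * a)"
proof -
  let ?f = "fps_nth f" and ?g = "fps_nth g"
  \<comment> \<open>So l is at least 5, which keeps the indices 0, 1, 2 apart from l - 1, l, l +
    1.\<close>
  have l4: "l \<noteq> 4" using l(1) prime_nat_iff[of 4] by (auto dest: spec[of _ 2])
  define p where "p = l - 1"
  have p: "l = p + 1" "p \<ge> 4" using l l4 by (auto simp: p_def)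
  note F = f[unfolded l_admissible_def] and G = g[unfolded l_admissible_def]
  have f0: "?f 0 = 1" "?f 1 = 0" "?g 0 = 1" "?g 1 = 0" using F G by auto
  have fX: "?f j \<in> Xfilt l j" "?g j \<in> Xfilt l j" if "j < p" for j using F G that p by auto
  have fp: "?f p - a \<in> Xfilt l p" "?g p - c \<in> Xfilt l p" using F G p by auto
  have fl: "?f (p + 1) \<in> Xfilt l (p + 1)" "?g (p + 1) \<in> Xfilt l (p + 1)" using F G p by auto
  have fl1: "?f (p + 2) - b \<in> Xfilt l (p + 2)" "?g (p + 2) - d \<in> Xfilt l (p + 2)" using F G p by auto
  have prod: "?f i * ?g (j - i) \<in> Xfilt l j" if "i \<le> j" "i < p" "j - i < p" for i j
    using that by (intro Xfilt_mult_eq[OF l(1) fX(1) fX(2)]) auto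
  have low: "fps_nth (f * g) j \<in> Xfilt l j" if "j < p" for j
    unfolding fps_mult_nth using that by (intro Xfilt_sum prod) auto
  have P: "fps_nth (f * g) p - (a + c) \<in> Xfilt l p"
  proof -
    have set: "{0..p} = insert 0 (insert p {1..p - 1})" using p by auto
    have "fps_nth (f * g) p = ?g p + ?f p + (\<Sum>i\<in>{1..p-1}. ?f i * ?g (p - i))"
      unfolding fps_mult_nth set using p f0 by (simp add: algebra_simps)
    then have "fps_nth (f * g) p - (a + c) = (?g p - c) + (?f p - a) + (\<Sum>i\<in>{1..p-1}. ?f i * ?g (p - i))" by simp
    also have "\<dots> \<in> Xfilt l p" using p by (intro Xfilt_add fp Xfilt_sum prod) auto
    finally show ?thesis .
  qed
  have P1: "fps_nth (f * g) (p + 1) \<in> Xfilt l (p + 1)"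
  proof -
    have set: "{0..p+1} = insert 0 (insert (p + 1) (insert 1 (insert p {2..p - 1})))" using p by auto
    have "fps_nth (f * g) (p + 1) = ?g (p + 1) + ?f (p + 1) + (\<Sum>i\<in>{2..p-1}. ?f i * ?g (p + 1 - i))"
      unfolding fps_mult_nth set using p f0 by (simp add: algebra_simps)
    also have "\<dots> \<in> Xfilt l (p + 1)" using p by (intro Xfilt_add fl Xfilt_sum prod) auto
    finally show ?thesis .
  qed
  have P2: "fps_nth (f * g) (p + 2) - (b + d + ?f 2 * c + ?g 2 * a) \<in> Xfilt l (p + 2)"
  proof -
    have set: "{0..p+2} = insert 0 (insert (p + 2) (insert 1 (insert (p + 1) (insert 2 (insert p {3..p - 1})))))" using p by auto
    have "fps_nth (f * g) (p + 2) = ?g (p + 2) + ?f (p + 2) + ?f 2 * ?g p + ?f p * ?g 2 + (\<Sum>i\<in>{3..p-1}. ?f i * ?g (p + 2 - i))"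
      unfolding fps_mult_nth set using p f0 by (simp add: algebra_simps)
    then have "fps_nth (f * g) (p + 2) - (b + d + ?f 2 * c + ?g 2 * a) =
       (?g (p + 2) - d) + (?f (p + 2) - b) + ?f 2 * (?g p - c) + ?g 2 * (?f p - a) + (\<Sum>i\<in>{3..p-1}. ?f i * ?g (p + 2 - i))"
      by (simp add: algebra_simps)
    also have "\<dots> \<in> Xfilt l (p + 2)"
      using p by (intro Xfilt_add fl1 Xfilt_sum prod Xfilt_mult_eq[OF l(1) fX(1) fp(2)] Xfilt_mult_eq[OF l(1) fX(2) fp(1)]) auto
    finally show ?thesis .
  qed
  have "fps_nth (f * g) 0 = 1" "fps_nth (f * g) 1 = 0" using f0 by (simp_all add: fps_mult_nth)
  then show ?thesis unfolding l_admissible_def using low P P1 P2 p by simp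
qed

text \<open>With x = \<open>mu\<close> - 1 the inverse is 1 - x + x^2 - ..., and the critical part
  of x^2 at index l + 1 is 2 A times the coefficient E2/24 of u^2.\<close>

lemma l_admissible_nu:
  assumes l: "prime l" "l > 3"
  defines "A \<equiv> fps_nth mu (l - 1)" and "B \<equiv> fps_nth mu (l + 1)"
  shows "l_admissible l nu (- A) (- B + fps_const (1/12) * (E2 * A))"
proof -
  let ?m = "fps_nth mu" and ?n = "fps_nth nu"
  have l4: "l \<noteq> 4" using l(1) prime_nat_iff[of 4] by (auto dest: spec[of _ 2])
  define p where "p = l - 1"
  have p: "l = p + 1" "p \<ge> 4" using l l4 by (auto simp: p_def)
  have mX: "?m j \<in> Xfilt l j" if "j < p" for j using that p by (intro mu_Xfilt l) auto
  have nX: "?n j \<in> Xfilt l j" if "j < p" for j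
    using that
  proof (induction j rule: less_induct)
    case (less j)
    show ?case
    proof (cases "j = 0")
      case True then show ?thesis using nu_rec(1) Xfilt_1[OF l(1)] by simp
    next
      case False
      then have "?n j = - (\<Sum>i\<in>{1..j}. ?m i * ?n (j - i))" by (intro nu_rec(2)) simp
      also have "\<dots> \<in> Xfilt l j"
        using less False by (intro Xfilt_minus l Xfilt_sum Xfilt_mult_eq[OF l(1) mX less.IH]) auto
      finally show ?thesis .
    qed
  qed
  have prod: "?m i * ?n (j - i) \<in> Xfilt l j" if "i \<le> j" "i < p" "j - i < p" for i j
    using that by (intro Xfilt_mult_eq[OF l(1) mX nX]) auto
  \<comment> \<open>Here p + 1 = l is odd, and the normalised theta series divided by u is even in
    u.\<close>
  have mp1: "?m (p + 1) = 0"
  proof -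
    have "odd l" using l prime_odd_nat[of l] by simp
    then show ?thesis using p by (simp add: mu_def ec_even)
  qed
  have P: "?n p - (- A) \<in> Xfilt l p"
  proof -
    have set: "{1..p} = insert p {1..p - 1}" using p by auto
    have "?n p = - (\<Sum>i\<in>{1..p}. ?m i * ?n (p - i))" using p by (intro nu_rec(2)) simp
    moreover have "(\<Sum>i\<in>{1..p}. ?m i * ?n (p - i)) = ?m p + (\<Sum>i\<in>{1..p-1}. ?m i * ?n (p - i))"
      unfolding set using p(2) nu_rec(1) by simp
    moreover have "A = ?m p" using p(1) by (simp add: A_def)
    ultimately have "?n p - (- A) = - (\<Sum>i\<in>{1..p-1}. ?m i * ?n (p - i))" by simp
    also have "\<dots> \<in> Xfilt l p" using p by (intro Xfilt_minus l Xfilt_sum prod) auto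
    finally show ?thesis .
  qed
  have P1: "?n (p + 1) \<in> Xfilt l (p + 1)"
  proof -
    have set: "{1..p+1} = insert (p + 1) (insert 1 (insert p {2..p - 1}))" using p by auto
    have "?n (p + 1) = - (\<Sum>i\<in>{1..p+1}. ?m i * ?n (p + 1 - i))" by (intro nu_rec(2)) simp
    then have "?n (p + 1) = - (\<Sum>i\<in>{2..p-1}. ?m i * ?n (p + 1 - i))"
      unfolding set using p(2) mu_1 nu_1 mp1 by simp
    also have "\<dots> \<in> Xfilt l (p + 1)" using p by (intro Xfilt_minus l Xfilt_sum prod) auto
    finally show ?thesis .
  qed
  have P2: "?n (p + 2) - (- B + fps_const (1/12) * (E2 * A)) \<in> Xfilt l (p + 2)"
  proof -
    have set: "{1..p+2} = insert (p + 2) (insert 1 (insert (p + 1) (insert 2 (insert p {3..p - 1}))))" using p by auto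
    have "?n (p + 2) = - (\<Sum>i\<in>{1..p+2}. ?m i * ?n (p + 2 - i))" by (intro nu_rec(2)) simp
    then have "?n (p + 2) = - (B + ?m 2 * ?n p + A * ?n 2 + (\<Sum>i\<in>{3..p-1}. ?m i * ?n (p + 2 - i)))"
    proof -
      have "(\<Sum>i\<in>{1..p+2}. ?m i * ?n (p + 2 - i)) = ?m (p + 2) + ?m 2 * ?n p + ?m p * ?n 2 + (\<Sum>i\<in>{3..p-1}. ?m i * ?n (p + 2 - i))"
        unfolding set using p(2) mu_1 nu_1 mp1 nu_rec(1) by (simp add: add.assoc)
      moreover have "A = ?m p" "B = ?m (p + 2)" using p(1) by (simp_all add: A_def B_def)
      ultimately show ?thesis using \<open>?n (p + 2) = _\<close> by simp
    qed
    also have "A * ?n 2 = - (?m 2 * A)" by (simp add: nu_2)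
    finally have "?n (p + 2) = - B + (?m 2 * A + ?m 2 * A) - ?m 2 * (?n p - (- A)) - (\<Sum>i\<in>{3..p-1}. ?m i * ?n (p + 2 - i))"
      by (simp add: algebra_simps)
    moreover have "?m 2 * A + ?m 2 * A = fps_const (1/12) * (E2 * A)"
      unfolding mu_2 mult.assoc distrib_right[symmetric] fps_const_add by simp
    ultimately have "?n (p + 2) - (- B + fps_const (1/12) * (E2 * A)) = - (?m 2 * (?n p - (- A))) - (\<Sum>i\<in>{3..p-1}. ?m i * ?n (p + 2 - i))"
      by (simp add: algebra_simps)
    also have "\<dots> \<in> Xfilt l (p + 2)"
      using p by (intro Xfilt_diff Xfilt_minus l Xfilt_sum prod Xfilt_mult_eq[OF l(1) mX P]) auto
    finally show ?thesis .
  qed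
  show ?thesis unfolding l_admissible_def using nu_rec(1) nu_1 nX P P1 P2 p by simp
qed

text \<open>As for \<open>nu\<close>, now with 1 - 3 x + 6 x^2 - ...: the quadratic term contributes
  12 A times E2/24.\<close>

lemma l_admissible_nu_cube:
  assumes l: "prime l" "l > 3"
  defines "A \<equiv> fps_nth mu (l - 1)" and "B \<equiv> fps_nth mu (l + 1)"
  shows "l_admissible l (nu * (nu * nu)) (- (fps_const 3 * A)) (- (fps_const 3 * B) + fps_const (1/2) * (E2 * A))"
proof -
  define b where "b = - B + fps_const (1/12) * (E2 * A)"
  have n: "l_admissible l nu (- A) b" unfolding A_def B_def b_def by (rule l_admissible_nu[OF l])
  define b2 where "b2 = b + b + fps_nth nu 2 * (- A) + fps_nth nu 2 * (- A)"
  have n2: "l_admissible l (nu * nu) (- A + - A) b2" unfolding b2_def by (rule l_admissible_mult[OF l n n])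
  have n3: "l_admissible l (nu * (nu * nu)) (- A + (- A + - A)) (b + b2 + fps_nth nu 2 * (- A + - A) + fps_nth (nu * nu) 2 * (- A))"
    by (rule l_admissible_mult[OF l n n2])
  have nn2: "fps_nth (nu * nu) 2 = fps_nth nu 2 + fps_nth nu 2"
    by (rule square_nth_2[OF nu_rec(1) nu_1 nu_rec(1) nu_1])
  have mA: "fps_nth nu 2 * A = - (fps_const (1/24) * (E2 * A))" unfolding nu_2 mu_2 by (simp add: mult.assoc)
  have "- A + (- A + - A) = - (fps_const 3 * A)" by (rule fps_ext) simp
  moreover have "b + b2 + fps_nth nu 2 * (- A + - A) + fps_nth (nu * nu) 2 * (- A) = - (fps_const 3 * B) + fps_const (1/2) * (E2 * A)"
  proof -
    have "b + b2 + fps_nth nu 2 * (- A + - A) + fps_nth (nu * nu) 2 * (- A) = b + b + b - (fps_nth nu 2 * A + fps_nth nu 2 * A + fps_nth nu 2 * A + fps_nth nu 2 * A + fps_nth nu 2 * A + fps_nth nu 2 * A)"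
      unfolding nn2 b2_def by (simp add: algebra_simps)
    also have "\<dots> = - (fps_const 3 * B) + fps_const (1/2) * (E2 * A)"
    proof (rule fps_ext)
      fix n
      show "fps_nth (b + b + b - (fps_nth nu 2 * A + fps_nth nu 2 * A + fps_nth nu 2 * A + fps_nth nu 2 * A + fps_nth nu 2 * A + fps_nth nu 2 * A)) n
          = fps_nth (- (fps_const 3 * B) + fps_const (1/2) * (E2 * A)) n"
        unfolding mA b_def fps_add_nth fps_sub_nth fps_neg_nth fps_mult_left_const_nth by (simp add: field_simps)
    qed
    finally show ?thesis .
  qed
  ultimately show ?thesis using n3 by (simp only:)
qed

lemma qc_next:
  assumes "j > 0"
  shows "qc (j + 2) = fps_const (1 / (of_nat (j + 1) * of_nat j)) * (vc (j + 2) - fps_const 6 * qD (qc j) + fps_const (1/4) * (E2 * qc j))"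
proof -
  have "vc (j + 2) - fps_const 6 * qD (qc j) + fps_const (1/4) * (E2 * qc j) = fps_const (of_nat (j + 1) * of_nat j) * qc (j + 2)"
  proof -
    have "(a - b + c) - a + b = c" for a b c :: "rat fps" by simp
    then show ?thesis unfolding vc_rec[of j] of_nat_mult .
  qed
  moreover have "fps_const (1 / (of_nat (j + 1) * of_nat j)) * (fps_const (of_nat (j + 1) * of_nat j) * qc (j + 2)) = qc (j + 2)"
    unfolding mult.assoc[symmetric] fps_const_mult using assms by simp
  ultimately show ?thesis by simp
qed

lemma Xfilt_E2_mult: "prime l \<Longrightarrow> F \<in> Xfilt l k \<Longrightarrow> E2 * F \<in> Xfilt l (k + 2)"
  using Xfilt_mult_eq[OF _ Xfilt_E2, of l F k "k + 2"] by simp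

lemma qc_step_Xfilt:
  assumes l: "prime l" "l > 3" and F: "F \<in> Xfilt l k"
  shows "fps_const (1/4) * (E2 * F) - fps_const 6 * qD F \<in> Xfilt l (k + 2)"
  using l F by (intro Xfilt_diff Xfilt_scale Xfilt_E2_mult Xfilt_qD l_integral_quarter) auto

lemma vc_Xfilt:
  assumes l: "prime l" "l > 3" and j: "j < l - 1"
  shows "vc j \<in> Xfilt l j"
  using l_admissible_nu_cube[OF l] j unfolding l_admissible_def vc_nu by (intro Xfilt_scale) (auto simp: l)

text \<open>The induction restarts at \<open>qc 2\<close>, which the recursion does not reach; up to
  this range the denominators j + 1 and j are smaller than l.\<close>

lemma qc_Xfilt:
  assumes l: "prime l" "l > 3"
  shows "2 * i < l - 1 \<Longrightarrow> qc (2 * i) \<in> Xfilt l (2 * i)"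
proof (induction i)
  case 0 then show ?case by (simp add: qc_0 Xfilt_1 l)
next
  case (Suc i)
  show ?case
  proof (cases "i = 0")
    case True
    have "l_integral l (- 1/24)" using l_integral_minus[OF l(1) l_integral_24th[OF l]] by simp
    then show ?thesis using True by (simp add: qc_2 Xfilt_const l del: fps_const_neg)
  next
    case False
    define j where "j = 2 * i"
    have j: "j > 0" "2 * Suc i = j + 2" "j + 2 < l - 1" using False Suc.prems by (auto simp: j_def)
    have IH: "qc j \<in> Xfilt l j" using Suc j by (simp add: j_def)
    have "qc (j + 2) = fps_const (1 / of_nat (j + 1) * (1 / of_nat j)) * (vc (j + 2) + (fps_const (1/4) * (E2 * qc j) - fps_const 6 * qD (qc j)))"
      unfolding qc_next[OF j(1)] by (simp add: algebra_simps)
    also have "\<dots> \<in> Xfilt l (j + 2)"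
      using j l by (intro Xfilt_scale Xfilt_add vc_Xfilt qc_step_Xfilt IH l_integral_mult l_integral_inverse_small) auto
    finally show ?thesis unfolding j(2) .
  qed
qed

text \<open>The step from l - 3 divides by (l-2)(l-3), still prime to l, so the only critical
  contribution is the -6 A in \<open>vc (l - 1)\<close>.\<close>

lemma qc_pred_l:
  assumes l: "prime l" "l > 3"
  shows "\<exists>r \<in> Xfilt l (l - 1). qc (l - 1) = fps_const (- 6 / ((of_nat l - 2) * (of_nat l - 3))) * fps_nth mu (l - 1) + r"
proof -
  define A where "A = fps_nth mu (l - 1)"
  define j where "j = l - 3"
  have odd: "odd l" using l prime_odd_nat[of l] by simp
  have l4: "l \<noteq> 4" using odd by auto
  have j: "j > 0" "j + 2 = l - 1" "j < l - 1" "j + 1 < l" "even j" using l odd by (auto simp: j_def)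
  have oj: "of_nat (j + 1) = (of_nat l - 2 :: rat)" "of_nat j = (of_nat l - 3 :: rat)" using l by (auto simp: j_def of_nat_diff)
  have jX: "qc j \<in> Xfilt l j" using qc_Xfilt[OF l, of "j div 2"] j by simp
  define t where "t = fps_nth (nu * (nu * nu)) (l - 1) - (- (fps_const 3 * A))"
  have t: "t \<in> Xfilt l (l - 1)" using l_admissible_nu_cube[OF l] unfolding l_admissible_def t_def A_def by blast
  define c where "c = (1 / of_nat (j + 1) * (1 / of_nat j) :: rat)"
  have c: "l_integral l c" unfolding c_def using j l by (intro l_integral_mult l_integral_inverse_small) auto
  define r where "r = fps_const c * (fps_const 2 * t + (fps_const (1/4) * (E2 * qc j) - fps_const 6 * qD (qc j)))"
  have rX: "r \<in> Xfilt l (l - 1)"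
    unfolding r_def using qc_step_Xfilt[OF l jX] t c l unfolding j(2) by (intro Xfilt_scale Xfilt_add) auto
  have v: "vc (j + 2) = fps_const 2 * t - fps_const 6 * A"
  proof -
    have "fps_nth (nu * (nu * nu)) (l - 1) = t - fps_const 3 * A" by (simp add: t_def)
    then show ?thesis unfolding vc_nu j(2) by (simp add: right_diff_distrib mult.assoc[symmetric])
  qed
  have "qc (j + 2) = fps_const c * (vc (j + 2) - fps_const 6 * qD (qc j) + fps_const (1/4) * (E2 * qc j))"
    unfolding qc_next[OF j(1)] c_def by simp
  also have "\<dots> = fps_const (- 6 * c) * A + r"
    unfolding v r_def by (rule fps_ext) (simp add: algebra_simps)
  also have "- 6 * c = - 6 / ((of_nat l - 2) * (of_nat l - 3))" unfolding c_def oj by simp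
  finally show ?thesis using rX unfolding j(2) A_def by blast
qed

text \<open>Both \<open>vc (l + 1)\<close> and \<open>qc (l - 1)\<close> have denominator \<open>l\<close>, but the polar parts cancel modulo \<open>l\<close>: the
  coefficients \<open>c1\<close> and \<open>c2\<close> below are divisible by \<open>l\<close>.\<close>

lemma top_coefficient_Xfilt:
  assumes l: "prime l" "l > 3"
  shows "vc (l + 1) - fps_const 6 * qD (qc (l - 1)) + fps_const (1/4) * (E2 * qc (l - 1)) \<in> Xfilt l (l + 1)"
proof -
  define A where "A = fps_nth mu (l - 1)"
  define B where "B = fps_nth mu (l + 1)"
  define x where "x = (of_nat l :: rat)"
  define p where "p = l - 1"
  have p: "p + 2 = l + 1" "p + 3 = l + 2" "p + 1 = l" using l by (auto simp: p_def)
  have x: "x > 3" unfolding x_def using l(2) by (metis of_nat_less_iff of_nat_numeral)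
  obtain r where r: "r \<in> Xfilt l p" "qc p = fps_const (- 6 / ((x - 2) * (x - 3))) * A + r"
    using qc_pred_l[OF l] unfolding A_def x_def p_def by blast
  define t where "t = fps_nth (nu * (nu * nu)) (l + 1) - (- (fps_const 3 * B) + fps_const (1/2) * (E2 * A))"
  have t: "t \<in> Xfilt l (l + 1)" using l_admissible_nu_cube[OF l] unfolding l_admissible_def t_def A_def B_def by blast
  have Beq: "B = fps_const (1 / ((x + 1) * (x + 2))) * (fps_const 2 * qD A + fps_const (1/4) * (E2 * A))"
    using mu_rec[of p] unfolding p B_def A_def p_def[symmetric] x_def by (simp add: add.commute)
  have v: "vc (l + 1) = fps_const 2 * t - fps_const 6 * B + E2 * A"
  proof -
    have "fps_nth (nu * (nu * nu)) (l + 1) = t - fps_const 3 * B + fps_const (1/2) * (E2 * A)" by (simp add: t_def)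
    then show ?thesis unfolding vc_nu by (simp only:) (rule fps_ext, simp add: algebra_simps)
  qed
  \<comment> \<open>The coefficients of \<open>qD A\<close> and \<open>E2 * A\<close> in
    \<open>main\<close> are rational functions of x = l that vanish at x = 0; \<open>c1\<close> and
    \<open>c2\<close> are their quotients by x. The common denominator \<open>den\<close> is 12
    modulo l, hence invertible.\<close>
  define den where "den = (x - 2) * (x - 3) * ((x + 1) * (x + 2))"
  define c1 where "c1 = (24 * x + 168) * (1 / den)"
  define c2 where "c2 = (x ^ 3 - 2 * x\<^sup>2 - 10 * x + 11) * (1 / den)"
  have den0: "den \<noteq> 0" using x by (simp add: den_def)
  have iden: "l_integral l (1 / den)"
  proof -
    have "\<not> l dvd l + 1" "\<not> l dvd l + 2" unfolding dvd_add_triv_left_iff using l by (auto dest: dvd_imp_le)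
    then have a: "l_integral l (1 / of_nat (l + 1))" "l_integral l (1 / of_nat (l + 2))"
      by (intro l_integral_inverse_nat l; simp)+
    have b: "l_integral l (1 / of_nat (l - 2))" "l_integral l (1 / of_nat (l - 3))"
      by (rule l_integral_inverse_small[OF l(1)]; use l in simp)+
    have "1 / den = 1 / of_nat (l - 2) * (1 / of_nat (l - 3)) * (1 / of_nat (l + 1) * (1 / of_nat (l + 2)))"
      using l unfolding den_def x_def by (simp add: of_nat_diff add.commute)
    then show ?thesis using l_integral_mult[OF l(1) l_integral_mult[OF l(1) b] l_integral_mult[OF l(1) a]] by simp
  qed
  have xi: "l_integral l x" unfolding x_def by (rule l_integral_of_nat[OF l(1)])
  have ci: "l_integral l c1" "l_integral l c2" unfolding c1_def c2_def
    by (intro l_integral_mult l_integral_add l_integral_diff l_integral_power xi iden l l_integral_numeral)+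
  have k1: "36 / ((x - 2) * (x - 3)) - 12 / ((x + 1) * (x + 2)) = c1 * x"
  proof -
    have "36 / ((x - 2) * (x - 3)) - 12 / ((x + 1) * (x + 2)) = (36 * ((x + 1) * (x + 2)) - 12 * ((x - 2) * (x - 3))) / den"
      unfolding den_def using x by (simp add: divide_simps)
    also have "36 * ((x + 1) * (x + 2)) - 12 * ((x - 2) * (x - 3)) = (24 * x + 168) * x" by (simp add: algebra_simps)
    finally show ?thesis by (simp add: c1_def)
  qed
  have k2: "1 - (3/2) / ((x - 2) * (x - 3)) - (3/2) / ((x + 1) * (x + 2)) = c2 * x"
  proof -
    have "1 - (3/2) / ((x - 2) * (x - 3)) - (3/2) / ((x + 1) * (x + 2)) = (den - (3/2) * ((x + 1) * (x + 2)) - (3/2) * ((x - 2) * (x - 3))) / den"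
      unfolding den_def using x by (simp add: divide_simps) (simp add: algebra_simps)
    also have "den - (3/2) * ((x + 1) * (x + 2)) - (3/2) * ((x - 2) * (x - 3)) = (x ^ 3 - 2 * x\<^sup>2 - 10 * x + 11) * x"
      by (simp add: den_def algebra_simps power2_eq_square power3_eq_cube)
    finally show ?thesis by (simp add: c2_def)
  qed
  have Dq: "qD (qc p) = fps_const (- 6 / ((x - 2) * (x - 3))) * qD A + qD r"
    unfolding r(2) by (simp only: qD_add qD_const_mult)
  have Eq: "E2 * qc p = fps_const (- 6 / ((x - 2) * (x - 3))) * (E2 * A) + E2 * r"
    unfolding r(2) by (simp only: distrib_left mult.left_commute)
  have main: "vc (l + 1) - fps_const 6 * qD (qc p) + fps_const (1/4) * (E2 * qc p)
     = fps_const (36 / ((x - 2) * (x - 3)) - 12 / ((x + 1) * (x + 2))) * qD A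
      + fps_const (1 - (3/2) / ((x - 2) * (x - 3)) - (3/2) / ((x + 1) * (x + 2))) * (E2 * A)
      + (fps_const 2 * t + (fps_const (1/4) * (E2 * r) - fps_const 6 * qD r))"
  proof (rule fps_ext)
    fix n
    define u where "u = 1 / ((x - 2) * (x - 3))"
    define w where "w = 1 / ((x + 1) * (x + 2))"
    have e: "- 6 / ((x - 2) * (x - 3)) = - 6 * u" "36 / ((x - 2) * (x - 3)) = 36 * u" "(3/2) / ((x - 2) * (x - 3)) = (3/2) * u"
      "12 / ((x + 1) * (x + 2)) = 12 * w" "(3/2) / ((x + 1) * (x + 2)) = (3/2) * w"
      by (simp_all add: u_def w_def)
    show "fps_nth (vc (l + 1) - fps_const 6 * qD (qc p) + fps_const (1/4) * (E2 * qc p)) n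
     = fps_nth (fps_const (36 / ((x - 2) * (x - 3)) - 12 / ((x + 1) * (x + 2))) * qD A
      + fps_const (1 - (3/2) / ((x - 2) * (x - 3)) - (3/2) / ((x + 1) * (x + 2))) * (E2 * A)
      + (fps_const 2 * t + (fps_const (1/4) * (E2 * r) - fps_const 6 * qD r))) n"
      unfolding v Beq Dq Eq e w_def[symmetric] fps_add_nth fps_sub_nth fps_mult_left_const_nth by (simp add: algebra_simps)
  qed
  also have "\<dots> = fps_const c1 * qD (fps_const x * A) + fps_const c2 * (E2 * (fps_const x * A))
      + (fps_const 2 * t + (fps_const (1/4) * (E2 * r) - fps_const 6 * qD r))"
  proof -
    have "fps_const (c1 * x) * qD A = fps_const c1 * qD (fps_const x * A)"
      unfolding qD_const_mult mult.assoc[symmetric] fps_const_mult ..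
    moreover have "fps_const (c2 * x) * (E2 * A) = fps_const c2 * (E2 * (fps_const x * A))"
      unfolding mult.left_commute[of E2 "fps_const x"] unfolding mult.assoc[symmetric] fps_const_mult ..
    ultimately show ?thesis unfolding k1 k2 by (simp only:)
  qed
  also have "\<dots> \<in> Xfilt l (l + 1)"
  proof -
    have xA: "fps_const x * A \<in> Xfilt l p" unfolding x_def A_def p_def by (rule mu_pred_l_Xfilt[OF l])
    have "qD (fps_const x * A) \<in> Xfilt l (l + 1)" using Xfilt_qD[OF l xA] unfolding p .
    moreover have "E2 * (fps_const x * A) \<in> Xfilt l (l + 1)" using Xfilt_E2_mult[OF l(1) xA] unfolding p .
    moreover have "fps_const (1/4) * (E2 * r) - fps_const 6 * qD r \<in> Xfilt l (l + 1)" using qc_step_Xfilt[OF l r(1)] unfolding p .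
    ultimately show ?thesis using t ci l by (intro Xfilt_add Xfilt_scale) auto
  qed
  finally show ?thesis unfolding p_def .
qed

text \<open>The factor (l+1)! holds a single l. At j = l + 1 it is spent on the division by l (l-1),
  at j = l - 1 on the denominator of \<open>mu\<close>, and at smaller positive even j the whole
  factorial absorbs the denominator of \<open>sig\<close>.\<close>

lemma target_Xfilt:
  assumes l: "prime l" "l > 3"
  shows "(\<Sum>j=0..l + 1. fps_const (fact (l + 1) * fps_nth sig (l + 1 - j)) * qc j) \<in> Xfilt l (l + 1)"
proof (rule Xfilt_sum)
  fix j assume j: "j \<in> {0..l + 1}"
  have odd: "odd l" using l prime_odd_nat[of l] by simp
  have half: "l_integral l ((1/2) ^ m)" for m using l_integral_power[OF l(1) l_integral_half[OF l]] .
  consider "odd j" | "even j" "j = l + 1" | "even j" "j = l - 1" | "even j" "j = 0" | "even j" "0 < j" "j < l - 1"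
  proof -
    have "j < l - 1 \<or> j = l - 1 \<or> j = l \<or> j = l + 1" using j l(2) by auto
    then show ?thesis using that odd by blast
  qed
  then show "fps_const (fact (l + 1) * fps_nth sig (l + 1 - j)) * qc j \<in> Xfilt l (l + 1)"
  proof cases
    case 1
    then have "fps_nth sig (l + 1 - j) = 0" using j odd by (simp add: sig_nth)
    then show ?thesis by (simp add: Xfilt_zero)
  next
    case 2
    define p where "p = l - 1"
    have p: "p > 0" "p + 2 = l + 1" "p + 1 = l" using l by (auto simp: p_def)
    have f: "fact (l + 1) = (of_nat (l + 1) * fact (l - 2) * (of_nat (p + 1) * of_nat p) :: rat)"
    proof -
      have "l - 1 = Suc (l - 2)" "l = Suc (l - 1)" using l by auto
      then have "fact (l - 1) = (of_nat (l - 1) * fact (l - 2) :: rat)" "fact l = (of_nat l * fact (l - 1) :: rat)"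
        by (metis fact_Suc)+
      then show ?thesis unfolding p by (simp add: p_def mult_ac)
    qed
    let ?Z = "vc (l + 1) - fps_const 6 * qD (qc p) + fps_const (1/4) * (E2 * qc p)"
    have "qc j = fps_const (1 / (of_nat (p + 1) * of_nat p)) * ?Z" using qc_next[OF p(1)] 2 unfolding p by simp
    then have "fps_const (fact (l + 1) * fps_nth sig (l + 1 - j)) * qc j = fps_const (fact (l + 1) * (1 / (of_nat (p + 1) * of_nat p))) * ?Z"
      using 2 by (simp add: sig_0 mult.assoc[symmetric])
    also have "fact (l + 1) * (1 / (of_nat (p + 1) * of_nat p)) = (of_nat ((l + 1) * fact (l - 2)) :: rat)"
    proof -
      have "of_nat (p + 1) * of_nat p \<noteq> (0 :: rat)" using p(1) by simp
      then show ?thesis unfolding f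
        by (simp only: of_nat_mult of_nat_fact times_divide_eq_right mult_1_right nonzero_mult_div_cancel_right not_False_eq_True)
    qed
    also have "fps_const (of_nat ((l + 1) * fact (l - 2))) * ?Z \<in> Xfilt l (l + 1)"
      using top_coefficient_Xfilt[OF l] unfolding p_def by (intro Xfilt_scale l_integral_of_nat l)
    finally show ?thesis .
  next
    case 3
    obtain r where r: "r \<in> Xfilt l (l - 1)" "qc (l - 1) = fps_const (- 6 / ((of_nat l - 2) * (of_nat l - 3))) * fps_nth mu (l - 1) + r"
      using qc_pred_l[OF l] by blast
    define c where "c = (- 6 / ((of_nat l - 2) * (of_nat l - 3)) :: rat)"
    have c: "l_integral l c"
    proof -
      have "c = - (6 * (1 / of_nat (l - 2) * (1 / of_nat (l - 3))))" using l by (simp add: c_def of_nat_diff)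
      then show ?thesis using l by (simp only:) (intro l_integral_minus l_integral_mult l_integral_inverse_small l_integral_numeral, auto)
    qed
    have "fps_const (of_nat l) * qc (l - 1) = fps_const c * (fps_const (of_nat l) * fps_nth mu (l - 1)) + fps_const (of_nat l) * r"
      unfolding r(2) c_def[symmetric] by (simp only: distrib_left mult.left_commute)
    also have "\<dots> \<in> Xfilt l (l - 1)"
      by (intro Xfilt_add Xfilt_scale l c mu_pred_l_Xfilt r(1) l_integral_of_nat)
    finally have lq: "fps_const (of_nat l) * qc (l - 1) \<in> Xfilt l (l + 1)" by (rule Xfilt_mono) simp
    have s2: "fps_nth sig (l + 1 - j) = 1/24" using 3 l by (simp add: sig_nth eval_nat_numeral)
    have fl: "fact (l + 1) = (of_nat (l + 1) * fact (l - 1) * of_nat l :: rat)"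
      using l fact_reduce[of l, where 'a=rat] by (simp add: mult_ac)
    have "fps_const (fact (l + 1) * fps_nth sig (l + 1 - j)) * qc j = fps_const (of_nat ((l + 1) * fact (l - 1)) * (1/24)) * (fps_const (of_nat l) * qc (l - 1))"
      unfolding s2 fl mult.assoc[symmetric] fps_const_mult by (simp only: 3 of_nat_mult of_nat_fact mult_ac)
    also have "\<dots> \<in> Xfilt l (l + 1)"
      by (intro Xfilt_scale l_integral_mult l_integral_of_nat l_integral_24th l lq)
    finally show ?thesis .
  next
    case 4
    \<comment> \<open>At j = 0 the denominator (l+2)! of \<open>sig\<close> exceeds (l+1)! by the
      factor l + 2, which is prime to l.\<close>
    have "\<not> l dvd l + 2" unfolding dvd_add_triv_left_iff using l by (auto dest: dvd_imp_le)
    then have i: "l_integral l (1 / of_nat (l + 2))" by (intro l_integral_inverse_nat l)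
    have "fact (l + 1) * fps_nth sig (l + 1 - j) = (1/2) ^ (l + 1) * (1 / of_nat (l + 2))"
    proof -
      have "fps_nth sig (l + 1) = (1/2) ^ (l + 1) / fact (l + 2)" using odd by (simp add: sig_nth del: fact_Suc power_Suc)
      moreover have "fact (l + 2) = (of_nat (l + 2) * fact (l + 1) :: rat)" by simp
      moreover have "fact (l + 1) \<noteq> (0 :: rat)" by (rule fact_nonzero)
      ultimately show ?thesis using 4 by (simp del: fact_Suc power_Suc of_nat_add of_nat_Suc)
    qed
    then show ?thesis using 4 by (simp only: qc_0) (intro Xfilt_scale l_integral_mult half i l Xfilt_1)
  next
    case 5
    have "(fact (l + 2 - j) :: nat) dvd fact (l + 1)" using 5 by (intro fact_dvd) simp
    then obtain d where d: "(fact (l + 1) :: nat) = fact (l + 2 - j) * d" by (elim dvdE)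
    have "fact (l + 1) = (fact (l + 2 - j) * of_nat d :: rat)" using arg_cong[OF d, of "of_nat :: nat \<Rightarrow> rat"] by (simp del: fact_Suc)
    moreover have "fps_nth sig (l + 1 - j) = (1/2) ^ (l + 1 - j) / fact (l + 2 - j)"
      using 5 odd by (simp add: sig_nth Suc_diff_le del: fact_Suc)
    ultimately have "fact (l + 1) * fps_nth sig (l + 1 - j) = (1/2) ^ (l + 1 - j) * of_nat d" by simp
    moreover have "qc j \<in> Xfilt l (l + 1)"
    proof (rule Xfilt_mono)
      show "qc j \<in> Xfilt l j" using qc_Xfilt[OF l, of "j div 2"] 5 by simp
    qed (use 5 in simp)
    ultimately show ?thesis by (simp only:) (intro Xfilt_scale l_integral_mult half l_integral_of_nat l)
  qed
qed

theorem theorem7p4: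
  fixes l :: nat
  assumes "prime l" and "l > 3"
  shows "Rgen (l + 1) - poly_delta (Ppoly ((l + 1) div 2)) (Rgen 2) \<in> PXset l (l + 1)"
proof -
  have "odd l" using assms prime_odd_nat[of l] by simp
  then have k: "2 * ((l + 1) div 2) = l + 1" by simp
  have "(l + 1) div 2 \<ge> 1" using assms by simp
  from target_qc[OF this] have "Rgen (l + 1) - poly_delta (Ppoly ((l + 1) div 2)) (Rgen 2)
      = Pgen * (\<Sum>j=0..l + 1. fps_const (fact (l + 1) * fps_nth sig (l + 1 - j)) * qc j)"
    unfolding k .
  moreover have "(\<Sum>j=0..l + 1. fps_const (fact (l + 1) * fps_nth sig (l + 1 - j)) * qc j) \<in> Xset l (l + 1)"
    by (intro Xfilt_subset_Xset target_Xfilt assms)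
  ultimately show ?thesis unfolding PXset_def by blast
qed

end
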